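(* Let $\alpha>0$ and $M>0$. Let $\hat f_n$ be the BlockJS estimator (defined in the context), and let $0<x_0<1$ and $c_n=d_nn^{-1/(1+2\alpha)}$ with $d_n\ge 0$. Suppose the wavelet $\psi$ is $r$-regular with $r>\alpha$. (i) If $\limsup_{n\to\infty}d_n(\log n)^{-1/(1+2\alpha)}<\infty$, then $$\limsup_{n\to\infty}\Big(\frac{n}{\log n}\Big)^{2\alpha/(1+2\alpha)}\sup_{f\in F(\alpha,M)}R(\hat f_n,f;x_0,c_n)<\infty.$$ (ii) If $\liminf_{n\to\infty}d_n(\log n)^{-1/(1+2\alpha)}=\infty$ and $\limsup_{n\to\infty}d_n[(\log n)(\log\log n)]^{-1}=0$, then $$\limsup_{n\to\infty}n^{2\alpha/(1+2\alpha)}\frac{d_n}{(\log n)(\log\log n)}\sup_{f\in F(\alpha,M)}R(\hat f_n,f;x_0,c_n)<\infty.$$ (iii) If $\liminf_{n\to\infty}d_n[(\log n)(\log\log n)]^{-1}>0$, then $$\limsup_{n\to\infty}n^{2\alpha/(1+2\alpha)}\sup_{f\in F(\alpha,M)}R(\hat f_n,f;x_0,c_n)<\infty.$$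
   Context: Observation model: for each $n$ one observes $Z_n^*(t)=\int_0^t f(x)\,dx+\frac{1}{\sqrt n}B^*(t)$, $0\le t\le 1$, with $B^*$ a standard Brownian motion and $f:[0,1]\to\mathbb{R}$ unknown; $E_f$ is expectation when the true function is $f$. Hölder class: $F(\alpha,M)=\{f:|f^{(k)}(x)-f^{(k)}(y)|\le M|x-y|^{\alpha-k},\ 0\le x<y\le 1\}$, where $k$ is the greatest integer strictly less than $\alpha$. Risk: $R(\hat f_n,f;x_0,c_n)=\frac{1}{2c_n}E_f\int_{x_0-c_n}^{x_0+c_n}(\hat f_n(x)-f(x))^2\,dx$ when $c_n>0$; $c_n=0$ is interpreted as the pointwise risk $E_f(\hat f_n(x_0)-f(x_0))^2$. The neighborhoods satisfy $[x_0-c_n,x_0+c_n]\subset[0,1]$. Wavelets: $\phi,\psi$ are compactly supported father and mother wavelets with $\int\phi=1$; $\psi$ is $r$-regular, meaning it has $r$ vanishing moments and $r$ continuous derivatives. Put $\phi_{j,k}(t)=2^{j/2}\phi(2^jt-k)$, $\psi_{j,k}(t)=2^{j/2}\psi(2^jt-k)$. For a fixed coarse level $j_0$, the collection $\{\phi_{j_0,k},1\le k\le 2^{j_0};\ \psi_{j,k},j\ge j_0,1\le k\le 2^j\}$, with the standard boundary corrections (Cohen–Daubechies–Jawerth–Vial), is an orthonormal basis of $L^2[0,1]$. The empirical coefficients are $\tilde y_{j_0,k}=\int\phi_{j_0,k}\,dZ_n^*$ and $y_{j,k}=\int\psi_{j,k}\,dZ_n^*$; equivalently $\tilde y_{j_0,k}=\xi_{j_0,k}+n^{-1/2}\tilde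 z_{j_0,k}$, $y_{j,k}=\theta_{j,k}+n^{-1/2}z_{j,k}$ with $\xi_{j_0,k}=\int f\phi_{j_0,k}$, $\theta_{j,k}=\int f\psi_{j,k}$ and i.i.d. $N(0,1)$ noise. BlockJS estimator: let $J=[\log_2 n]$, $L=\log n$ (natural logarithm; as a block length it is understood as rounded to an integer), and let $\lambda_*=4.50524\ldots$ be the root larger than 1 of $\lambda-\log\lambda-1=2$. At each level $j_0\le j<J$ divide the indices into non-overlapping consecutive blocks $(jb)=\{k:(b-1)L+1\le k\le bL\}$ covering $1\le k\le 2^j$, and put $S_{(jb)}^2=\sum_{k\in(jb)}y_{j,k}^2$. Set $$\hat\theta_{j,k}=\begin{cases}\big(1-\frac{\lambda_*Ln^{-1}}{S_{(jb)}^2}\big)_+y_{j,k}, & k\in(jb),\ j_0\le j<J,\\ 0,& j\ge J,\end{cases}$$ and $\hat f_n(x)=\sum_{k=1}^{2^{j_0}}\tilde y_{j_0,k}\phi_{j_0,k}(x)+\sum_{j=j_0}^\infty\sum_{k=1}^{2^j}\hat\theta_{j,k}\psi_{j,k}(x)$. *)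

theory Defs
  imports "HOL-Probability.Probability"
begin

definition partition01 :: "nat \<Rightarrow> (nat \<Rightarrow> real) \<Rightarrow> bool" where
  "partition01 m p \<longleftrightarrow> 0 \<le> p 0 \<and> (\<forall>i<m. p i \<le> p (Suc i)) \<and> p m \<le> 1"

definition brownian_motion :: "'w measure \<Rightarrow> (real \<Rightarrow> 'w \<Rightarrow> real) \<Rightarrow> bool" where
  "brownian_motion P B \<longleftrightarrow>
     prob_space P \<and>
     (\<forall>t\<in>{0..1}. B t \<in> borel_measurable P) \<and>
     (AE \<omega> in P. B 0 \<omega> = 0) \<and>
     (\<forall>m p. partition01 m p \<longrightarrow>
        prob_space.indep_vars P (\<lambda>_. borel) (\<lambda>i \<omega>. B (p (Suc i)) \<omega> - B (p i) \<omega>) {..<m}) \<and>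
     (\<forall>s t. 0 \<le> s \<and> s < t \<and> t \<le> 1 \<longrightarrow>
        distributed P lborel (\<lambda>\<omega>. B t \<omega> - B s \<omega>)
          (\<lambda>x. ennreal (normal_density 0 (sqrt (t - s)) x))) \<and>
     (AE \<omega> in P. continuous_on {0..1} (\<lambda>t. B t \<omega>))"

definition observation :: "(real \<Rightarrow> 'w \<Rightarrow> real) \<Rightarrow> nat \<Rightarrow> (real \<Rightarrow> real) \<Rightarrow> real \<Rightarrow> 'w \<Rightarrow> real" where
  "observation B n f t \<omega> = (LINT x:{0..t}|lborel. f x) + 1 / sqrt (real n) * B t \<omega>"

text \<open>
  Wiener integral of a deterministic g over [0,1] with respect to a process Z: the L2(P)-limit of
  the elementary integrals of step functions that converge to g in L2[0,1].  It is determined up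
  to P-null sets; \<open>stoch_integral\<close> picks a version.
\<close>

definition step_fun :: "nat \<Rightarrow> (nat \<Rightarrow> real) \<Rightarrow> (nat \<Rightarrow> real) \<Rightarrow> real \<Rightarrow> real" where
  "step_fun m p a t = (\<Sum>i<m. a i * indicator {p i<..p (Suc i)} t)"

definition step_integral ::
    "(real \<Rightarrow> 'w \<Rightarrow> real) \<Rightarrow> nat \<Rightarrow> (nat \<Rightarrow> real) \<Rightarrow> (nat \<Rightarrow> real) \<Rightarrow> 'w \<Rightarrow> real" where
  "step_integral Z m p a \<omega> = (\<Sum>i<m. a i * (Z (p (Suc i)) \<omega> - Z (p i) \<omega>))"

definition has_stoch_integral ::
    "'w measure \<Rightarrow> (real \<Rightarrow> 'w \<Rightarrow> real) \<Rightarrow> (real \<Rightarrow> real) \<Rightarrow> ('w \<Rightarrow> real) \<Rightarrow> bool" where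
  "has_stoch_integral P Z g W \<longleftrightarrow>
     W \<in> borel_measurable P \<and>
     (\<exists>m p a. (\<forall>l. partition01 (m l) (p l)) \<and>
        (\<lambda>l::nat. \<integral>\<^sup>+t\<in>{0..1}. ennreal ((g t - step_fun (m l) (p l) (a l) t)\<^sup>2) \<partial>lborel)
          \<longlonglongrightarrow> 0 \<and>
        (\<lambda>l::nat. \<integral>\<^sup>+\<omega>. ennreal ((W \<omega> - step_integral Z (m l) (p l) (a l) \<omega>)\<^sup>2) \<partial>P)
          \<longlonglongrightarrow> 0)"

definition stoch_integral ::
    "'w measure \<Rightarrow> (real \<Rightarrow> 'w \<Rightarrow> real) \<Rightarrow> (real \<Rightarrow> real) \<Rightarrow> 'w \<Rightarrow> real" where
  "stoch_integral P Z g = (SOME W. has_stoch_integral P Z g W)"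

text \<open>D 0, ..., D k are f and its derivatives on S, one-sided at the boundary of an interval.\<close>

definition derivs_on :: "real set \<Rightarrow> nat \<Rightarrow> (real \<Rightarrow> real) \<Rightarrow> (nat \<Rightarrow> real \<Rightarrow> real) \<Rightarrow> bool" where
  "derivs_on S k f D \<longleftrightarrow>
     (\<forall>x\<in>S. D 0 x = f x) \<and>
     (\<forall>i<k. \<forall>x\<in>S. (D i has_real_derivative D (Suc i) x) (at x within S))"

text \<open>For positive \<open>\<alpha>\<close>, the greatest integer strictly less than \<open>\<alpha>\<close> is \<open>\<lceil>\<alpha>\<rceil> - 1\<close>.\<close>

definition holder_class :: "real \<Rightarrow> real \<Rightarrow> (real \<Rightarrow> real) set" where
  "holder_class \<alpha> M =
     (let k = nat (\<lceil>\<alpha>\<rceil> - 1) in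
      {f. \<exists>D. derivs_on {0..1} k f D \<and>
          (\<forall>x y. 0 \<le> x \<and> x < y \<and> y \<le> 1 \<longrightarrow>
             \<bar>D k x - D k y\<bar> \<le> M * \<bar>x - y\<bar> powr (\<alpha> - real k))})"

definition square_integrable :: "real measure \<Rightarrow> (real \<Rightarrow> real) \<Rightarrow> bool" where
  "square_integrable \<mu> g \<longleftrightarrow> g \<in> borel_measurable \<mu> \<and> integrable \<mu> (\<lambda>x. (g x)\<^sup>2)"

definition L2_orthonormal_basis ::
    "real measure \<Rightarrow> 'i set \<Rightarrow> ('i \<Rightarrow> real \<Rightarrow> real) \<Rightarrow> bool" where
  "L2_orthonormal_basis \<mu> I e \<longleftrightarrow>
     (\<forall>i\<in>I. square_integrable \<mu> (e i)) \<and>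
     (\<forall>i\<in>I. \<forall>j\<in>I. (LINT x|\<mu>. e i x * e j x) = (if i = j then 1 else 0)) \<and>
     (\<forall>g \<epsilon>. square_integrable \<mu> g \<and> \<epsilon> > 0 \<longrightarrow>
        (\<exists>A c. finite A \<and> A \<subseteq> I \<and> (LINT x|\<mu>. (g x - (\<Sum>i\<in>A. c i * e i x))\<^sup>2) < \<epsilon>))"

definition dilate :: "(real \<Rightarrow> real) \<Rightarrow> nat \<Rightarrow> int \<Rightarrow> real \<Rightarrow> real" where
  "dilate \<eta> j k t = 2 powr (real j / 2) * \<eta> (2 ^ j * t - of_int k)"

text \<open>On S, \<open>\<eta>\<close> is a finite linear combination of the functions \<open>\<phi>(s x - k)\<close>, k an integer.\<close>

definition finite_comb_on ::
    "real set \<Rightarrow> (real \<Rightarrow> real) \<Rightarrow> real \<Rightarrow> (real \<Rightarrow> real) \<Rightarrow> bool" where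
  "finite_comb_on S \<phi> s \<eta> \<longleftrightarrow>
     (\<exists>h :: int \<Rightarrow> real. finite {k. h k \<noteq> 0} \<and>
        (\<forall>x\<in>S. \<eta> x = (\<Sum>k | h k \<noteq> 0. h k * \<phi> (s * x - of_int k))))"

text \<open>
  Compactly supported father and mother wavelet of a multiresolution analysis of L2 of the real
  line.  With the two-scale relations, the basis property says that the spaces \<open>V\<^sub>j\<close> spanned by
  the \<open>\<phi>\<^sub>j\<^sub>,\<^sub>k\<close> increase to the whole space and that the \<open>\<psi>\<^sub>j\<^sub>,\<^sub>k\<close> are an orthonormal basis of the
  complement of \<open>V\<^sub>j\<close> in the next space: dilating the basis by 2 shows that this complement
  contains nothing else.  Since functions are evaluated pointwise below, \<open>\<phi>\<close> is required to be the
  continuous version.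
\<close>

definition wavelet_pair :: "(real \<Rightarrow> real) \<Rightarrow> (real \<Rightarrow> real) \<Rightarrow> bool" where
  "wavelet_pair \<phi> \<psi> \<longleftrightarrow>
     (\<exists>K. \<forall>x. K < \<bar>x\<bar> \<longrightarrow> \<phi> x = 0 \<and> \<psi> x = 0) \<and>
     continuous_on UNIV \<phi> \<and>
     (LINT x|lborel. \<phi> x) = 1 \<and>
     finite_comb_on UNIV \<phi> 2 \<phi> \<and>
     finite_comb_on UNIV \<phi> 2 \<psi> \<and>
     L2_orthonormal_basis lborel (UNIV :: (int + nat \<times> int) set)
       (case_sum (dilate \<phi> 0) (\<lambda>(j, k). dilate \<psi> j k))"

definition regular_wavelet :: "nat \<Rightarrow> (real \<Rightarrow> real) \<Rightarrow> bool" where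
  "regular_wavelet r \<psi> \<longleftrightarrow>
     (\<forall>i<r. (LINT x|lborel. x ^ i * \<psi> x) = 0) \<and>
     (\<exists>D. derivs_on UNIV r \<psi> D \<and> continuous_on UNIV (D r))"

text \<open>
  Cohen--Daubechies--Jawerth--Vial boundary correction of the family \<open>\<eta>\<^sub>j\<^sub>,\<^sub>k\<close>, \<open>1 \<le> k \<le> 2\<^sup>j\<close>, on
  [0,1].  The first and the last N members are replaced by dilates of N fixed left-edge and N
  fixed right-edge functions; on their half line these are finite linear combinations of the
  functions \<open>\<phi>(s x - m)\<close> (s = 1 for scaling functions, s = 2 for wavelets).  The member k from the
  right end is dilated about the point 1.
\<close>

definition boundary_corrected ::
    "nat \<Rightarrow> (real \<Rightarrow> real) \<Rightarrow> real \<Rightarrow> nat \<Rightarrow> (real \<Rightarrow> real) \<Rightarrow> (nat \<Rightarrow> nat \<Rightarrow> real \<Rightarrow> real) \<Rightarrow> bool" where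
  "boundary_corrected N \<phi> s j\<^sub>0 \<eta> \<eta>I \<longleftrightarrow>
     (\<exists>\<eta>L \<eta>R :: nat \<Rightarrow> real \<Rightarrow> real.
        (\<forall>i\<in>{1..N}.
           finite_comb_on {0..} \<phi> s (\<eta>L i) \<and> (\<forall>x > 2 * real N. \<eta>L i x = 0) \<and>
           finite_comb_on {..0} \<phi> s (\<eta>R i) \<and> (\<forall>x < - 2 * real N. \<eta>R i x = 0)) \<and>
        (\<forall>j\<ge>j\<^sub>0. \<forall>k\<in>{1..2 ^ j}. \<forall>t\<in>{0..1}.
           \<eta>I j k t =
             (if k \<le> N then dilate (\<eta>L k) j 0 t
              else if k \<le> 2 ^ j - N then dilate \<eta> j (int k) t
              else dilate (\<eta>R (2 ^ j + 1 - k)) j (2 ^ j) t)))"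

text \<open>
  The support of \<open>\<phi>\<close> and \<open>\<psi>\<close> in [-N,N] is a normalisation (translate by an integer, enlarge N); it
  makes the uncorrected members, \<open>N < k \<le> 2\<^sup>j - N\<close>, supported in [0,1].  As in the construction,
  the corrected wavelets keep the r vanishing moments.
\<close>

definition interval_wavelet_basis ::
    "(real \<Rightarrow> real) \<Rightarrow> (real \<Rightarrow> real) \<Rightarrow> nat \<Rightarrow> nat \<Rightarrow>
     (nat \<Rightarrow> nat \<Rightarrow> real \<Rightarrow> real) \<Rightarrow> (nat \<Rightarrow> nat \<Rightarrow> real \<Rightarrow> real) \<Rightarrow> bool" where
  "interval_wavelet_basis \<phi> \<psi> r j\<^sub>0 \<phi>I \<psi>I \<longleftrightarrow>
     (\<exists>N. 2 * N \<le> 2 ^ j\<^sub>0 \<and>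
        (\<forall>x. real N < \<bar>x\<bar> \<longrightarrow> \<phi> x = 0 \<and> \<psi> x = 0) \<and>
        boundary_corrected N \<phi> 1 j\<^sub>0 \<phi> \<phi>I \<and>
        boundary_corrected N \<phi> 2 j\<^sub>0 \<psi> \<psi>I) \<and>
     (\<forall>j\<ge>j\<^sub>0. \<forall>k\<in>{1..2 ^ j}. \<forall>i<r. (LINT t:{0..1}|lborel. t ^ i * \<psi>I j k t) = 0) \<and>
     L2_orthonormal_basis (restrict_space lborel {0..1})
       (Inl ` {1..2 ^ j\<^sub>0} \<union> Inr ` (SIGMA j:{j\<^sub>0..}. {1..2 ^ j}))
       (case_sum (\<phi>I j\<^sub>0) (\<lambda>(j, k). \<psi>I j k))"

definition lambda_star :: real where
  "lambda_star = (THE l. l > 1 \<and> l - ln l - 1 = 2)"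

definition block_length :: "nat \<Rightarrow> nat" where
  "block_length n = nat (round (ln (real n)))"

text \<open>The last block of a level is cut off at \<open>2\<^sup>j\<close>.\<close>

definition block :: "nat \<Rightarrow> nat \<Rightarrow> nat \<Rightarrow> nat set" where
  "block n j b = {k \<in> {1..2 ^ j}. (b - 1) * block_length n + 1 \<le> k \<and> k \<le> b * block_length n}"

definition block_of :: "nat \<Rightarrow> nat \<Rightarrow> nat" where
  "block_of n k = (k - 1) div block_length n + 1"

definition block_energy :: "nat \<Rightarrow> (nat \<Rightarrow> nat \<Rightarrow> real) \<Rightarrow> nat \<Rightarrow> nat \<Rightarrow> real" where
  "block_energy n y j b = (\<Sum>k\<in>block n j b. (y j k)\<^sup>2)"

definition block_js_coeff :: "nat \<Rightarrow> (nat \<Rightarrow> nat \<Rightarrow> real) \<Rightarrow> nat \<Rightarrow> nat \<Rightarrow> real" where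
  "block_js_coeff n y j k =
     (if int j < \<lfloor>log 2 (real n)\<rfloor>
      then max 0 (1 - (lambda_star * ln (real n) / real n) / block_energy n y j (block_of n k)) * y j k
      else 0)"

definition block_js ::
    "'w measure \<Rightarrow> (nat \<Rightarrow> nat \<Rightarrow> real \<Rightarrow> real) \<Rightarrow> (nat \<Rightarrow> nat \<Rightarrow> real \<Rightarrow> real) \<Rightarrow> nat \<Rightarrow> nat \<Rightarrow>
     (real \<Rightarrow> 'w \<Rightarrow> real) \<Rightarrow> 'w \<Rightarrow> real \<Rightarrow> real" where
  "block_js P \<phi>I \<psi>I j\<^sub>0 n Z \<omega> x =
     (\<Sum>k=1..2 ^ j\<^sub>0. stoch_integral P Z (\<phi>I j\<^sub>0 k) \<omega> * \<phi>I j\<^sub>0 k x) +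
     (\<Sum>i. \<Sum>k=1..2 ^ (j\<^sub>0 + i).
        block_js_coeff n (\<lambda>j k. stoch_integral P Z (\<psi>I j k) \<omega>) (j\<^sub>0 + i) k * \<psi>I (j\<^sub>0 + i) k x)"

definition local_risk ::
    "'w measure \<Rightarrow> ('w \<Rightarrow> real \<Rightarrow> real) \<Rightarrow> (real \<Rightarrow> real) \<Rightarrow> real \<Rightarrow> real \<Rightarrow> ennreal" where
  "local_risk P fhat f x\<^sub>0 c =
     (if c > 0
      then ennreal (1 / (2 * c)) *
        (\<integral>\<^sup>+\<omega>. (\<integral>\<^sup>+x\<in>{x\<^sub>0 - c..x\<^sub>0 + c}. ennreal ((fhat \<omega> x - f x)\<^sup>2) \<partial>lborel) \<partial>P)
      else (\<integral>\<^sup>+\<omega>. ennreal ((fhat \<omega> x\<^sub>0 - f x\<^sub>0)\<^sup>2) \<partial>P))"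

end

theory Submission
  imports Defs
begin

text \<open>
  Write $y_{j,k} = \theta_{j,k} + n^{-1/2} z_{j,k}$ for the empirical wavelet coefficients and $\tau = \lambda_* (\log n) / n$
  for the threshold.  A block is set to zero when its energy is at most $\tau$ and is shrunk towards zero otherwise.
  Three bounds for the coefficient error $\hat\theta_{j,k} - \theta_{j,k}$ carry the proof:
  it is at most $|\theta_{j,k}| + n^{-1/2} |z_{j,k}|$, because the shrinkage factor lies in $[0,1]$;
  over a block its square sums to at most a multiple of $n^{-1} \sum z^2 + \tau$;
  and in a block whose signal energy is a small multiple of $\tau$ it is at most $|\theta_{j,k}|$ unless the noise energy
  of the block exceeds almost $\lambda_* \log n$.  The number $\lambda_*$ is chosen such that this last event has probability
  about $n^{-1}$, which is small enough to be summed over all levels $2^j \le n$.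
  Taylor expansion and vanishing moments give $|\theta_{j,k}| \le K 2^{-j(\alpha + 1/2)}$ uniformly over the Hoelder class.
  
  The noise enters through its joint exponential moments: $E \exp(\sum_k u_k z_{j,k}) \le \exp(|u|^2/2)$.
  For step functions this is a product over independent Gaussian increments on a common refinement of the partitions,
  and it passes to Wiener integrals by the lemma of Fatou (\<open>wiener_exp_moment\<close>).  Averaging over a Gaussian vector $u$ turns it
  into $E \exp(t \sum_k z_{j,k}^2) \le (1 - 2t)^{-m/2}$ for a block of $m$ coefficients
  (\<open>chi_square_exp_moment\<close>), hence into the tail bound \<open>chi_square_tail\<close>.
  
  Case (i) is a bound for the risk at each point.  The root mean squares of the levels add up: only boundedly many wavelets
  of a level are nonzero at $x$, so level $j$ contributes $2^{j/2}$ times a coefficient error, and this is of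
  the order $\sqrt{(\log n)/n}$ when $2^j \le (n / \log n)^{1/(1+2\alpha)}$, of the order $|\theta| + n^{-1/2}$ up to
  $2^j \approx n^{1/(1+2\alpha)}$, and of the order $|\theta|$ beyond.  All sums are geometric (\<open>pointwise_error_bound\<close>).
  Integrating over the neighbourhood preserves the bound.
  
  Cases (ii) and (iii) follow from one bound, of order $n^{-2\alpha/(1+2\alpha)} (1 + (\log n) (\log\log n) / d_n)$, for the risk over an
  interval of half-length $c > 0$ (\<open>local_risk_bound\<close>).  Levels with $2^j \le 1/c$ are treated
  pointwise as before and give $(\log n)/(n c)$.  For the finer levels the triangle inequality would lose a factor $\log\log n$; instead,
  orthonormality bounds the integral over the interval by the sum of all squared coefficient errors whose wavelets reach into it.
  They occupy about $2^j c / \log n + 1$ blocks, each costing $(\log n)/n$.  The extra block per level matters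
  only while $2^j c \le \log n$, and there are about $\log\log n$ such levels; this is the source of the iterated logarithm.
\<close>

section \<open>Step functions and their integrals\<close>

lemma partition01_mono:
  assumes "partition01 m p" "i \<le> j" "j \<le> m"
  shows "p i \<le> p j"
  using assms(2,3)
proof (induction j rule: dec_induct)
  case (step n)
  then have "p i \<le> p n" by simp
  also have "p n \<le> p (Suc n)" using assms(1) step by (auto simp: partition01_def)
  finally show ?case .
qed simp

lemma partition01_range:
  assumes "partition01 m p" "i \<le> m"
  shows "p i \<in> {0..1}"
  using partition01_mono[OF assms(1), of 0 i] partition01_mono[OF assms(1), of i m] assms
  by (auto simp: partition01_def)

text \<open>
  The refinement is stated for the increments of an arbitrary function, so that the same one serves for the paths
  of a process and, through \<open>step_fun_eq_increments\<close>, for the integrands: finitely many step functions and their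
  integrals are combined at the same time.
\<close>

lemma common_refinement:
  fixes m :: "'k \<Rightarrow> nat" and p a :: "'k \<Rightarrow> nat \<Rightarrow> real"
  assumes fin: "finite K" and part: "\<And>\<kappa>. \<kappa> \<in> K \<Longrightarrow> partition01 (m \<kappa>) (p \<kappa>)"
  obtains M q A where "partition01 M q"
    "\<And>F :: real \<Rightarrow> real. (\<Sum>\<kappa>\<in>K. \<Sum>i<m \<kappa>. a \<kappa> i * (F (p \<kappa> (Suc i)) - F (p \<kappa> i)))
       = (\<Sum>h<M. A h * (F (q (Suc h)) - F (q h)))"
proof -
  define T where "T = insert 0 (\<Union>\<kappa>\<in>K. p \<kappa> ` {..m \<kappa>})"
  have finT: "finite T" using fin by (auto simp: T_def)
  have T01: "T \<subseteq> {0..1}" using partition01_range[OF part] by (auto simp: T_def)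
  define xs where "xs = sorted_list_of_set T"
  have sxs: "sorted_wrt (<) xs" and set: "set xs = T"
    using finT by (auto simp: xs_def)
  define M where "M = length xs - 1"
  define q where "q i = xs ! i" for i
  have len: "length xs = Suc M" using set T_def by (cases xs) (auto simp: M_def)
  have le_iff: "xs ! i \<le> xs ! j \<longleftrightarrow> i \<le> j" if "i < length xs" "j < length xs" for i j
    using sorted_wrt_nth_less[OF sxs, of i j] sorted_wrt_nth_less[OF sxs, of j i] that
    by (cases i j rule: linorder_cases) auto
  have PM: "partition01 M q"
    unfolding partition01_def q_def
  proof (intro conjI allI impI)
    show "0 \<le> xs ! 0" "xs ! M \<le> 1"
      using T01 set len nth_mem[of 0 xs] nth_mem[of M xs] by auto
    show "xs ! i \<le> xs ! Suc i" if "i < M" for i using that len by (subst le_iff) auto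
  qed
  define A where "A h = (\<Sum>\<kappa>\<in>K. \<Sum>i<m \<kappa>. a \<kappa> i * of_bool (p \<kappa> i \<le> q h \<and> q (Suc h) \<le> p \<kappa> (Suc i)))" for h
  have key: "F t - F s = (\<Sum>h<M. of_bool (s \<le> q h \<and> q (Suc h) \<le> t) * (F (q (Suc h)) - F (q h)))"
    if st: "s \<in> T" "t \<in> T" "s \<le> t" for s t and F :: "real \<Rightarrow> real"
  proof -
    obtain u v where uv: "u < length xs" "v < length xs" "s = xs ! u" "t = xs ! v"
      using st(1,2) unfolding set[symmetric] in_set_conv_nth by auto
    have "u \<le> v" using le_iff[of u v] uv st by auto
    have "(\<Sum>h<M. of_bool (s \<le> q h \<and> q (Suc h) \<le> t) * (F (q (Suc h)) - F (q h)))
        = (\<Sum>h<M. of_bool (h \<in> {u..<v}) * (F (q (Suc h)) - F (q h)))"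
      unfolding uv q_def using le_iff uv len by (intro sum.cong refl) auto
    also have "\<dots> = (\<Sum>h\<in>{u..<v}. F (q (Suc h)) - F (q h))"
      using uv len by (intro sum.mono_neutral_cong_right) (auto split: if_splits)
    also have "\<dots> = F t - F s" using sum_Suc_diff'[OF \<open>u \<le> v\<close>, of "\<lambda>h. F (q h)"] uv by (simp add: q_def)
    finally show ?thesis by simp
  qed
  have "(\<Sum>\<kappa>\<in>K. \<Sum>i<m \<kappa>. a \<kappa> i * (F (p \<kappa> (Suc i)) - F (p \<kappa> i)))
       = (\<Sum>h<M. A h * (F (q (Suc h)) - F (q h)))" for F :: "real \<Rightarrow> real"
  proof -
    have "(\<Sum>\<kappa>\<in>K. \<Sum>i<m \<kappa>. a \<kappa> i * (F (p \<kappa> (Suc i)) - F (p \<kappa> i))) =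
      (\<Sum>\<kappa>\<in>K. \<Sum>i<m \<kappa>. a \<kappa> i * (\<Sum>h<M. of_bool (p \<kappa> i \<le> q h \<and> q (Suc h) \<le> p \<kappa> (Suc i)) * (F (q (Suc h)) - F (q h))))"
    proof (intro sum.cong refl)
      fix \<kappa> i assume *: "\<kappa> \<in> K" "i \<in> {..<m \<kappa>}"
      then have "p \<kappa> i \<in> T" "p \<kappa> (Suc i) \<in> T" unfolding T_def by (auto intro!: bexI[of _ \<kappa>] imageI)
      moreover have "p \<kappa> i \<le> p \<kappa> (Suc i)" using part[of \<kappa>] * by (auto simp: partition01_def)
      ultimately show "a \<kappa> i * (F (p \<kappa> (Suc i)) - F (p \<kappa> i)) = a \<kappa> i * (\<Sum>h<M. of_bool (p \<kappa> i \<le> q h \<and> q (Suc h) \<le> p \<kappa> (Suc i)) * (F (q (Suc h)) - F (q h)))"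
        using key by simp
    qed
    also have "\<dots> = (\<Sum>\<kappa>\<in>K. \<Sum>i<m \<kappa>. \<Sum>h<M. a \<kappa> i * of_bool (p \<kappa> i \<le> q h \<and> q (Suc h) \<le> p \<kappa> (Suc i)) * (F (q (Suc h)) - F (q h)))"
      by (simp only: sum_distrib_left mult.assoc)
    also have "\<dots> = (\<Sum>h<M. \<Sum>\<kappa>\<in>K. \<Sum>i<m \<kappa>. a \<kappa> i * of_bool (p \<kappa> i \<le> q h \<and> q (Suc h) \<le> p \<kappa> (Suc i)) * (F (q (Suc h)) - F (q h)))"
      by (rule trans[OF sum.cong[OF refl sum.swap] sum.swap])
    also have "\<dots> = (\<Sum>h<M. A h * (F (q (Suc h)) - F (q h)))"
      by (simp only: A_def sum_distrib_right)
    finally show ?thesis .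
  qed
  with PM show ?thesis by (rule that)
qed

text \<open>
  A step function at $x$ is the step integral of the deterministic process $t \mapsto 1(x \le t)$.
\<close>

lemma step_fun_eq_increments:
  assumes "partition01 m p"
  shows "step_fun m p a x = (\<Sum>i<m. a i * (of_bool (x \<le> p (Suc i)) - of_bool (x \<le> p i)))"
  unfolding step_fun_def using assms
  by (intro sum.cong refl) (force simp: partition01_def indicator_def)

lemma partition01_piece_unique:
  assumes "partition01 m p" "i < m" "x \<in> {p i<..p (Suc i)}" "j < m" "j \<noteq> i"
  shows "x \<notin> {p j<..p (Suc j)}"
proof (cases "j < i")
  case True
  then show ?thesis using partition01_mono[of m p "Suc j" i] assms by auto
next
  case False
  then show ?thesis using partition01_mono[of m p "Suc i" j] assms by auto
qed

lemma step_fun_on_piece: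
  assumes "partition01 m p" "i < m" "x \<in> {p i<..p (Suc i)}"
  shows "step_fun m p a x = a i"
proof -
  have "step_fun m p a x = (\<Sum>j<m. if j = i then a j else 0)"
    unfolding step_fun_def using partition01_piece_unique[OF assms] assms by (intro sum.cong refl) auto
  then show ?thesis using assms by simp
qed

lemma step_fun_square:
  assumes "partition01 m p"
  shows "(step_fun m p a x)\<^sup>2 = (\<Sum>i<m. (a i)\<^sup>2 * indicator {p i<..p (Suc i)} x)"
proof (cases "\<exists>i<m. x \<in> {p i<..p (Suc i)}")
  case True
  then obtain i where i: "i < m" "x \<in> {p i<..p (Suc i)}" by auto
  have "(\<Sum>j<m. (a j)\<^sup>2 * indicator {p j<..p (Suc j)} x) = (\<Sum>j<m. if j = i then (a j)\<^sup>2 else 0)"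
    using partition01_piece_unique[OF assms i] i by (intro sum.cong refl) auto
  then show ?thesis using i step_fun_on_piece[OF assms i] by simp
next
  case False
  then have "step_fun m p a x = 0" "(\<Sum>j<m. (a j)\<^sup>2 * indicator {p j<..p (Suc j)} x) = 0"
    unfolding step_fun_def by (auto intro!: sum.neutral)
  then show ?thesis by simp
qed

lemma step_fun_measurable [measurable]: "step_fun m p a \<in> borel_measurable borel"
  unfolding step_fun_def by measurable

lemma nn_integral_step_fun_square:
  assumes "partition01 m p"
  shows "(\<integral>\<^sup>+t\<in>{0..1}. ennreal ((step_fun m p a t)\<^sup>2) \<partial>lborel) = ennreal (\<Sum>i<m. (a i)\<^sup>2 * (p (Suc i) - p i))"
proof -
  have "(\<integral>\<^sup>+t\<in>{0..1}. ennreal ((step_fun m p a t)\<^sup>2) \<partial>lborel)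
      = (\<integral>\<^sup>+t. (\<Sum>i<m. ennreal ((a i)\<^sup>2) * indicator {p i<..p (Suc i)} t) \<partial>lborel)"
  proof (intro nn_integral_cong)
    fix t
    show "ennreal ((step_fun m p a t)\<^sup>2) * indicator {0..1} t = (\<Sum>i<m. ennreal ((a i)\<^sup>2) * indicator {p i<..p (Suc i)} t)"
    proof (cases "t \<in> {0..1}")
      case True
      then show ?thesis unfolding step_fun_square[OF assms]
        by (subst sum_ennreal[symmetric]) (auto intro!: sum.cong split: split_indicator)
    next
      case False
      then have "t \<notin> {p i<..p (Suc i)}" if "i < m" for i
        using partition01_range[OF assms, of i] partition01_range[OF assms, of "Suc i"] that by auto
      then show ?thesis using False by auto
    qed
  qed
  also have "\<dots> = (\<Sum>i<m. ennreal ((a i)\<^sup>2) * emeasure lborel {p i<..p (Suc i)})"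
    by (subst nn_integral_sum) (auto intro!: sum.cong nn_integral_cmult_indicator)
  also have "\<dots> = (\<Sum>i<m. ennreal ((a i)\<^sup>2 * (p (Suc i) - p i)))"
    using assms by (intro sum.cong refl) (auto simp: partition01_def ennreal_mult)
  also have "\<dots> = ennreal (\<Sum>i<m. (a i)\<^sup>2 * (p (Suc i) - p i))"
    using assms by (intro sum_ennreal) (auto simp: partition01_def)
  finally show ?thesis .
qed

lemma normal_exp_moment:
  assumes "\<sigma> > 0"
  shows "(\<integral>\<^sup>+x. ennreal (normal_density 0 \<sigma> x) * ennreal (exp (a * x)) \<partial>lborel) = ennreal (exp (a\<^sup>2 * \<sigma>\<^sup>2 / 2))"
proof -
  have "normal_density 0 \<sigma> x * exp (a * x) = exp (a\<^sup>2 * \<sigma>\<^sup>2 / 2) * normal_density (a * \<sigma>\<^sup>2) \<sigma> x" for x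
  proof -
    have "- x\<^sup>2 / (2 * \<sigma>\<^sup>2) + a * x = a\<^sup>2 * \<sigma>\<^sup>2 / 2 + - (x - a * \<sigma>\<^sup>2)\<^sup>2 / (2 * \<sigma>\<^sup>2)"
      using assms by (simp add: field_simps power2_eq_square)
    then show ?thesis
      by (simp add: normal_density_def mult_exp_exp)
  qed
  then have "(\<integral>\<^sup>+x. ennreal (normal_density 0 \<sigma> x) * ennreal (exp (a * x)) \<partial>lborel)
    = (\<integral>\<^sup>+x. ennreal (exp (a\<^sup>2 * \<sigma>\<^sup>2 / 2)) * ennreal (normal_density (a * \<sigma>\<^sup>2) \<sigma> x) \<partial>lborel)"
    by (intro nn_integral_cong) (simp add: ennreal_mult[symmetric])
  also have "\<dots> = ennreal (exp (a\<^sup>2 * \<sigma>\<^sup>2 / 2)) * (\<integral>\<^sup>+x. ennreal (normal_density (a * \<sigma>\<^sup>2) \<sigma> x) \<partial>lborel)"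
    by (intro nn_integral_cmult) simp
  also have "(\<integral>\<^sup>+x. ennreal (normal_density (a * \<sigma>\<^sup>2) \<sigma> x) \<partial>lborel) = 1"
    using prob_space.emeasure_space_1[OF prob_space_normal_density[OF assms, of "a * \<sigma>\<^sup>2"]]
    by (simp add: emeasure_density)
  finally show ?thesis by simp
qed

text \<open>
  The increments are independent and $N(0, p_{i+1} - p_i)$; an empty interval contributes the factor 1.
\<close>

lemma step_integral_exp_moment:
  assumes B: "brownian_motion P B" and part: "partition01 m p"
  shows "(\<integral>\<^sup>+\<omega>. ennreal (exp (step_integral B m p a \<omega>)) \<partial>P)
    = ennreal (exp ((\<Sum>i<m. (a i)\<^sup>2 * (p (Suc i) - p i)) / 2))"
proof -
  interpret prob_space P using B by (simp add: brownian_motion_def)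
  have [measurable]: "B t \<in> borel_measurable P" if "t \<in> {0..1}" for t
    using B that by (auto simp: brownian_motion_def)
  let ?D = "\<lambda>i \<omega>. B (p (Suc i)) \<omega> - B (p i) \<omega>"
  have ind: "indep_vars (\<lambda>_. borel) ?D {..<m}"
    using B part by (auto simp: brownian_motion_def)
  have one: "(\<integral>\<^sup>+\<omega>. ennreal (exp (a i * ?D i \<omega>)) \<partial>P) = ennreal (exp ((a i)\<^sup>2 * (p (Suc i) - p i) / 2))"
    if i: "i < m" for i
  proof (cases "p i = p (Suc i)")
    case True
    then show ?thesis using emeasure_space_1 by simp
  next
    case False
    then have lt: "p i < p (Suc i)" using part i by (auto simp: partition01_def less_le)
    have "distributed P lborel (?D i) (\<lambda>x. ennreal (normal_density 0 (sqrt (p (Suc i) - p i)) x))"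
      using B lt partition01_range[OF part, of i] partition01_range[OF part, of "Suc i"] i
      by (auto simp: brownian_motion_def)
    from distributed_nn_integral[OF this, of "\<lambda>x. ennreal (exp (a i * x))"]
    have "(\<integral>\<^sup>+\<omega>. ennreal (exp (a i * ?D i \<omega>)) \<partial>P)
      = (\<integral>\<^sup>+x. ennreal (normal_density 0 (sqrt (p (Suc i) - p i)) x) * ennreal (exp (a i * x)) \<partial>lborel)"
      by simp
    also have "\<dots> = ennreal (exp ((a i)\<^sup>2 * (p (Suc i) - p i) / 2))"
      using lt by (subst normal_exp_moment) auto
    finally show ?thesis .
  qed
  have "(\<integral>\<^sup>+\<omega>. ennreal (exp (step_integral B m p a \<omega>)) \<partial>P) = (\<integral>\<^sup>+\<omega>. (\<Prod>i<m. ennreal (exp (a i * ?D i \<omega>))) \<partial>P)"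
    by (simp add: step_integral_def exp_sum prod_ennreal)
  also have "\<dots> = (\<Prod>i<m. (\<integral>\<^sup>+\<omega>. ennreal (exp (a i * ?D i \<omega>)) \<partial>P))"
    by (rule indep_vars_nn_integral[OF _ indep_vars_compose2[OF ind, of "\<lambda>i x. ennreal (exp (a i * x))"]])
      auto
  also have "\<dots> = (\<Prod>i<m. ennreal (exp ((a i)\<^sup>2 * (p (Suc i) - p i) / 2)))"
    using one by (intro prod.cong) auto
  also have "\<dots> = ennreal (exp ((\<Sum>i<m. (a i)\<^sup>2 * (p (Suc i) - p i)) / 2))"
    by (simp add: prod_ennreal exp_sum sum_divide_distrib)
  finally show ?thesis .
qed

text \<open>
  Only the $L^2$ norm of the combined integrand matters, whatever the individual partitions are.
\<close>

lemma step_integrals_exp_moment: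
  fixes u :: "'k \<Rightarrow> real"
  assumes B: "brownian_motion P B" and fin: "finite K"
    and part: "\<And>\<kappa>. \<kappa> \<in> K \<Longrightarrow> partition01 (m \<kappa>) (p \<kappa>)"
    and v: "(\<integral>\<^sup>+t\<in>{0..1}. ennreal ((\<Sum>\<kappa>\<in>K. u \<kappa> * step_fun (m \<kappa>) (p \<kappa>) (a \<kappa>) t)\<^sup>2) \<partial>lborel) \<le> ennreal v"
    and "0 \<le> v"
  shows "(\<integral>\<^sup>+\<omega>. ennreal (exp (\<Sum>\<kappa>\<in>K. u \<kappa> * step_integral B (m \<kappa>) (p \<kappa>) (a \<kappa>) \<omega>)) \<partial>P) \<le> ennreal (exp (v / 2))"
proof -
  obtain M q A where MqA: "partition01 M q"
    "\<And>F :: real \<Rightarrow> real. (\<Sum>\<kappa>\<in>K. \<Sum>i<m \<kappa>. (u \<kappa> * a \<kappa> i) * (F (p \<kappa> (Suc i)) - F (p \<kappa> i)))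
       = (\<Sum>h<M. A h * (F (q (Suc h)) - F (q h)))"
    by (rule common_refinement[OF fin part, where a = "\<lambda>\<kappa> i. u \<kappa> * a \<kappa> i"]) (assumption, rule that)
  have 1: "(\<Sum>\<kappa>\<in>K. u \<kappa> * step_integral B (m \<kappa>) (p \<kappa>) (a \<kappa>) \<omega>) = step_integral B M q A \<omega>" for \<omega>
    using MqA(2)[of "\<lambda>t. B t \<omega>"] by (simp add: step_integral_def sum_distrib_left mult.assoc)
  have 2: "(\<Sum>\<kappa>\<in>K. u \<kappa> * step_fun (m \<kappa>) (p \<kappa>) (a \<kappa>) x) = step_fun M q A x" for x
  proof -
    have "(\<Sum>\<kappa>\<in>K. u \<kappa> * step_fun (m \<kappa>) (p \<kappa>) (a \<kappa>) x)
      = (\<Sum>\<kappa>\<in>K. \<Sum>i<m \<kappa>. (u \<kappa> * a \<kappa> i) * (of_bool (x \<le> p \<kappa> (Suc i)) - of_bool (x \<le> p \<kappa> i)))"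
      by (intro sum.cong refl, subst step_fun_eq_increments[OF part])
        (simp_all only: sum_distrib_left mult.assoc)
    also have "\<dots> = step_fun M q A x"
      by (subst MqA(2), subst step_fun_eq_increments[OF MqA(1)], rule refl)
    finally show ?thesis .
  qed
  have "(\<Sum>i<M. (A i)\<^sup>2 * (q (Suc i) - q i)) \<le> v"
    using v \<open>0 \<le> v\<close> unfolding 2 nn_integral_step_fun_square[OF MqA(1)] by (simp add: ennreal_le_iff)
  then show ?thesis
    unfolding 1 step_integral_exp_moment[OF B MqA(1)] by (intro ennreal_leI) simp
qed

lemma half_square_le_exp_sum: "(y :: real)\<^sup>2 / 2 \<le> exp y + exp (- y)"
proof (cases "y \<ge> 0")
  case True
  then show ?thesis using exp_lower_Taylor_quadratic[of y] exp_gt_zero[of "- y"] by linarith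
next
  case False
  then show ?thesis using exp_lower_Taylor_quadratic[of "- y"] exp_gt_zero[of y]
    unfolding power2_minus by linarith
qed

text \<open>
  Exponential moments of both signs control the square; the argument is scaled by $v^{-1/2}$.
\<close>

lemma second_moment_from_exp_moments:
  assumes [measurable]: "X \<in> borel_measurable P" and v: "v > 0"
    and 1: "\<And>s. (\<integral>\<^sup>+\<omega>. ennreal (exp (s * X \<omega>)) \<partial>P) \<le> ennreal (exp (s\<^sup>2 * v / 2))"
  shows "(\<integral>\<^sup>+\<omega>. ennreal ((X \<omega>)\<^sup>2) \<partial>P) \<le> ennreal (8 * v)"
proof -
  define c where "c = 1 / sqrt v"
  have c: "c\<^sup>2 = 1 / v" using v by (simp add: c_def power_divide)
  have "(X \<omega>)\<^sup>2 \<le> 2 * v * (exp (c * X \<omega>) + exp (- c * X \<omega>))" for \<omega>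
  proof -
    let ?y = "c * X \<omega>"
    have "?y\<^sup>2 / 2 \<le> exp ?y + exp (- ?y)"
      by (rule half_square_le_exp_sum)
    then have "v * (?y\<^sup>2 / 2) \<le> v * (exp ?y + exp (- ?y))" using v by (intro mult_left_mono) auto
    moreover have "v * (?y\<^sup>2 / 2) = (X \<omega>)\<^sup>2 / 2" using v by (simp add: power_mult_distrib c)
    ultimately have "(X \<omega>)\<^sup>2 / 2 \<le> v * (exp ?y + exp (- ?y))" by (simp only:)
    then show ?thesis by simp
  qed
  then have "(\<integral>\<^sup>+\<omega>. ennreal ((X \<omega>)\<^sup>2) \<partial>P) \<le> (\<integral>\<^sup>+\<omega>. ennreal (2 * v) * (ennreal (exp (c * X \<omega>)) + ennreal (exp (- c * X \<omega>))) \<partial>P)"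
    using v by (intro nn_integral_mono) (simp add: ennreal_mult[symmetric] ennreal_plus[symmetric] del: ennreal_plus)
  also have "\<dots> = ennreal (2 * v) * ((\<integral>\<^sup>+\<omega>. ennreal (exp (c * X \<omega>)) \<partial>P) + (\<integral>\<^sup>+\<omega>. ennreal (exp (- c * X \<omega>)) \<partial>P))"
    by (simp add: nn_integral_cmult nn_integral_add)
  also have "\<dots> \<le> ennreal (2 * v) * (ennreal (exp (1/2)) + ennreal (exp (1/2)))"
    using 1[of c] 1[of "-c"] v by (intro mult_left_mono add_mono) (auto simp: c)
  also have "\<dots> = ennreal (2 * v * (2 * exp (1/2)))"
    using v by (simp add: ennreal_mult[symmetric] ennreal_plus[symmetric] del: ennreal_plus)
  also have "\<dots> \<le> ennreal (8 * v)"
  proof -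
    have "exp (1/2::real) \<le> 2" using exp_bound[of "1/2::real"] by (simp add: power2_eq_square)
    then show ?thesis using v by (intro ennreal_leI) simp
  qed
  finally show ?thesis .
qed

section \<open>Limits in mean square\<close>

lemma ennreal_tendsto_0I:
  fixes u :: "nat \<Rightarrow> ennreal"
  assumes "\<And>e :: real. e > 0 \<Longrightarrow> eventually (\<lambda>l. u l \<le> ennreal e) sequentially"
  shows "u \<longlonglongrightarrow> 0"
proof (rule order_tendstoI)
  fix a :: ennreal assume "0 < a"
  then obtain z where z: "0 < z" "z < a" using dense by blast
  then have "z \<noteq> \<top>" by auto
  then obtain e where e: "z = ennreal e" "e \<ge> 0" by (cases z) auto
  then have "e > 0" using z by (simp add: ennreal_less_zero_iff)
  from assms[OF this] show "eventually (\<lambda>l. u l < a) sequentially"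
    using z e by (auto elim!: eventually_mono)
qed auto

lemma ennreal_tendsto_0D:
  fixes u :: "nat \<Rightarrow> ennreal"
  assumes "u \<longlonglongrightarrow> 0" "e > 0"
  shows "eventually (\<lambda>l. u l \<le> ennreal e) sequentially"
  using order_tendstoD(2)[OF assms(1), of "ennreal e"] assms(2) by (auto elim!: eventually_mono)

lemma nn_integral_Fatou_le:
  assumes [measurable]: "\<And>i. U i \<in> borel_measurable P"
    and lim: "AE \<omega> in P. (\<lambda>i. U i \<omega>) \<longlonglongrightarrow> V \<omega>"
    and le: "eventually (\<lambda>i. (\<integral>\<^sup>+\<omega>. U i \<omega> \<partial>P) \<le> (c :: ennreal)) sequentially"
  shows "(\<integral>\<^sup>+\<omega>. V \<omega> \<partial>P) \<le> c"
proof -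
  have "(\<integral>\<^sup>+\<omega>. V \<omega> \<partial>P) \<le> (\<integral>\<^sup>+\<omega>. liminf (\<lambda>i. U i \<omega>) \<partial>P)"
    using lim by (intro nn_integral_mono_AE) (auto elim!: eventually_mono simp: lim_imp_Liminf)
  also have "\<dots> \<le> liminf (\<lambda>i. \<integral>\<^sup>+\<omega>. U i \<omega> \<partial>P)" by (rule nn_integral_liminf) simp
  also have "\<dots> \<le> c" using le by (intro Liminf_le) auto
  finally show ?thesis .
qed

lemma AE_summable:
  fixes D :: "nat \<Rightarrow> 'w \<Rightarrow> real"
  assumes [measurable]: "\<And>i. D i \<in> borel_measurable P" and D0: "\<And>i \<omega>. 0 \<le> D i \<omega>"
    and le: "\<And>i. (\<integral>\<^sup>+\<omega>. ennreal (D i \<omega>) \<partial>P) \<le> ennreal (b i)" and b: "summable b" "\<And>i. 0 \<le> b i"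
  shows "AE \<omega> in P. summable (\<lambda>i. D i \<omega>)"
proof -
  have "(\<integral>\<^sup>+\<omega>. (\<Sum>i. ennreal (D i \<omega>)) \<partial>P) = (\<Sum>i. \<integral>\<^sup>+\<omega>. ennreal (D i \<omega>) \<partial>P)"
    by (rule nn_integral_suminf) simp
  also have "\<dots> \<le> (\<Sum>i. ennreal (b i))" using le by (intro suminf_le) auto
  also have "\<dots> = ennreal (\<Sum>i. b i)" using b by (intro suminf_ennreal2) auto
  also have "\<dots> < \<infinity>" by simp
  finally have "(\<integral>\<^sup>+\<omega>. (\<Sum>i. ennreal (D i \<omega>)) \<partial>P) \<noteq> \<infinity>" by simp
  then have "AE \<omega> in P. (\<Sum>i. ennreal (D i \<omega>)) \<noteq> \<infinity>"
    by (intro nn_integral_noteq_infinite) simp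
  then show ?thesis by eventually_elim (rule summable_suminf_not_top, auto simp: D0)
qed

text \<open>
  A subsequence with mean squares below $2^{-i}$ has almost surely summable squared distances.
\<close>

lemma L2_tendsto_AE_subseq:
  fixes Y :: "nat \<Rightarrow> 'w \<Rightarrow> real"
  assumes [measurable]: "\<And>i. Y i \<in> borel_measurable P" "V \<in> borel_measurable P"
    and lim: "(\<lambda>l. \<integral>\<^sup>+\<omega>. ennreal ((V \<omega> - Y l \<omega>)\<^sup>2) \<partial>P) \<longlonglongrightarrow> 0"
  obtains r :: "nat \<Rightarrow> nat" where "\<And>i. r i \<ge> i" "AE \<omega> in P. (\<lambda>i. Y (r i) \<omega>) \<longlonglongrightarrow> V \<omega>"
proof -
  have "\<exists>l\<ge>i. (\<integral>\<^sup>+\<omega>. ennreal ((V \<omega> - Y l \<omega>)\<^sup>2) \<partial>P) \<le> ennreal ((1/2)^i)" for i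
    using eventually_conj[OF eventually_ge_at_top[of i] ennreal_tendsto_0D[OF lim, of "(1/2)^i"]]
    by (auto simp: eventually_sequentially)
  then obtain r where r: "\<And>i. r i \<ge> i" "\<And>i. (\<integral>\<^sup>+\<omega>. ennreal ((V \<omega> - Y (r i) \<omega>)\<^sup>2) \<partial>P) \<le> ennreal ((1/2)^i)"
    by metis
  have "AE \<omega> in P. summable (\<lambda>i. (V \<omega> - Y (r i) \<omega>)\<^sup>2)"
    by (rule AE_summable[OF _ _ r(2)]) (auto intro: summable_geometric)
  then have "AE \<omega> in P. (\<lambda>i. Y (r i) \<omega>) \<longlonglongrightarrow> V \<omega>"
  proof eventually_elim
    case (elim \<omega>)
    then have "(\<lambda>i. (V \<omega> - Y (r i) \<omega>)\<^sup>2) \<longlonglongrightarrow> 0" by (rule summable_LIMSEQ_zero)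
    from tendsto_real_sqrt[OF this] have "(\<lambda>i. \<bar>V \<omega> - Y (r i) \<omega>\<bar>) \<longlonglongrightarrow> 0" by simp
    then have "(\<lambda>i. V \<omega> - Y (r i) \<omega>) \<longlonglongrightarrow> 0" by (rule tendsto_rabs_zero_cancel)
    from tendsto_diff[OF tendsto_const[of "V \<omega>"] this] show ?case by simp
  qed
  with r(1) show ?thesis by (rule that)
qed

text \<open>
  Completeness of $L^2$: along a subsequence whose increments have mean squares below $4^{-i}$, the increments are
  almost surely absolutely summable, since $|D| \le 2^i D^2 + 2^{-i}$; the lemma of Fatou turns the almost sure limit into a
  limit in mean square.
\<close>

lemma L2_Cauchy_convergent:
  fixes X :: "nat \<Rightarrow> 'w \<Rightarrow> real"
  assumes "prob_space P" and [measurable]: "\<And>l. X l \<in> borel_measurable P"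
    and Cauchy: "\<And>e. e > 0 \<Longrightarrow> \<exists>l0. \<forall>l\<ge>l0. \<forall>l'\<ge>l0. (\<integral>\<^sup>+\<omega>. ennreal ((X l' \<omega> - X l \<omega>)\<^sup>2) \<partial>P) \<le> ennreal e"
  obtains W where "W \<in> borel_measurable P"
    "(\<lambda>l. \<integral>\<^sup>+\<omega>. ennreal ((W \<omega> - X l \<omega>)\<^sup>2) \<partial>P) \<longlonglongrightarrow> 0"
proof -
  interpret prob_space P by fact
  have "\<forall>i. \<exists>l0. \<forall>l\<ge>l0. \<forall>l'\<ge>l0. (\<integral>\<^sup>+\<omega>. ennreal ((X l' \<omega> - X l \<omega>)\<^sup>2) \<partial>P) \<le> ennreal ((1/4)^i)"
    using Cauchy by simp
  then obtain f where f: "\<And>i l l'. l \<ge> f i \<Longrightarrow> l' \<ge> f i \<Longrightarrow> (\<integral>\<^sup>+\<omega>. ennreal ((X l' \<omega> - X l \<omega>)\<^sup>2) \<partial>P) \<le> ennreal ((1/4)^i)"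
    by metis
  \<comment> \<open>the sum makes the subsequence tend to infinity and pass all the thresholds $f\,0, \dots, f\,i$\<close>
  define \<sigma> where "\<sigma> i = i + (\<Sum>j\<le>i. f j)" for i
  have \<sigma>: "\<sigma> i \<ge> f i" "\<sigma> (Suc i) \<ge> f i" "\<sigma> i \<ge> i" for i
    unfolding \<sigma>_def using member_le_sum[of i "{..i}" f] by (auto intro: trans_le_add2)
  define D where "D i \<omega> = X (\<sigma> (Suc i)) \<omega> - X (\<sigma> i) \<omega>" for i \<omega>
  have [measurable]: "D i \<in> borel_measurable P" for i by (simp add: D_def[abs_def])
  have "AE \<omega> in P. summable (\<lambda>i. \<bar>D i \<omega>\<bar>)"
  proof (rule AE_summable)
    fix i
    have "\<bar>D i \<omega>\<bar> \<le> 2 ^ i * (D i \<omega>)\<^sup>2 + (1/2) ^ i" for \<omega>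
    proof -
      have "0 \<le> 2 ^ i * (\<bar>D i \<omega>\<bar> - (1/2)^i)\<^sup>2" by simp
      also have "\<dots> = 2 ^ i * (D i \<omega>)\<^sup>2 - 2 * \<bar>D i \<omega>\<bar> + (1/2)^i"
        by (simp add: power2_diff algebra_simps power_divide power2_eq_square)
      finally show ?thesis by linarith
    qed
    then have "(\<integral>\<^sup>+\<omega>. ennreal \<bar>D i \<omega>\<bar> \<partial>P) \<le> (\<integral>\<^sup>+\<omega>. ennreal (2 ^ i) * ennreal ((D i \<omega>)\<^sup>2) + ennreal ((1/2) ^ i) \<partial>P)"
      by (intro nn_integral_mono) (simp add: ennreal_mult[symmetric] ennreal_plus[symmetric] del: ennreal_plus)
    also have "\<dots> = ennreal (2 ^ i) * (\<integral>\<^sup>+\<omega>. ennreal ((D i \<omega>)\<^sup>2) \<partial>P) + ennreal ((1/2) ^ i)"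
      by (subst nn_integral_add) (simp_all add: nn_integral_cmult emeasure_space_1)
    also have "\<dots> \<le> ennreal (2 ^ i) * ennreal ((1/4) ^ i) + ennreal ((1/2) ^ i)"
      unfolding D_def by (intro add_mono mult_left_mono f \<sigma> order_refl) auto
    also have "\<dots> = ennreal (2 * (1/2) ^ i)"
      by (simp add: ennreal_mult[symmetric] ennreal_plus[symmetric] power_mult_distrib[symmetric] del: ennreal_plus)
    finally show "(\<integral>\<^sup>+\<omega>. ennreal \<bar>D i \<omega>\<bar> \<partial>P) \<le> ennreal (2 * (1/2) ^ i)" .
  qed (auto intro!: summable_mult summable_geometric)
  then have conv: "AE \<omega> in P. convergent (\<lambda>i. X (\<sigma> i) \<omega>)"
  proof eventually_elim
    case (elim \<omega>)
    then have "summable (\<lambda>i. D i \<omega>)" by (rule summable_rabs_cancel)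
    then have "convergent (\<lambda>n. X (\<sigma> 0) \<omega> + (\<Sum>i<n. D i \<omega>))"
      by (intro convergent_add convergent_const) (simp add: summable_iff_convergent)
    moreover have "X (\<sigma> 0) \<omega> + (\<Sum>i<n. D i \<omega>) = X (\<sigma> n) \<omega>" for n
      by (induction n) (auto simp: D_def)
    ultimately show ?case by simp
  qed
  define W where "W \<omega> = lim (\<lambda>i. X (\<sigma> i) \<omega>)" for \<omega>
  have W[measurable]: "W \<in> borel_measurable P" unfolding W_def[abs_def] by measurable
  from conv have lim: "AE \<omega> in P. (\<lambda>i. X (\<sigma> i) \<omega>) \<longlonglongrightarrow> W \<omega>"
    by eventually_elim (simp add: W_def convergent_LIMSEQ_iff)
  have "(\<lambda>l. \<integral>\<^sup>+\<omega>. ennreal ((W \<omega> - X l \<omega>)\<^sup>2) \<partial>P) \<longlonglongrightarrow> 0"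
  proof (rule ennreal_tendsto_0I)
    fix e :: real assume "e > 0"
    from Cauchy[OF this] obtain l0 where
      l0: "\<And>l l'. l \<ge> l0 \<Longrightarrow> l' \<ge> l0 \<Longrightarrow> (\<integral>\<^sup>+\<omega>. ennreal ((X l' \<omega> - X l \<omega>)\<^sup>2) \<partial>P) \<le> ennreal e" by blast
    have "(\<integral>\<^sup>+\<omega>. ennreal ((W \<omega> - X l \<omega>)\<^sup>2) \<partial>P) \<le> ennreal e" if "l \<ge> l0" for l
    proof (rule nn_integral_Fatou_le)
      show "AE \<omega> in P. (\<lambda>i. ennreal ((X (\<sigma> i) \<omega> - X l \<omega>)\<^sup>2)) \<longlonglongrightarrow> ennreal ((W \<omega> - X l \<omega>)\<^sup>2)"
        using lim by eventually_elim (intro tendsto_intros)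
      show "\<forall>\<^sub>F i in sequentially. (\<integral>\<^sup>+\<omega>. ennreal ((X (\<sigma> i) \<omega> - X l \<omega>)\<^sup>2) \<partial>P) \<le> ennreal e"
        using eventually_ge_at_top[of l0] by eventually_elim (rule l0[OF that order_trans[OF _ \<sigma>(3)]])
    qed simp
    then show "\<forall>\<^sub>F l in sequentially. (\<integral>\<^sup>+\<omega>. ennreal ((W \<omega> - X l \<omega>)\<^sup>2) \<partial>P) \<le> ennreal e"
      by (auto simp: eventually_sequentially)
  qed
  with W show ?thesis by (rule that)
qed

section \<open>Existence of Wiener integrals\<close>

lemma step_integral_measurable:
  assumes "brownian_motion P B" "partition01 m p"
  shows "step_integral B m p a \<in> borel_measurable P"
proof -
  have "B (p i) \<in> borel_measurable P" if "i \<le> m" for i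
    using assms partition01_range[OF assms(2) that] by (auto simp: brownian_motion_def)
  then show ?thesis unfolding step_integral_def[abs_def]
    by (intro borel_measurable_sum borel_measurable_times borel_measurable_diff borel_measurable_const) auto
qed

lemma continuous_uniform_step_approx:
  assumes g: "continuous_on {0..1} g" and e: "e > 0"
  shows "\<exists>l0. \<forall>l\<ge>l0. \<forall>x\<in>{0<..1}.
    \<bar>g x - step_fun (Suc l) (\<lambda>i. real i / real (Suc l)) (\<lambda>i. g (real i / real (Suc l))) x\<bar> \<le> e"
proof -
  have "uniformly_continuous_on {0..1} g" using g by (intro compact_uniformly_continuous) auto
  then obtain \<delta> where \<delta>: "\<delta> > 0" "\<And>x y. x \<in> {0..1} \<Longrightarrow> y \<in> {0..1} \<Longrightarrow> \<bar>x - y\<bar> < \<delta> \<Longrightarrow> \<bar>g x - g y\<bar> < e"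
    unfolding uniformly_continuous_on_def dist_real_def using e by (metis abs_minus_commute)
  obtain l0 where l0: "1 / real (Suc l0) < \<delta>" using \<delta>(1) nat_approx_posE by blast
  show ?thesis
  proof (intro exI[of _ l0] allI impI ballI)
    fix l x assume l: "l \<ge> l0" and x: "x \<in> {0<..1::real}"
    let ?m = "real (Suc l)" and ?p = "\<lambda>i. real i / real (Suc l)"
    have part: "partition01 (Suc l) ?p" by (auto simp: partition01_def divide_right_mono)
    define i where "i = nat (\<lceil>x * ?m\<rceil> - 1)"
    have pos: "0 < x * ?m" using x by simp
    then have "\<lceil>x * ?m\<rceil> \<ge> 1" by linarith
    then have i: "real i = real_of_int \<lceil>x * ?m\<rceil> - 1" by (simp add: i_def)
    then have i': "real i < x * ?m" "x * ?m \<le> real (Suc i)" by linarith+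
    have "x * ?m \<le> ?m" using x by (intro mult_left_le_one_le) auto
    then have "i < Suc l" using i' by linarith
    have xin: "x \<in> {?p i<..?p (Suc i)}" using i' by (simp add: field_simps)
    have "\<bar>x - ?p i\<bar> \<le> 1 / ?m"
      using xin by (simp add: add_divide_distrib)
    also have "1 / ?m \<le> 1 / real (Suc l0)" using l by (intro divide_left_mono) auto
    finally have "\<bar>x - ?p i\<bar> < \<delta>" using l0 by simp
    moreover have "?p i \<in> {0..1}" using \<open>i < Suc l\<close> by auto
    ultimately have "\<bar>g x - g (?p i)\<bar> < e" using x by (intro \<delta>(2)) auto
    then show "\<bar>g x - step_fun (Suc l) ?p (\<lambda>i. g (?p i)) x\<bar> \<le> e"
      using step_fun_on_piece[OF part \<open>i < Suc l\<close> xin] by simp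
  qed
qed

lemma set_nn_integral_unit_interval_le:
  fixes h :: "real \<Rightarrow> ennreal"
  assumes "\<And>x. x \<in> {0<..1} \<Longrightarrow> h x \<le> c"
  shows "(\<integral>\<^sup>+t\<in>{0..1}. h t \<partial>lborel) \<le> c"
proof -
  have "(\<integral>\<^sup>+t\<in>{0..1}. h t \<partial>lborel) \<le> (\<integral>\<^sup>+t. c * indicator {0..1::real} t \<partial>lborel)"
  proof (rule nn_integral_mono_AE)
    show "AE t in lborel. h t * indicator {0..1} t \<le> c * indicator {0..1::real} t"
      using AE_lborel_singleton[of "0::real"]
      by eventually_elim (auto split: split_indicator intro!: assms)
  qed
  also have "\<dots> = c" by (simp add: nn_integral_cmult_indicator)
  finally show ?thesis .
qed

text \<open>
  The step functions on the uniform partitions converge uniformly on $(0,1]$, so their integrals are Cauchy in mean square.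
\<close>

lemma continuous_has_stoch_integral:
  assumes B: "brownian_motion P B" and g: "continuous_on {0..1} g"
  shows "\<exists>W. has_stoch_integral P B g W"
proof -
  interpret prob_space P using B by (simp add: brownian_motion_def)
  define m where "m l = Suc l" for l
  define p where "p l i = real i / real (Suc l)" for l i
  define a where "a l i = g (p l i)" for l i
  let ?s = "\<lambda>l. step_fun (m l) (p l) (a l)"
  have part: "partition01 (m l) (p l)" for l by (auto simp: partition01_def divide_right_mono m_def p_def)
  have unif: "\<exists>l0. \<forall>l\<ge>l0. \<forall>x\<in>{0<..1}. \<bar>g x - ?s l x\<bar> \<le> e" if e: "e > 0" for e
    using continuous_uniform_step_approx[OF g e] unfolding m_def p_def[abs_def] a_def[abs_def] .
  have [measurable]: "step_integral B (m l) (p l) (a l) \<in> borel_measurable P" for l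
    by (rule step_integral_measurable[OF B part])
  obtain W where W: "W \<in> borel_measurable P"
    "(\<lambda>l. \<integral>\<^sup>+\<omega>. ennreal ((W \<omega> - step_integral B (m l) (p l) (a l) \<omega>)\<^sup>2) \<partial>P) \<longlonglongrightarrow> 0"
  proof (rule L2_Cauchy_convergent)
    show "prob_space P" by unfold_locales
    fix e :: real assume e: "e > 0"
    \<comment> \<open>two step functions differ by at most $2\eta$, and 8 is the constant in the second moment bound\<close>
    define \<eta> where "\<eta> = sqrt (e / 32)"
    have \<eta>: "\<eta> > 0" "8 * (2 * \<eta>)\<^sup>2 = e" using e by (auto simp: \<eta>_def power_mult_distrib)
    from unif[OF \<eta>(1)] obtain l0 where l0: "\<And>l x. l \<ge> l0 \<Longrightarrow> x \<in> {0<..1} \<Longrightarrow> \<bar>g x - ?s l x\<bar> \<le> \<eta>" by blast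
    have "(\<integral>\<^sup>+\<omega>. ennreal ((step_integral B (m l') (p l') (a l') \<omega> - step_integral B (m l) (p l) (a l) \<omega>)\<^sup>2) \<partial>P) \<le> ennreal e"
      if l: "l \<ge> l0" "l' \<ge> l0" for l l'
    proof -
      have "(\<integral>\<^sup>+\<omega>. ennreal (exp (s * (step_integral B (m l') (p l') (a l') \<omega> - step_integral B (m l) (p l) (a l) \<omega>))) \<partial>P)
        \<le> ennreal (exp (s\<^sup>2 * (2 * \<eta>)\<^sup>2 / 2))" for s
      proof -
        \<comment> \<open>the difference of two step integrals as a combination indexed by the truth values\<close>
        let ?L = "\<lambda>\<kappa>. if \<kappa> then l' else l"
        have "(\<integral>\<^sup>+\<omega>. ennreal (exp (\<Sum>\<kappa>\<in>UNIV. (if \<kappa> then s else - s) * step_integral B (m (?L \<kappa>)) (p (?L \<kappa>)) (a (?L \<kappa>)) \<omega>)) \<partial>P)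
          \<le> ennreal (exp (s\<^sup>2 * (2 * \<eta>)\<^sup>2 / 2))"
        proof (rule step_integrals_exp_moment[OF B])
          show "(\<integral>\<^sup>+t\<in>{0..1}. ennreal ((\<Sum>\<kappa>\<in>UNIV. (if \<kappa> then s else - s) * ?s (?L \<kappa>) t)\<^sup>2) \<partial>lborel) \<le> ennreal (s\<^sup>2 * (2 * \<eta>)\<^sup>2)"
          proof (intro set_nn_integral_unit_interval_le ennreal_leI)
            fix x :: real assume x: "x \<in> {0<..1}"
            have "\<bar>?s l' x - ?s l x\<bar> \<le> \<bar>2 * \<eta>\<bar>" using l0[OF l(1) x] l0[OF l(2) x] \<eta>(1) by linarith
            then have "(?s l' x - ?s l x)\<^sup>2 \<le> (2 * \<eta>)\<^sup>2" by (simp only: abs_le_square_iff)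
            then have "s\<^sup>2 * (?s l' x - ?s l x)\<^sup>2 \<le> s\<^sup>2 * (2 * \<eta>)\<^sup>2" by (rule mult_left_mono) simp
            moreover have "(\<Sum>\<kappa>\<in>UNIV. (if \<kappa> then s else - s) * ?s (?L \<kappa>) x) = s * (?s l' x - ?s l x)"
              by (simp add: UNIV_bool right_diff_distrib)
            ultimately show "(\<Sum>\<kappa>\<in>UNIV. (if \<kappa> then s else - s) * ?s (?L \<kappa>) x)\<^sup>2 \<le> s\<^sup>2 * (2 * \<eta>)\<^sup>2"
              by (simp only: power_mult_distrib)
          qed
        qed (auto simp: part)
        then show ?thesis by (simp add: UNIV_bool algebra_simps)
      qed
      from second_moment_from_exp_moments[OF _ _ this] show ?thesis using \<eta> by simp
    qed
    then show "\<exists>l0. \<forall>l\<ge>l0. \<forall>l'\<ge>l0. (\<integral>\<^sup>+\<omega>. ennreal ((step_integral B (m l') (p l') (a l') \<omega> - step_integral B (m l) (p l) (a l) \<omega>)\<^sup>2) \<partial>P) \<le> ennreal e"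
      by (intro exI[of _ l0] allI impI)
  qed simp
  have "(\<lambda>l. \<integral>\<^sup>+t\<in>{0..1}. ennreal ((g t - ?s l t)\<^sup>2) \<partial>lborel) \<longlonglongrightarrow> 0"
  proof (rule ennreal_tendsto_0I)
    fix e :: real assume e: "e > 0"
    then have "sqrt e > 0" by simp
    from unif[OF this] obtain l0 where l0: "\<And>l x. l \<ge> l0 \<Longrightarrow> x \<in> {0<..1} \<Longrightarrow> \<bar>g x - ?s l x\<bar> \<le> sqrt e" by blast
    have "(\<integral>\<^sup>+t\<in>{0..1}. ennreal ((g t - ?s l t)\<^sup>2) \<partial>lborel) \<le> ennreal e" if "l \<ge> l0" for l
    proof (intro set_nn_integral_unit_interval_le ennreal_leI)
      fix x :: real assume "x \<in> {0<..1}"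
      from l0[OF that this] have "\<bar>g x - ?s l x\<bar> \<le> \<bar>sqrt e\<bar>" by simp
      then have "(g x - ?s l x)\<^sup>2 \<le> (sqrt e)\<^sup>2" by (simp only: abs_le_square_iff)
      then show "(g x - ?s l x)\<^sup>2 \<le> e" using e by simp
    qed
    then show "\<forall>\<^sub>F l in sequentially. (\<integral>\<^sup>+t\<in>{0..1}. ennreal ((g t - ?s l t)\<^sup>2) \<partial>lborel) \<le> ennreal e"
      by (auto simp: eventually_sequentially)
  qed
  with W(2) part have "\<exists>m p a. (\<forall>l. partition01 (m l) (p l)) \<and>
        (\<lambda>l. \<integral>\<^sup>+t\<in>{0..1}. ennreal ((g t - step_fun (m l) (p l) (a l) t)\<^sup>2) \<partial>lborel) \<longlonglongrightarrow> 0 \<and>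
        (\<lambda>l. \<integral>\<^sup>+\<omega>. ennreal ((W \<omega> - step_integral B (m l) (p l) (a l) \<omega>)\<^sup>2) \<partial>P) \<longlonglongrightarrow> 0"
    by (intro exI[of _ m] exI[of _ p] exI[of _ a] conjI allI)
  with W(1) show ?thesis unfolding has_stoch_integral_def by (intro exI[of _ W] conjI)
qed

section \<open>Exponential moments of Wiener integrals\<close>

abbreviation unit_lebesgue :: "real measure" where
  "unit_lebesgue \<equiv> restrict_space lborel {0..1}"

lemma set_nn_integral_unit: "(\<integral>\<^sup>+t\<in>{0..1}. h t \<partial>lborel) = (\<integral>\<^sup>+t. h t \<partial>unit_lebesgue)"
  by (subst nn_integral_restrict_space) auto

lemma set_lebesgue_integral_unit: "(LINT t:{0..1}|lborel. (h t :: real)) = (LINT t|unit_lebesgue. h t)"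
  by (subst integral_restrict_space) (auto simp: set_lebesgue_integral_def)

lemma prob_space_unit_lebesgue: "prob_space unit_lebesgue"
  by (rule prob_spaceI) (simp add: space_restrict_space emeasure_restrict_space)

lemma continuous_on_unit_measurable:
  "continuous_on {0..1} g \<Longrightarrow> g \<in> borel_measurable unit_lebesgue" for g :: "real \<Rightarrow> real"
  using borel_measurable_continuous_on_restrict[of "{0..1}" g]
  by (simp add: measurable_cong_sets[OF sets_restrict_space_cong[OF sets_lborel] refl])

lemma borel_measurable_unit: "g \<in> borel_measurable borel \<Longrightarrow> g \<in> borel_measurable unit_lebesgue"
  by (intro measurable_restrict_space1) simp

lemma L2_tendsto_lincomb:
  fixes X :: "'k \<Rightarrow> nat \<Rightarrow> 'w \<Rightarrow> real"
  assumes fin: "finite K"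
    and meas: "\<And>k l. k \<in> K \<Longrightarrow> X k l \<in> borel_measurable M" "\<And>k. k \<in> K \<Longrightarrow> Y k \<in> borel_measurable M"
    and lim: "\<And>k. k \<in> K \<Longrightarrow> (\<lambda>l. \<integral>\<^sup>+\<omega>. ennreal ((Y k \<omega> - X k l \<omega>)\<^sup>2) \<partial>M) \<longlonglongrightarrow> 0"
  shows "(\<lambda>l. \<integral>\<^sup>+\<omega>. ennreal (((\<Sum>k\<in>K. u k * Y k \<omega>) - (\<Sum>k\<in>K. u k * X k l \<omega>))\<^sup>2) \<partial>M) \<longlonglongrightarrow> 0"
proof -
  let ?U = "\<Sum>k\<in>K. (u k)\<^sup>2"
  have mm: "(\<lambda>\<omega>. ennreal ((Y k \<omega> - X k l \<omega>)\<^sup>2)) \<in> borel_measurable M" if "k \<in> K" for k l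
  proof -
    note meas(1)[OF that, measurable] meas(2)[OF that, measurable]
    show ?thesis by measurable
  qed
  have le: "(\<integral>\<^sup>+\<omega>. ennreal (((\<Sum>k\<in>K. u k * Y k \<omega>) - (\<Sum>k\<in>K. u k * X k l \<omega>))\<^sup>2) \<partial>M)
    \<le> ennreal ?U * (\<Sum>k\<in>K. \<integral>\<^sup>+\<omega>. ennreal ((Y k \<omega> - X k l \<omega>)\<^sup>2) \<partial>M)" for l
  proof -
    have "(\<integral>\<^sup>+\<omega>. ennreal (((\<Sum>k\<in>K. u k * Y k \<omega>) - (\<Sum>k\<in>K. u k * X k l \<omega>))\<^sup>2) \<partial>M)
      \<le> (\<integral>\<^sup>+\<omega>. ennreal ?U * (\<Sum>k\<in>K. ennreal ((Y k \<omega> - X k l \<omega>)\<^sup>2)) \<partial>M)"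
    proof (intro nn_integral_mono)
      fix \<omega>
      have "((\<Sum>k\<in>K. u k * Y k \<omega>) - (\<Sum>k\<in>K. u k * X k l \<omega>))\<^sup>2 \<le> ?U * (\<Sum>k\<in>K. (Y k \<omega> - X k l \<omega>)\<^sup>2)"
        using Cauchy_Schwarz_ineq_sum[of u "\<lambda>k. Y k \<omega> - X k l \<omega>" K]
        by (simp add: right_diff_distrib sum_subtractf)
      then show "ennreal (((\<Sum>k\<in>K. u k * Y k \<omega>) - (\<Sum>k\<in>K. u k * X k l \<omega>))\<^sup>2)
         \<le> ennreal ?U * (\<Sum>k\<in>K. ennreal ((Y k \<omega> - X k l \<omega>)\<^sup>2))"
        by (simp add: sum_nonneg ennreal_mult[symmetric])
    qed
    also have "\<dots> = ennreal ?U * (\<Sum>k\<in>K. \<integral>\<^sup>+\<omega>. ennreal ((Y k \<omega> - X k l \<omega>)\<^sup>2) \<partial>M)"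
      by (subst nn_integral_cmult, rule borel_measurable_sum, erule mm, subst nn_integral_sum, erule mm, rule refl)
    finally show ?thesis .
  qed
  have "(\<lambda>l. ennreal ?U * (\<Sum>k\<in>K. \<integral>\<^sup>+\<omega>. ennreal ((Y k \<omega> - X k l \<omega>)\<^sup>2) \<partial>M)) \<longlonglongrightarrow> ennreal ?U * (\<Sum>k\<in>K. 0)"
    by (intro ennreal_tendsto_cmult tendsto_sum lim) auto
  then have "(\<lambda>l. ennreal ?U * (\<Sum>k\<in>K. \<integral>\<^sup>+\<omega>. ennreal ((Y k \<omega> - X k l \<omega>)\<^sup>2) \<partial>M)) \<longlonglongrightarrow> 0" by simp
  then show ?thesis
    by (rule tendsto_sandwich[OF _ _ tendsto_const, rotated 2]) (use le in auto)
qed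

text \<open>
  $x^2 \le (1 + \eta) y^2 + (1 + 1/\eta) (y - x)^2$.
\<close>

lemma L2_limit_norm_le:
  fixes X :: "nat \<Rightarrow> 'w \<Rightarrow> real"
  assumes [measurable]: "\<And>l. X l \<in> borel_measurable M" "Y \<in> borel_measurable M"
    and lim: "(\<lambda>l. \<integral>\<^sup>+\<omega>. ennreal ((Y \<omega> - X l \<omega>)\<^sup>2) \<partial>M) \<longlonglongrightarrow> 0"
    and le: "(\<integral>\<^sup>+\<omega>. ennreal ((Y \<omega>)\<^sup>2) \<partial>M) \<le> ennreal v" and v: "0 \<le> v" and \<eta>: "\<eta> > 0"
  shows "eventually (\<lambda>l. (\<integral>\<^sup>+\<omega>. ennreal ((X l \<omega>)\<^sup>2) \<partial>M) \<le> ennreal ((1 + \<eta>) * v + \<eta>)) sequentially"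
proof -
  define \<delta> where "\<delta> = \<eta> / (1 + 1 / \<eta>)"
  have "1 + 1 / \<eta> > 0" using \<eta> by (simp add: add_pos_pos)
  then have \<delta>: "\<delta> > 0" "(1 + 1/\<eta>) * \<delta> = \<eta>" using \<eta> by (simp_all add: \<delta>_def)
  from ennreal_tendsto_0D[OF lim \<delta>(1)] show ?thesis
  proof eventually_elim
    case (elim l)
    have "(\<integral>\<^sup>+\<omega>. ennreal ((X l \<omega>)\<^sup>2) \<partial>M)
      \<le> (\<integral>\<^sup>+\<omega>. ennreal (1 + \<eta>) * ennreal ((Y \<omega>)\<^sup>2) + ennreal (1 + 1/\<eta>) * ennreal ((Y \<omega> - X l \<omega>)\<^sup>2) \<partial>M)"
    proof (intro nn_integral_mono)
      fix \<omega>
      let ?x = "X l \<omega>" and ?y = "Y \<omega>"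
      have "0 \<le> (sqrt \<eta> * ?y + (?y - ?x) / sqrt \<eta>)\<^sup>2" by simp
      also have "\<dots> = \<eta> * ?y\<^sup>2 + 2 * ?y * (?y - ?x) + (?y - ?x)\<^sup>2 / \<eta>"
        using \<eta> by (simp add: power2_sum power_mult_distrib power_divide)
      finally have "?x\<^sup>2 \<le> (1 + \<eta>) * ?y\<^sup>2 + (1 + 1/\<eta>) * (?y - ?x)\<^sup>2"
      proof -
        assume *: "0 \<le> \<eta> * ?y\<^sup>2 + 2 * ?y * (?y - ?x) + (?y - ?x)\<^sup>2 / \<eta>"
        have "?x\<^sup>2 = ?y\<^sup>2 - 2 * ?y * (?y - ?x) + (?y - ?x)\<^sup>2"
          by (simp add: power2_eq_square algebra_simps)
        moreover have "(1 + \<eta>) * ?y\<^sup>2 + (1 + 1/\<eta>) * (?y - ?x)\<^sup>2 = ?y\<^sup>2 + \<eta> * ?y\<^sup>2 + (?y - ?x)\<^sup>2 + (?y - ?x)\<^sup>2 / \<eta>"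
          by (simp add: distrib_right)
        ultimately show ?thesis using * by linarith
      qed
      then show "ennreal (?x\<^sup>2) \<le> ennreal (1 + \<eta>) * ennreal (?y\<^sup>2) + ennreal (1 + 1/\<eta>) * ennreal ((?y - ?x)\<^sup>2)"
        using \<eta> by (simp add: ennreal_mult[symmetric] ennreal_plus[symmetric] del: ennreal_plus)
    qed
    also have "\<dots> = ennreal (1 + \<eta>) * (\<integral>\<^sup>+\<omega>. ennreal ((Y \<omega>)\<^sup>2) \<partial>M)
        + ennreal (1 + 1/\<eta>) * (\<integral>\<^sup>+\<omega>. ennreal ((Y \<omega> - X l \<omega>)\<^sup>2) \<partial>M)"
      by (subst nn_integral_add) (simp_all add: nn_integral_cmult)
    also have "\<dots> \<le> ennreal (1 + \<eta>) * ennreal v + ennreal (1 + 1/\<eta>) * ennreal \<delta>"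
      by (intro add_mono mult_left_mono le elim) auto
    also have "\<dots> = ennreal ((1 + \<eta>) * v + \<eta>)"
      using \<eta> v \<delta> by (subst (1 2) ennreal_mult[symmetric]) (simp_all add: ennreal_plus[symmetric] del: ennreal_plus)
    finally show ?case .
  qed
qed

text \<open>
  Joint sub-Gaussianity of Wiener integrals, with the variance of the combined integrand.  The integrals may be
  limits along unrelated partitions; a common subsequence converges almost surely, and the lemma of Fatou keeps the bound.
\<close>

lemma wiener_exp_moment:
  fixes u :: "'k \<Rightarrow> real"
  assumes B: "brownian_motion P B" and fin: "finite K"
    and V: "\<And>k. k \<in> K \<Longrightarrow> has_stoch_integral P B (g k) (V k)"
    and g: "\<And>k. k \<in> K \<Longrightarrow> continuous_on {0..1} (g k)"
    and v: "(\<integral>\<^sup>+t. ennreal ((\<Sum>k\<in>K. u k * g k t)\<^sup>2) \<partial>unit_lebesgue) \<le> ennreal v" "0 \<le> v"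
  shows "(\<integral>\<^sup>+\<omega>. ennreal (exp (\<Sum>k\<in>K. u k * V k \<omega>)) \<partial>P) \<le> ennreal (exp (v / 2))"
proof -
  have "\<forall>k\<in>K. \<exists>mpa. (\<forall>l. partition01 (fst mpa l) (fst (snd mpa) l)) \<and>
     (\<lambda>l. \<integral>\<^sup>+t. ennreal ((g k t - step_fun (fst mpa l) (fst (snd mpa) l) (snd (snd mpa) l) t)\<^sup>2) \<partial>unit_lebesgue) \<longlonglongrightarrow> 0 \<and>
     (\<lambda>l. \<integral>\<^sup>+\<omega>. ennreal ((V k \<omega> - step_integral B (fst mpa l) (fst (snd mpa) l) (snd (snd mpa) l) \<omega>)\<^sup>2) \<partial>P) \<longlonglongrightarrow> 0"
    (is "\<forall>k\<in>K. \<exists>mpa. ?Q k mpa")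
  proof
    fix k assume "k \<in> K"
    from V[OF this] obtain m p a where "?Q k (m, p, a)"
      unfolding has_stoch_integral_def set_nn_integral_unit by auto
    then show "\<exists>mpa. ?Q k mpa" by blast
  qed
  then obtain mpa where mpa: "\<And>k. k \<in> K \<Longrightarrow> ?Q k (mpa k)" unfolding bchoice_iff by blast
  define m where "m k = fst (mpa k)" for k
  define p where "p k = fst (snd (mpa k))" for k
  define a where "a k = snd (snd (mpa k))" for k
  have part: "partition01 (m k l) (p k l)" if "k \<in> K" for k l
    using mpa[OF that] by (simp add: m_def p_def)
  have lim1: "(\<lambda>l. \<integral>\<^sup>+t. ennreal ((g k t - step_fun (m k l) (p k l) (a k l) t)\<^sup>2) \<partial>unit_lebesgue) \<longlonglongrightarrow> 0" if "k \<in> K" for k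
    using mpa[OF that] by (simp add: m_def p_def a_def)
  have lim2: "(\<lambda>l. \<integral>\<^sup>+\<omega>. ennreal ((V k \<omega> - step_integral B (m k l) (p k l) (a k l) \<omega>)\<^sup>2) \<partial>P) \<longlonglongrightarrow> 0" if "k \<in> K" for k
    using mpa[OF that] by (simp add: m_def p_def a_def)
  have Vm: "V k \<in> borel_measurable P" if "k \<in> K" for k using V[OF that] by (simp add: has_stoch_integral_def)
  note Sm = step_integral_measurable[OF B part]
  let ?Y = "\<lambda>l \<omega>. \<Sum>k\<in>K. u k * step_integral B (m k l) (p k l) (a k l) \<omega>"
  have Ym[measurable]: "?Y l \<in> borel_measurable P" for l
    by (intro borel_measurable_sum borel_measurable_times borel_measurable_const Sm)
  have Zm[measurable]: "(\<lambda>\<omega>. \<Sum>k\<in>K. u k * V k \<omega>) \<in> borel_measurable P"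
    by (intro borel_measurable_sum borel_measurable_times borel_measurable_const Vm)
  have "(\<lambda>l. \<integral>\<^sup>+\<omega>. ennreal (((\<Sum>k\<in>K. u k * V k \<omega>) - ?Y l \<omega>)\<^sup>2) \<partial>P) \<longlonglongrightarrow> 0"
    by (rule L2_tendsto_lincomb[OF fin Sm Vm lim2])
  from L2_tendsto_AE_subseq[OF Ym Zm this] obtain r :: "nat \<Rightarrow> nat" where
    r: "\<And>i. r i \<ge> i" "AE \<omega> in P. (\<lambda>i. ?Y (r i) \<omega>) \<longlonglongrightarrow> (\<Sum>k\<in>K. u k * V k \<omega>)" by blast
  have sm: "step_fun (m k l) (p k l) (a k l) \<in> borel_measurable unit_lebesgue" for k l
    by (intro borel_measurable_unit step_fun_measurable)
  have gm: "g k \<in> borel_measurable unit_lebesgue" if "k \<in> K" for k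
    by (intro continuous_on_unit_measurable g that)
  have limG: "(\<lambda>l. \<integral>\<^sup>+t. ennreal (((\<Sum>k\<in>K. u k * g k t) - (\<Sum>k\<in>K. u k * step_fun (m k l) (p k l) (a k l) t))\<^sup>2) \<partial>unit_lebesgue) \<longlonglongrightarrow> 0"
    by (rule L2_tendsto_lincomb[OF fin sm gm lim1])
  have bound: "(\<integral>\<^sup>+\<omega>. ennreal (exp (\<Sum>k\<in>K. u k * V k \<omega>)) \<partial>P) \<le> ennreal (exp (((1 + \<eta>) * v + \<eta>) / 2))"
    if \<eta>: "\<eta> > 0" for \<eta>
  proof (rule nn_integral_Fatou_le)
    show "AE \<omega> in P. (\<lambda>i. ennreal (exp (?Y (r i) \<omega>))) \<longlonglongrightarrow> ennreal (exp (\<Sum>k\<in>K. u k * V k \<omega>))"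
      using r(2) by eventually_elim (intro tendsto_ennrealI tendsto_exp)
    have "eventually (\<lambda>l. (\<integral>\<^sup>+t. ennreal ((\<Sum>k\<in>K. u k * step_fun (m k l) (p k l) (a k l) t)\<^sup>2) \<partial>unit_lebesgue)
       \<le> ennreal ((1 + \<eta>) * v + \<eta>)) sequentially"
      by (rule L2_limit_norm_le[OF _ _ limG v \<eta>])
        (intro borel_measurable_sum borel_measurable_times borel_measurable_const sm gm; assumption)+
    then have "eventually (\<lambda>l. (\<integral>\<^sup>+\<omega>. ennreal (exp (?Y l \<omega>)) \<partial>P) \<le> ennreal (exp (((1 + \<eta>) * v + \<eta>) / 2))) sequentially"
    proof eventually_elim
      case (elim l)
      show ?case
        using elim v \<eta> by (intro step_integrals_exp_moment[OF B fin part]) (auto simp: set_nn_integral_unit)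
    qed
    then obtain l0 where l0: "\<And>l. l \<ge> l0 \<Longrightarrow> (\<integral>\<^sup>+\<omega>. ennreal (exp (?Y l \<omega>)) \<partial>P) \<le> ennreal (exp (((1 + \<eta>) * v + \<eta>) / 2))"
      unfolding eventually_sequentially by blast
    show "\<forall>\<^sub>F i in sequentially. (\<integral>\<^sup>+\<omega>. ennreal (exp (?Y (r i) \<omega>)) \<partial>P) \<le> ennreal (exp (((1 + \<eta>) * v + \<eta>) / 2))"
      using eventually_ge_at_top[of l0] by eventually_elim (rule l0[OF order_trans[OF _ r(1)]])
  qed simp
  have "((\<lambda>\<eta>. ennreal (exp (((1 + \<eta>) * v + \<eta>) / 2))) \<longlongrightarrow> ennreal (exp (((1 + 0) * v + 0) / 2))) (at_right 0)"
    by (intro tendsto_intros) auto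
  then have "((\<lambda>\<eta>. ennreal (exp (((1 + \<eta>) * v + \<eta>) / 2))) \<longlongrightarrow> ennreal (exp (v / 2))) (at_right 0)" by simp
  then show ?thesis
    by (rule tendsto_lowerbound) (auto simp: eventually_at_right_less intro!: eventually_mono[OF eventually_at_right_less[of 0]] bound)
qed

section \<open>Exponential moments of sums of squares\<close>

text \<open>
  $e^{s w^2}$ times the standard normal density is $(1-2s)^{-1/2}$ times a centred normal density.
\<close>

lemma normal_exp_square_moment:
  assumes "s < 1/2"
  shows "(\<integral>\<^sup>+w. ennreal (std_normal_density w) * ennreal (exp (s * w\<^sup>2)) \<partial>lborel) = ennreal ((1 - 2 * s) powr (- 1 / 2))"
proof -
  define \<sigma> where "\<sigma> = 1 / sqrt (1 - 2 * s)"
  have \<sigma>: "\<sigma> > 0" "\<sigma>\<^sup>2 = 1 / (1 - 2 * s)" "(1 - 2 * s) powr (- 1 / 2) = \<sigma>"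
    using assms by (auto simp: \<sigma>_def power_divide powr_minus powr_half_sqrt field_simps)
  have "std_normal_density w * exp (s * w\<^sup>2) = \<sigma> * normal_density 0 \<sigma> w" for w
  proof -
    have "- w\<^sup>2 / 2 + s * w\<^sup>2 = - w\<^sup>2 / (2 * \<sigma>\<^sup>2)" unfolding \<sigma>(2) by (simp add: field_simps)
    then have "exp (- w\<^sup>2 / 2) * exp (s * w\<^sup>2) = exp (- w\<^sup>2 / (2 * \<sigma>\<^sup>2))" by (simp add: mult_exp_exp)
    moreover have "1 / sqrt (2 * pi) = \<sigma> * (1 / sqrt (2 * pi * \<sigma>\<^sup>2))" using \<sigma>(1) by (simp add: real_sqrt_mult)
    ultimately show ?thesis
      unfolding std_normal_density_def normal_density_def[of 0 \<sigma>] by (simp only: mult.assoc diff_0_right)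
  qed
  then have "(\<integral>\<^sup>+w. ennreal (std_normal_density w) * ennreal (exp (s * w\<^sup>2)) \<partial>lborel)
     = (\<integral>\<^sup>+w. ennreal \<sigma> * (ennreal (normal_density 0 \<sigma> w) * ennreal (exp (0 * w))) \<partial>lborel)"
    using \<sigma> by (intro nn_integral_cong) (simp add: ennreal_mult[symmetric])
  also have "\<dots> = ennreal \<sigma> * (\<integral>\<^sup>+w. ennreal (normal_density 0 \<sigma> w) * ennreal (exp (0 * w)) \<partial>lborel)"
    by (rule nn_integral_cmult) simp
  also have "\<dots> = ennreal \<sigma>" by (subst normal_exp_moment[OF \<sigma>(1)]) simp
  finally show ?thesis unfolding \<sigma>(3) .
qed

text \<open>
  Squares are introduced one coordinate at a time.  Since $e^{s V^2} = E_w\, e^{\sqrt{2s}\, w V}$ for a standard normal $w$, a coordinate that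
  enters through its square is, for fixed $w$, one that enters linearly, and the order of integration can be exchanged.
\<close>

lemma chi_square_exp_moment_aux:
  fixes V :: "'k \<Rightarrow> 'w \<Rightarrow> real"
  assumes "prob_space P" and fin: "finite K" and V: "\<And>k. k \<in> K \<Longrightarrow> V k \<in> borel_measurable P"
    and mgf: "\<And>u. (\<integral>\<^sup>+\<omega>. ennreal (exp (\<Sum>k\<in>K. u k * V k \<omega>)) \<partial>P) \<le> ennreal (exp ((\<Sum>k\<in>K. (u k)\<^sup>2) / 2))"
    and s: "0 \<le> s" "s < 1/2" and F: "F \<subseteq> K"
  shows "(\<integral>\<^sup>+\<omega>. ennreal (exp (s * (\<Sum>k\<in>F. (V k \<omega>)\<^sup>2) + (\<Sum>k\<in>K - F. u k * V k \<omega>))) \<partial>P)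
     \<le> ennreal ((1 - 2 * s) powr (- real (card F) / 2) * exp ((\<Sum>k\<in>K - F. (u k)\<^sup>2) / 2))"
  using finite_subset[OF F fin] F
proof (induction F arbitrary: u rule: finite_induct)
  case empty
  then show ?case using mgf[of u] s by simp
next
  case (insert i F)
  interpret prob_space P by fact
  interpret pair_sigma_finite lborel P by unfold_locales
  let ?N = "std_normal_density" and ?c = "sqrt (2 * s)"
  let ?R = "K - insert i F"
  have i: "i \<in> K" and FK: "F \<subseteq> K" using insert by auto
  have KF: "K - F = insert i ?R" using insert by auto
  have finR: "finite ?R" using fin by auto
  have [measurable]: "V i \<in> borel_measurable P" using V i by auto
  define G where "G \<omega> = s * (\<Sum>k\<in>F. (V k \<omega>)\<^sup>2) + (\<Sum>k\<in>?R. u k * V k \<omega>)" for \<omega>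
  have [measurable]: "G \<in> borel_measurable P"
    unfolding G_def[abs_def]
    using V FK by (intro borel_measurable_add borel_measurable_times borel_measurable_const borel_measurable_sum borel_measurable_power) auto
  define C where "C = (1 - 2 * s) powr (- real (card F) / 2) * exp ((\<Sum>k\<in>?R. (u k)\<^sup>2) / 2)"
  have C: "C \<ge> 0" by (simp add: C_def)
  have "(\<integral>\<^sup>+\<omega>. ennreal (exp (s * (\<Sum>k\<in>insert i F. (V k \<omega>)\<^sup>2) + (\<Sum>k\<in>?R. u k * V k \<omega>))) \<partial>P)
    = (\<integral>\<^sup>+\<omega>. (\<integral>\<^sup>+w. ennreal (?N w) * ennreal (exp (?c * w * V i \<omega> + G \<omega>)) \<partial>lborel) \<partial>P)"
  proof (intro nn_integral_cong)
    fix \<omega>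
    have "(\<integral>\<^sup>+w. ennreal (?N w) * ennreal (exp (?c * w * V i \<omega> + G \<omega>)) \<partial>lborel)
      = (\<integral>\<^sup>+w. ennreal (exp (G \<omega>)) * (ennreal (?N w) * ennreal (exp ((?c * V i \<omega>) * w))) \<partial>lborel)"
      by (intro nn_integral_cong) (simp add: ennreal_mult[symmetric] exp_add ac_simps)
    also have "\<dots> = ennreal (exp (G \<omega>)) * ennreal (exp ((?c * V i \<omega>)\<^sup>2 * 1\<^sup>2 / 2))"
      by (subst nn_integral_cmult) (simp_all only: normal_exp_moment[OF zero_less_one], simp)
    also have "\<dots> = ennreal (exp (s * (\<Sum>k\<in>insert i F. (V k \<omega>)\<^sup>2) + (\<Sum>k\<in>?R. u k * V k \<omega>)))"
      using insert s by (simp add: ennreal_mult[symmetric] mult_exp_exp G_def power_mult_distrib algebra_simps)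
    finally show "ennreal (exp (s * (\<Sum>k\<in>insert i F. (V k \<omega>)\<^sup>2) + (\<Sum>k\<in>?R. u k * V k \<omega>))) =
      (\<integral>\<^sup>+w. ennreal (?N w) * ennreal (exp (?c * w * V i \<omega> + G \<omega>)) \<partial>lborel)" by simp
  qed
  also have "\<dots> = (\<integral>\<^sup>+w. (\<integral>\<^sup>+\<omega>. ennreal (?N w) * ennreal (exp (?c * w * V i \<omega> + G \<omega>)) \<partial>P) \<partial>lborel)"
    by (subst Fubini') (simp_all add: case_prod_beta)
  also have "\<dots> \<le> (\<integral>\<^sup>+w. ennreal C * (ennreal (?N w) * ennreal (exp (s * w\<^sup>2))) \<partial>lborel)"
  proof (intro nn_integral_mono)
    fix w
    define u' where "u' = u(i := ?c * w)"
    have 1: "(\<Sum>k\<in>K - F. u' k * V k \<omega>) = ?c * w * V i \<omega> + (\<Sum>k\<in>?R. u k * V k \<omega>)" for \<omega>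
      unfolding KF using finR by (subst sum.insert) (auto simp: u'_def intro!: sum.cong)
    have 2: "(\<Sum>k\<in>K - F. (u' k)\<^sup>2) = 2 * s * w\<^sup>2 + (\<Sum>k\<in>?R. (u k)\<^sup>2)"
      unfolding KF using finR s by (subst sum.insert) (auto simp: u'_def power_mult_distrib intro!: sum.cong)
    have 3: "?c * w * V i \<omega> + G \<omega> = s * (\<Sum>k\<in>F. (V k \<omega>)\<^sup>2) + (\<Sum>k\<in>K - F. u' k * V k \<omega>)" for \<omega>
      unfolding 1 G_def by simp
    have "(\<integral>\<^sup>+\<omega>. ennreal (?N w) * ennreal (exp (?c * w * V i \<omega> + G \<omega>)) \<partial>P)
      = ennreal (?N w) * (\<integral>\<^sup>+\<omega>. ennreal (exp (?c * w * V i \<omega> + G \<omega>)) \<partial>P)"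
      by (rule nn_integral_cmult) simp
    also have "\<dots> = ennreal (?N w) * (\<integral>\<^sup>+\<omega>. ennreal (exp (s * (\<Sum>k\<in>F. (V k \<omega>)\<^sup>2) + (\<Sum>k\<in>K - F. u' k * V k \<omega>))) \<partial>P)"
      unfolding 3 ..
    also have "\<dots> \<le> ennreal (?N w) * ennreal ((1 - 2 * s) powr (- real (card F) / 2) * exp ((\<Sum>k\<in>K - F. (u' k)\<^sup>2) / 2))"
      by (intro mult_left_mono insert.IH FK) simp
    also have "\<dots> = ennreal C * (ennreal (?N w) * ennreal (exp (s * w\<^sup>2)))"
      unfolding 2 using C by (simp add: ennreal_mult[symmetric] C_def add_divide_distrib exp_add ac_simps)
    finally show "(\<integral>\<^sup>+\<omega>. ennreal (?N w) * ennreal (exp (?c * w * V i \<omega> + G \<omega>)) \<partial>P)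
      \<le> ennreal C * (ennreal (?N w) * ennreal (exp (s * w\<^sup>2)))" .
  qed
  also have "\<dots> = ennreal C * ennreal ((1 - 2 * s) powr (- 1 / 2))"
    by (subst nn_integral_cmult) (simp_all add: normal_exp_square_moment[OF s(2)])
  also have "\<dots> = ennreal ((1 - 2 * s) powr (- real (card (insert i F)) / 2) * exp ((\<Sum>k\<in>?R. (u k)\<^sup>2) / 2))"
  proof -
    have "(1 - 2 * s) powr (- real (card (insert i F)) / 2) = (1 - 2 * s) powr (- real (card F) / 2) * (1 - 2 * s) powr (- 1 / 2)"
    proof -
      have "- real (card (insert i F)) / 2 = - real (card F) / 2 + - 1 / 2" using insert by (simp add: field_simps)
      then show ?thesis by (simp only: powr_add)
    qed
    then show ?thesis using C by (simp add: ennreal_mult[symmetric] C_def ac_simps)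
  qed
  finally show ?case .
qed

text \<open>
  The exponential moment of the chi-square distribution, as an upper bound for jointly sub-Gaussian variables.
\<close>

lemma chi_square_exp_moment:
  fixes V :: "'k \<Rightarrow> 'w \<Rightarrow> real"
  assumes "prob_space P" "finite K" "\<And>k. k \<in> K \<Longrightarrow> V k \<in> borel_measurable P"
    and "\<And>u. (\<integral>\<^sup>+\<omega>. ennreal (exp (\<Sum>k\<in>K. u k * V k \<omega>)) \<partial>P) \<le> ennreal (exp ((\<Sum>k\<in>K. (u k)\<^sup>2) / 2))"
    and "0 \<le> s" "s < 1/2"
  shows "(\<integral>\<^sup>+\<omega>. ennreal (exp (s * (\<Sum>k\<in>K. (V k \<omega>)\<^sup>2))) \<partial>P) \<le> ennreal ((1 - 2 * s) powr (- real (card K) / 2))"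
  using chi_square_exp_moment_aux[OF assms(1-4), where F = K and s = s] assms(5,6) by simp

section \<open>Integrals with respect to the observed process\<close>

lemma ennreal_tendsto_0_le:
  fixes u w :: "nat \<Rightarrow> ennreal"
  assumes "\<And>l. u l \<le> w l" "w \<longlonglongrightarrow> 0"
  shows "u \<longlonglongrightarrow> 0"
  by (rule tendsto_sandwich[OF _ _ tendsto_const assms(2)]) (use assms(1) in auto)

lemma bounded_integrable_unit:
  assumes "h \<in> borel_measurable unit_lebesgue" "\<And>x. x \<in> {0..1} \<Longrightarrow> \<bar>h x\<bar> \<le> (C :: real)"
  shows "integrable unit_lebesgue h"
proof -
  interpret prob_space unit_lebesgue by (rule prob_space_unit_lebesgue)
  show ?thesis by (rule integrable_const_bound[of _ C]) (use assms in \<open>auto simp: space_restrict_space intro!: AE_I2\<close>)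
qed

lemma continuous_on_unit_bound:
  fixes g :: "real \<Rightarrow> real"
  assumes "continuous_on {0..1} g"
  obtains C where "C > 0" "\<And>x. x \<in> {0..1} \<Longrightarrow> \<bar>g x\<bar> \<le> C"
proof -
  have "bounded (g ` {0..1})" using assms by (intro compact_imp_bounded compact_continuous_image) auto
  then obtain C where "C > 0" "\<forall>y\<in>g ` {0..1}. norm y \<le> C" unfolding bounded_pos by blast
  then show ?thesis by (intro that[of C]) auto
qed

lemma continuous_on_unit_integrable:
  fixes g :: "real \<Rightarrow> real"
  assumes "continuous_on {0..1} g"
  shows "integrable unit_lebesgue g"
  using continuous_on_unit_bound[OF assms] bounded_integrable_unit[OF continuous_on_unit_measurable[OF assms]] by metis

lemma abs_step_fun_le: "\<bar>step_fun m p a x\<bar> \<le> (\<Sum>i<m. \<bar>a i\<bar>)"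
  unfolding step_fun_def
  by (rule order_trans[OF sum_abs]) (auto intro!: sum_mono split: split_indicator)

lemma square_integral_le:
  assumes f: "\<And>x. x \<in> {0..1} \<Longrightarrow> \<bar>f x\<bar> \<le> C" "f \<in> borel_measurable unit_lebesgue"
    and h: "h \<in> borel_measurable unit_lebesgue" "\<And>x. x \<in> {0..1} \<Longrightarrow> \<bar>h x\<bar> \<le> D"
  shows "ennreal ((LINT t|unit_lebesgue. f t * h t)\<^sup>2) \<le> ennreal (C\<^sup>2) * (\<integral>\<^sup>+t. ennreal ((h t)\<^sup>2) \<partial>unit_lebesgue)"
proof -
  interpret prob_space unit_lebesgue by (rule prob_space_unit_lebesgue)
  note [measurable] = f(2) h(1)
  have C: "C \<ge> 0" using f(1)[of 0] by auto
  have int: "integrable unit_lebesgue (\<lambda>t. \<bar>h t\<bar>)" by (rule bounded_integrable_unit[of _ D]) (use h in auto)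
  have "\<bar>LINT t|unit_lebesgue. f t * h t\<bar> \<le> (LINT t|unit_lebesgue. C * \<bar>h t\<bar>)"
  proof (rule order_trans[OF integral_abs_bound integral_mono])
    show "integrable unit_lebesgue (\<lambda>t. \<bar>f t * h t\<bar>)"
      by (rule bounded_integrable_unit[of _ "C * D"]) (use f h C in \<open>auto simp: abs_mult intro!: mult_mono\<close>)
    show "integrable unit_lebesgue (\<lambda>t. C * \<bar>h t\<bar>)" using int by simp
    show "\<bar>f t * h t\<bar> \<le> C * \<bar>h t\<bar>" if "t \<in> space unit_lebesgue" for t
      using that f(1)[of t] by (auto simp: abs_mult space_restrict_space intro!: mult_right_mono)
  qed
  also have "\<dots> = C * (LINT t|unit_lebesgue. \<bar>h t\<bar>)" by simp
  finally have "(LINT t|unit_lebesgue. f t * h t)\<^sup>2 \<le> (C * (LINT t|unit_lebesgue. \<bar>h t\<bar>))\<^sup>2"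
    using C by (simp add: abs_le_square_iff[symmetric] abs_mult)
  then have "ennreal ((LINT t|unit_lebesgue. f t * h t)\<^sup>2) \<le> ennreal (C\<^sup>2) * (ennreal (LINT t|unit_lebesgue. \<bar>h t\<bar>))\<^sup>2"
    using C by (simp add: power_mult_distrib ennreal_mult[symmetric] ennreal_power)
  also have "ennreal (LINT t|unit_lebesgue. \<bar>h t\<bar>) = (\<integral>\<^sup>+t. ennreal \<bar>h t\<bar> * 1 \<partial>unit_lebesgue)"
    using nn_integral_eq_integral[OF int] by simp
  also have "\<dots>\<^sup>2 \<le> (\<integral>\<^sup>+t. (ennreal \<bar>h t\<bar>)\<^sup>2 \<partial>unit_lebesgue) * (\<integral>\<^sup>+t. 1\<^sup>2 \<partial>unit_lebesgue)"
    by (rule Cauchy_Schwarz_nn_integral) simp_all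
  also have "\<dots> = (\<integral>\<^sup>+t. ennreal ((h t)\<^sup>2) \<partial>unit_lebesgue)"
    using emeasure_space_1 by (simp add: ennreal_power)
  finally show ?thesis by (simp add: mult_left_mono)
qed

text \<open>
  The drift of the observed process contributes the inner product of $f$ with the step function.
\<close>

lemma step_integral_observation:
  assumes f: "continuous_on {0..1} f" and part: "partition01 m p"
  shows "step_integral (observation B n f) m p a \<omega>
    = (LINT t|unit_lebesgue. f t * step_fun m p a t) + step_integral B m p a \<omega> / sqrt (real n)"
proof -
  have int: "set_integrable lborel {0..1} f" by (rule borel_integrable_atLeastAtMost'[OF f])
  have incr: "observation B n f (p (Suc i)) \<omega> - observation B n f (p i) \<omega>
     = (LINT x:{p i<..p (Suc i)}|lborel. f x) + (B (p (Suc i)) \<omega> - B (p i) \<omega>) / sqrt (real n)" if "i < m" for i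
  proof -
    have p: "0 \<le> p i" "p i \<le> p (Suc i)" "p (Suc i) \<le> 1"
      using partition01_range[OF part, of i] partition01_range[OF part, of "Suc i"] that part
      by (auto simp: partition01_def)
    have "(LINT x:{0..p i} \<union> {p i<..p (Suc i)}|lborel. f x) = (LINT x:{0..p i}|lborel. f x) + (LINT x:{p i<..p (Suc i)}|lborel. f x)"
      by (rule set_integral_Un) (use p in \<open>auto intro!: set_integrable_subset[OF int]\<close>)
    moreover have "{0..p i} \<union> {p i<..p (Suc i)} = {0..p (Suc i)}" using p by auto
    ultimately show ?thesis by (simp add: observation_def diff_divide_distrib)
  qed
  have piece: "(LINT t|unit_lebesgue. f t * indicator {p i<..p (Suc i)} t) = (LINT x:{p i<..p (Suc i)}|lborel. f x)"
    if "i < m" for i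
  proof -
    have "{p i<..p (Suc i)} \<subseteq> {0..1}"
      using partition01_range[OF part, of i] partition01_range[OF part, of "Suc i"] that by auto
    then show ?thesis unfolding set_lebesgue_integral_unit[symmetric] set_lebesgue_integral_def
      by (intro Bochner_Integration.integral_cong) (auto split: split_indicator)
  qed
  obtain C where C: "\<And>x. x \<in> {0..1} \<Longrightarrow> \<bar>f x\<bar> \<le> C" "C > 0" using continuous_on_unit_bound[OF f] by metis
  have inti: "integrable unit_lebesgue (\<lambda>t. f t * (a i * indicator {p i<..p (Suc i)} t))" for i
  proof (rule bounded_integrable_unit[of _ "C * \<bar>a i\<bar>"])
    show "(\<lambda>t. f t * (a i * indicator {p i<..p (Suc i)} t)) \<in> borel_measurable unit_lebesgue"
      by (intro borel_measurable_times continuous_on_unit_measurable[OF f] borel_measurable_unit) auto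
  qed (use C in \<open>auto simp: abs_mult split: split_indicator intro!: mult_mono\<close>)
  have "(LINT t|unit_lebesgue. f t * step_fun m p a t) = (LINT t|unit_lebesgue. (\<Sum>i<m. f t * (a i * indicator {p i<..p (Suc i)} t)))"
    by (simp only: step_fun_def sum_distrib_left)
  also have "\<dots> = (\<Sum>i<m. LINT t|unit_lebesgue. f t * (a i * indicator {p i<..p (Suc i)} t))"
    by (intro Bochner_Integration.integral_sum inti)
  also have "\<dots> = (\<Sum>i<m. a i * (LINT x:{p i<..p (Suc i)}|lborel. f x))"
  proof (intro sum.cong refl)
    fix i assume "i \<in> {..<m}"
    then show "(LINT t|unit_lebesgue. f t * (a i * indicator {p i<..p (Suc i)} t)) = a i * (LINT x:{p i<..p (Suc i)}|lborel. f x)"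
      by (simp only: mult.left_commute[of _ "a i"] integral_mult_right_zero piece lessThan_iff)
  qed
  finally show ?thesis
    using incr by (simp add: step_integral_def sum.distrib[symmetric] sum_divide_distrib distrib_left)
qed

lemma L2_tendsto_affine:
  fixes X :: "nat \<Rightarrow> 'w \<Rightarrow> real"
  assumes "prob_space P" and [measurable]: "\<And>l. X l \<in> borel_measurable P"
    and X: "(\<lambda>l. \<integral>\<^sup>+\<omega>. ennreal ((X l \<omega>)\<^sup>2) \<partial>P) \<longlonglongrightarrow> 0" and d: "(\<lambda>l. ennreal ((d l)\<^sup>2)) \<longlonglongrightarrow> 0"
  shows "(\<lambda>l. \<integral>\<^sup>+\<omega>. ennreal ((c * X l \<omega> + c' * d l)\<^sup>2) \<partial>P) \<longlonglongrightarrow> 0"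
proof -
  interpret prob_space P by fact
  have le: "(\<integral>\<^sup>+\<omega>. ennreal ((c * X l \<omega> + c' * d l)\<^sup>2) \<partial>P)
     \<le> ennreal (2 * c\<^sup>2) * (\<integral>\<^sup>+\<omega>. ennreal ((X l \<omega>)\<^sup>2) \<partial>P) + ennreal (2 * c'\<^sup>2) * ennreal ((d l)\<^sup>2)" (is "_ \<le> ?W l") for l
  proof -
    have "(\<integral>\<^sup>+\<omega>. ennreal ((c * X l \<omega> + c' * d l)\<^sup>2) \<partial>P)
      \<le> (\<integral>\<^sup>+\<omega>. ennreal (2 * c\<^sup>2) * ennreal ((X l \<omega>)\<^sup>2) + ennreal (2 * c'\<^sup>2) * ennreal ((d l)\<^sup>2) \<partial>P)"
    proof (intro nn_integral_mono)
      fix \<omega>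
      have "(c * X l \<omega> + c' * d l)\<^sup>2 \<le> 2 * c\<^sup>2 * (X l \<omega>)\<^sup>2 + 2 * c'\<^sup>2 * (d l)\<^sup>2"
        using sum_squares_bound[of "c * X l \<omega>" "c' * d l"] by (simp add: power2_sum power_mult_distrib)
      then show "ennreal ((c * X l \<omega> + c' * d l)\<^sup>2) \<le> ennreal (2 * c\<^sup>2) * ennreal ((X l \<omega>)\<^sup>2) + ennreal (2 * c'\<^sup>2) * ennreal ((d l)\<^sup>2)"
        by (simp add: ennreal_mult[symmetric] ennreal_plus[symmetric] del: ennreal_plus)
    qed
    also have "\<dots> = ennreal (2 * c\<^sup>2) * (\<integral>\<^sup>+\<omega>. ennreal ((X l \<omega>)\<^sup>2) \<partial>P) + ennreal (2 * c'\<^sup>2) * ennreal ((d l)\<^sup>2)"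
      by (subst nn_integral_add) (simp_all add: nn_integral_cmult emeasure_space_1)
    finally show ?thesis .
  qed
  have "(\<lambda>l. ennreal (2 * c\<^sup>2) * (\<integral>\<^sup>+\<omega>. ennreal ((X l \<omega>)\<^sup>2) \<partial>P) + ennreal (2 * c'\<^sup>2) * ennreal ((d l)\<^sup>2)) \<longlonglongrightarrow>
    ennreal (2 * c\<^sup>2) * 0 + ennreal (2 * c'\<^sup>2) * 0"
    by (intro tendsto_add ennreal_tendsto_cmult X d) auto
  then have lim0: "(\<lambda>l. ?W l) \<longlonglongrightarrow> 0" by simp
  from ennreal_tendsto_0_le[OF le lim0] show ?thesis .
qed

lemma integral_step_fun_tendsto:
  assumes f: "continuous_on {0..1} f" and g: "continuous_on {0..1} g"
    and lim: "(\<lambda>l. \<integral>\<^sup>+t. ennreal ((g t - step_fun (m l) (p l) (a l) t)\<^sup>2) \<partial>unit_lebesgue) \<longlonglongrightarrow> 0"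
  shows "(\<lambda>l. ennreal (((LINT t|unit_lebesgue. f t * g t) - (LINT t|unit_lebesgue. f t * step_fun (m l) (p l) (a l) t))\<^sup>2)) \<longlonglongrightarrow> 0"
proof -
  obtain C where C: "\<And>x. x \<in> {0..1} \<Longrightarrow> \<bar>f x\<bar> \<le> C" "C > 0" using continuous_on_unit_bound[OF f] by metis
  obtain D where D: "\<And>x. x \<in> {0..1} \<Longrightarrow> \<bar>g x\<bar> \<le> D" "D > 0" using continuous_on_unit_bound[OF g] by metis
  let ?s = "\<lambda>l. step_fun (m l) (p l) (a l)"
  have fm: "f \<in> borel_measurable unit_lebesgue" and gm: "g \<in> borel_measurable unit_lebesgue"
    using f g by (auto intro: continuous_on_unit_measurable)
  have sm: "?s l \<in> borel_measurable unit_lebesgue" for l by (intro borel_measurable_unit) auto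
  have le: "ennreal (((LINT t|unit_lebesgue. f t * g t) - (LINT t|unit_lebesgue. f t * ?s l t))\<^sup>2)
     \<le> ennreal (C\<^sup>2) * (\<integral>\<^sup>+t. ennreal ((g t - ?s l t)\<^sup>2) \<partial>unit_lebesgue)" (is "_ \<le> ?W l") for l
  proof -
    have "integrable unit_lebesgue (\<lambda>t. f t * g t)"
      by (intro continuous_on_unit_integrable continuous_on_mult f g)
    moreover have "integrable unit_lebesgue (\<lambda>t. f t * ?s l t)"
    proof (rule bounded_integrable_unit)
      show "\<bar>f x * ?s l x\<bar> \<le> C * (\<Sum>i<m l. \<bar>a l i\<bar>)" if "x \<in> {0..1}" for x
        unfolding abs_mult using C that abs_step_fun_le by (intro mult_mono) auto
    qed (intro borel_measurable_times fm sm)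
    ultimately have "(LINT t|unit_lebesgue. f t * g t) - (LINT t|unit_lebesgue. f t * ?s l t)
       = (LINT t|unit_lebesgue. f t * (g t - ?s l t))"
      by (simp add: right_diff_distrib)
    moreover have hb: "\<bar>g x - ?s l x\<bar> \<le> D + (\<Sum>i<m l. \<bar>a l i\<bar>)" if "x \<in> {0..1}" for x
      using D(1)[OF that] abs_step_fun_le[of "m l" "p l" "a l" x] by linarith
    ultimately show ?thesis
      using square_integral_le[OF C(1) fm borel_measurable_diff[OF gm sm] hb] by simp
  qed
  have "(\<lambda>l. ennreal (C\<^sup>2) * (\<integral>\<^sup>+t. ennreal ((g t - ?s l t)\<^sup>2) \<partial>unit_lebesgue)) \<longlonglongrightarrow> ennreal (C\<^sup>2) * 0"
    by (intro ennreal_tendsto_cmult lim) auto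
  then have lim0: "(\<lambda>l. ?W l) \<longlonglongrightarrow> 0" by simp
  from ennreal_tendsto_0_le[OF le lim0] show ?thesis .
qed

text \<open>
  The standardised empirical coefficient is a Wiener integral with respect to the Brownian motion itself, whichever version of
  the integral is taken.
\<close>

lemma noise_has_stoch_integral:
  assumes B: "brownian_motion P B" and f: "continuous_on {0..1} f" and g: "continuous_on {0..1} g" and n: "n \<ge> 1"
    and W: "has_stoch_integral P (observation B n f) g W"
  shows "has_stoch_integral P B g (\<lambda>\<omega>. sqrt (real n) * (W \<omega> - (LINT t|unit_lebesgue. f t * g t)))"
proof -
  interpret prob_space P using B by (simp add: brownian_motion_def)
  from W obtain m p a where part: "\<And>l. partition01 (m l) (p l)"
    and l1: "(\<lambda>l. \<integral>\<^sup>+t. ennreal ((g t - step_fun (m l) (p l) (a l) t)\<^sup>2) \<partial>unit_lebesgue) \<longlonglongrightarrow> 0"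
    and l2: "(\<lambda>l. \<integral>\<^sup>+\<omega>. ennreal ((W \<omega> - step_integral (observation B n f) (m l) (p l) (a l) \<omega>)\<^sup>2) \<partial>P) \<longlonglongrightarrow> 0"
    and [measurable]: "W \<in> borel_measurable P"
    unfolding has_stoch_integral_def set_nn_integral_unit by blast
  let ?\<theta> = "LINT t|unit_lebesgue. f t * g t"
  let ?I = "\<lambda>l. LINT t|unit_lebesgue. f t * step_fun (m l) (p l) (a l) t"
  let ?Z = "\<lambda>l. step_integral (observation B n f) (m l) (p l) (a l)"
  note obs = step_integral_observation[OF f part]
  have [measurable]: "step_integral B (m l) (p l) (a l) \<in> borel_measurable P" for l
    by (rule step_integral_measurable[OF B part])
  have "?Z l \<in> borel_measurable P" for l unfolding obs[abs_def] by measurable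
  then have "(\<lambda>l. \<integral>\<^sup>+\<omega>. ennreal ((sqrt (real n) * (W \<omega> - ?Z l \<omega>) + - sqrt (real n) * (?\<theta> - ?I l))\<^sup>2) \<partial>P) \<longlonglongrightarrow> 0"
    by (intro L2_tendsto_affine integral_step_fun_tendsto[OF f g l1] l2) (auto intro: prob_space_axioms)
  moreover have "sqrt (real n) * (W \<omega> - ?Z l \<omega>) + - sqrt (real n) * (?\<theta> - ?I l)
    = sqrt (real n) * (W \<omega> - ?\<theta>) - step_integral B (m l) (p l) (a l) \<omega>" for l \<omega>
    using n unfolding obs by (simp add: field_simps)
  ultimately have "(\<lambda>l. \<integral>\<^sup>+\<omega>. ennreal ((sqrt (real n) * (W \<omega> - ?\<theta>) - step_integral B (m l) (p l) (a l) \<omega>)\<^sup>2) \<partial>P) \<longlonglongrightarrow> 0"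
    by simp
  with part l1 show ?thesis
    unfolding has_stoch_integral_def set_nn_integral_unit
    by (intro conjI exI[of _ m] exI[of _ p] exI[of _ a] allI) auto
qed

text \<open>
  The converse passage; it shows that the choice in \<open>stoch_integral\<close> is a choice from a nonempty set.
\<close>

lemma observation_has_stoch_integral:
  assumes B: "brownian_motion P B" and f: "continuous_on {0..1} f" and g: "continuous_on {0..1} g" and n: "n \<ge> 1"
    and V: "has_stoch_integral P B g V"
  shows "has_stoch_integral P (observation B n f) g (\<lambda>\<omega>. (LINT t|unit_lebesgue. f t * g t) + V \<omega> / sqrt (real n))"
proof -
  interpret prob_space P using B by (simp add: brownian_motion_def)
  from V obtain m p a where part: "\<And>l. partition01 (m l) (p l)"
    and l1: "(\<lambda>l. \<integral>\<^sup>+t. ennreal ((g t - step_fun (m l) (p l) (a l) t)\<^sup>2) \<partial>unit_lebesgue) \<longlonglongrightarrow> 0"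
    and l2: "(\<lambda>l. \<integral>\<^sup>+\<omega>. ennreal ((V \<omega> - step_integral B (m l) (p l) (a l) \<omega>)\<^sup>2) \<partial>P) \<longlonglongrightarrow> 0"
    and [measurable]: "V \<in> borel_measurable P"
    unfolding has_stoch_integral_def set_nn_integral_unit by blast
  let ?\<theta> = "LINT t|unit_lebesgue. f t * g t"
  let ?I = "\<lambda>l. LINT t|unit_lebesgue. f t * step_fun (m l) (p l) (a l) t"
  note obs = step_integral_observation[OF f part]
  have [measurable]: "step_integral B (m l) (p l) (a l) \<in> borel_measurable P" for l
    by (rule step_integral_measurable[OF B part])
  have "(\<lambda>l. \<integral>\<^sup>+\<omega>. ennreal ((1 / sqrt (real n) * (V \<omega> - step_integral B (m l) (p l) (a l) \<omega>) + 1 * (?\<theta> - ?I l))\<^sup>2) \<partial>P) \<longlonglongrightarrow> 0"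
    by (intro L2_tendsto_affine integral_step_fun_tendsto[OF f g l1] l2) (auto intro: prob_space_axioms)
  moreover have "1 / sqrt (real n) * (V \<omega> - step_integral B (m l) (p l) (a l) \<omega>) + 1 * (?\<theta> - ?I l)
    = ?\<theta> + V \<omega> / sqrt (real n) - step_integral (observation B n f) (m l) (p l) (a l) \<omega>" for l \<omega>
    unfolding obs by (simp add: diff_divide_distrib)
  ultimately have "(\<lambda>l. \<integral>\<^sup>+\<omega>. ennreal ((?\<theta> + V \<omega> / sqrt (real n) - step_integral (observation B n f) (m l) (p l) (a l) \<omega>)\<^sup>2) \<partial>P) \<longlonglongrightarrow> 0"
    by (simp only:)
  with part l1 show ?thesis
    unfolding has_stoch_integral_def set_nn_integral_unit
    by (intro conjI exI[of _ m] exI[of _ p] exI[of _ a] allI) auto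
qed

lemma stoch_integral_observation:
  assumes B: "brownian_motion P B" and f: "continuous_on {0..1} f" and g: "continuous_on {0..1} g" and n: "n \<ge> 1"
  shows "has_stoch_integral P (observation B n f) g (stoch_integral P (observation B n f) g)"
proof -
  obtain V where "has_stoch_integral P B g V" using continuous_has_stoch_integral[OF B g] by blast
  from observation_has_stoch_integral[OF B f g n this] have "\<exists>W. has_stoch_integral P (observation B n f) g W" by blast
  from someI_ex[OF this] show ?thesis unfolding stoch_integral_def .
qed

section \<open>Local polynomial approximation in the Hoelder class\<close>

text \<open>
  Induction on the order: apply the bound to the derivative, integrate the approximating polynomial termwise, and compare by
  the mean value theorem on the segment from $t_0$ to $t$. The bound
  for the derivative grows along the segment, so its value at $t$ serves for the whole segment.
\<close>

lemma taylor_bound: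
  fixes \<alpha> M t0 :: real
  assumes "derivs_on {0..1} k f D" and "real k < \<alpha>" and M: "M > 0" and t0: "t0 \<in> {0..1}"
    and "\<And>x y. 0 \<le> x \<Longrightarrow> x < y \<Longrightarrow> y \<le> 1 \<Longrightarrow> \<bar>D k x - D k y\<bar> \<le> M * \<bar>x - y\<bar> powr (\<alpha> - real k)"
  shows "\<exists>a. \<forall>t\<in>{0..1}. \<bar>f t - (\<Sum>i\<le>k. a i * (t - t0) ^ i)\<bar> \<le> M * \<bar>t - t0\<bar> powr \<alpha>"
  using assms(1,2,5)
proof (induction k arbitrary: f D \<alpha>)
  case 0
  have "\<bar>f t - f t0\<bar> \<le> M * \<bar>t - t0\<bar> powr \<alpha>" if "t \<in> {0..1}" for t
    using 0(3)[of t t0] 0(3)[of t0 t] 0(1) that t0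
    by (cases t t0 rule: linorder_cases) (auto simp: derivs_on_def abs_minus_commute)
  then show ?case by (intro exI[of _ "\<lambda>_. f t0"]) auto
next
  case (Suc k)
  have D0: "D 0 x = f x" if "x \<in> {0..1}" for x using Suc.prems(1) that by (auto simp: derivs_on_def)
  have D1: "(D 0 has_real_derivative D 1 x) (at x within {0..1})" if "x \<in> {0..1}" for x
    using Suc.prems(1) that by (auto simp: derivs_on_def)
  have "\<exists>a. \<forall>t\<in>{0..1}. \<bar>D 1 t - (\<Sum>i\<le>k. a i * (t - t0) ^ i)\<bar> \<le> M * \<bar>t - t0\<bar> powr (\<alpha> - 1)"
  proof (rule Suc.IH[of "D 1" "\<lambda>i. D (Suc i)" "\<alpha> - 1"])
    show "derivs_on {0..1} k (D 1) (\<lambda>i. D (Suc i))" using Suc.prems(1) by (auto simp: derivs_on_def)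
    show "real k < \<alpha> - 1" using Suc.prems(2) by simp
    show "\<bar>D (Suc k) x - D (Suc k) y\<bar> \<le> M * \<bar>x - y\<bar> powr (\<alpha> - 1 - real k)"
      if "0 \<le> x" "x < y" "y \<le> 1" for x y
      using Suc.prems(3)[OF that] by (simp add: algebra_simps)
  qed
  then obtain a where a: "\<And>t. t \<in> {0..1} \<Longrightarrow> \<bar>D 1 t - (\<Sum>i\<le>k. a i * (t - t0) ^ i)\<bar> \<le> M * \<bar>t - t0\<bar> powr (\<alpha> - 1)"
    by blast
  define b where "b i = (case i of 0 \<Rightarrow> f t0 | Suc i \<Rightarrow> a i / real (Suc i))" for i
  define h where "h t = D 0 t - (f t0 + (\<Sum>i\<le>k. a i / real (Suc i) * (t - t0) ^ Suc i))" for t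
  have bsum: "(\<Sum>i\<le>Suc k. b i * (t - t0) ^ i) = f t0 + (\<Sum>i\<le>k. a i / real (Suc i) * (t - t0) ^ Suc i)" for t
    by (subst sum.atMost_Suc_shift) (simp add: b_def)
  have "\<bar>f t - (\<Sum>i\<le>Suc k. b i * (t - t0) ^ i)\<bar> \<le> M * \<bar>t - t0\<bar> powr \<alpha>" if t: "t \<in> {0..1}" for t
  proof (cases "t = t0")
    case True
    then show ?thesis unfolding bsum by simp
  next
    case False
    have sub: "closed_segment t0 t \<subseteq> {0..1}" using t t0 by (simp add: closed_segment_subset)
    have "norm (h t - h t0) \<le> M * \<bar>t - t0\<bar> powr (\<alpha> - 1) * norm (t - t0)"
    proof (rule field_differentiable_bound)
      show "convex (closed_segment t0 t)" by simp
      fix z assume z: "z \<in> closed_segment t0 t"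
      then have z01: "z \<in> {0..1}" using sub by auto
      have *: "(h has_real_derivative D 1 z - (0 + (\<Sum>i\<le>k. a i / real (Suc i) * (real (Suc i) * (z - t0) ^ i)))) (at z within {0..1})"
        unfolding h_def
        by (rule derivative_eq_intros D1 z01 | simp add: mult.commute)+
      then have "(h has_real_derivative D 1 z - (\<Sum>i\<le>k. a i * (z - t0) ^ i)) (at z within {0..1})"
      proof -
        have "(\<Sum>i\<le>k. a i / real (Suc i) * (real (Suc i) * (z - t0) ^ i)) = (\<Sum>i\<le>k. a i * (z - t0) ^ i)"
          by (intro sum.cong refl) simp
        with * show ?thesis by (simp only: add_0_left)
      qed
      then show "(h has_real_derivative D 1 z - (\<Sum>i\<le>k. a i * (z - t0) ^ i)) (at z within closed_segment t0 t)"
        by (rule DERIV_subset[OF _ sub])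
      have "\<bar>z - t0\<bar> \<le> \<bar>t - t0\<bar>" using segment_bound1[OF z] by (simp add: abs_minus_commute)
      then have "\<bar>z - t0\<bar> powr (\<alpha> - 1) \<le> \<bar>t - t0\<bar> powr (\<alpha> - 1)"
        using Suc.prems(2) by (intro powr_mono2) auto
      then have "M * \<bar>z - t0\<bar> powr (\<alpha> - 1) \<le> M * \<bar>t - t0\<bar> powr (\<alpha> - 1)" using M by simp
      with a[OF z01] show "norm (D 1 z - (\<Sum>i\<le>k. a i * (z - t0) ^ i)) \<le> M * \<bar>t - t0\<bar> powr (\<alpha> - 1)" by simp
    qed auto
    also have "\<dots> = M * \<bar>t - t0\<bar> powr \<alpha>"
      using False by (simp add: powr_diff)
    finally show ?thesis
      unfolding bsum using D0[OF t] D0[OF t0] by (simp add: h_def)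
  qed
  then show ?case by blast
qed

lemma holder_class_taylor:
  assumes "f \<in> holder_class \<alpha> M" "\<alpha> > 0" "M > 0" "real r > \<alpha>" "t0 \<in> {0..1}"
  obtains k a where "k < r" "\<And>t. t \<in> {0..1} \<Longrightarrow> \<bar>f t - (\<Sum>i\<le>k. a i * (t - t0) ^ i)\<bar> \<le> M * \<bar>t - t0\<bar> powr \<alpha>"
proof -
  define k where "k = nat (\<lceil>\<alpha>\<rceil> - 1)"
  have k: "real k < \<alpha>" unfolding k_def using assms(2) by linarith
  obtain D where "derivs_on {0..1} k f D" "\<And>x y. 0 \<le> x \<Longrightarrow> x < y \<Longrightarrow> y \<le> 1 \<Longrightarrow> \<bar>D k x - D k y\<bar> \<le> M * \<bar>x - y\<bar> powr (\<alpha> - real k)"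
    using assms(1) unfolding holder_class_def k_def[symmetric] Let_def by blast
  from taylor_bound[OF this(1) k assms(3,5) this(2)] obtain a where
    "\<And>t. t \<in> {0..1} \<Longrightarrow> \<bar>f t - (\<Sum>i\<le>k. a i * (t - t0) ^ i)\<bar> \<le> M * \<bar>t - t0\<bar> powr \<alpha>" by blast
  moreover have "k < r" using k assms(4) by linarith
  ultimately show ?thesis by (rule that[rotated])
qed

text \<open>
  Near $t_0$ the function differs from a polynomial by at most $M |t - t_0|^\alpha$.
\<close>

lemma holder_class_continuous:
  assumes "f \<in> holder_class \<alpha> M" "\<alpha> > 0" "M > 0"
  shows "continuous_on {0..1} f"
  unfolding continuous_on_def
proof
  fix t0 :: real assume t0: "t0 \<in> {0..1}"
  obtain r :: nat where r: "real r > \<alpha>" using reals_Archimedean2 by blast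
  obtain k a where ka: "\<And>t. t \<in> {0..1} \<Longrightarrow> \<bar>f t - (\<Sum>i\<le>k. a i * (t - t0) ^ i)\<bar> \<le> M * \<bar>t - t0\<bar> powr \<alpha>"
    using holder_class_taylor[OF assms r t0] by metis
  let ?T = "\<lambda>t. \<Sum>i\<le>k. a i * (t - t0) ^ i"
  have T0: "?T t0 = f t0" using ka[OF t0] by simp
  have "((\<lambda>t. f t - ?T t) \<longlongrightarrow> 0) (at t0 within {0..1})"
  proof (rule Lim_null_comparison)
    show "\<forall>\<^sub>F t in at t0 within {0..1}. norm (f t - ?T t) \<le> M * \<bar>t - t0\<bar> powr \<alpha>"
      using ka by (auto simp: eventually_at_filter)
    have "((\<lambda>t. M * \<bar>t - t0\<bar> powr \<alpha>) \<longlongrightarrow> M * \<bar>t0 - t0\<bar> powr \<alpha>) (at t0 within {0..1})"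
      using assms(2) by (intro tendsto_intros tendsto_powr') auto
    then show "((\<lambda>t. M * \<bar>t - t0\<bar> powr \<alpha>) \<longlongrightarrow> 0) (at t0 within {0..1})" by simp
  qed
  moreover have "(?T \<longlongrightarrow> ?T t0) (at t0 within {0..1})" by (intro tendsto_intros)
  ultimately have "((\<lambda>t. (f t - ?T t) + ?T t) \<longlongrightarrow> 0 + ?T t0) (at t0 within {0..1})" by (rule tendsto_add)
  then show "(f \<longlongrightarrow> f t0) (at t0 within {0..1})" unfolding T0 by simp
qed

section \<open>Counting and geometric sums over dyadic levels\<close>

lemma card_near_le:
  assumes "finite A" "R \<ge> 0"
  shows "real (card {k\<in>A. \<bar>y - real k\<bar> \<le> R}) \<le> 2 * R + 1"
proof -
  let ?S = "{k\<in>A. \<bar>y - real k\<bar> \<le> R}"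
  have fin: "finite ?S" using assms by auto
  show ?thesis
  proof (cases "?S = {}")
    case False
    have "?S \<subseteq> {Min ?S..Max ?S}" using fin by auto
    then have "card ?S \<le> card {Min ?S..Max ?S}" by (intro card_mono) auto
    also have "\<dots> = Suc (Max ?S) - Min ?S" by simp
    finally have 1: "card ?S \<le> Suc (Max ?S) - Min ?S" .
    have "Min ?S \<in> ?S" "Max ?S \<in> ?S" using fin False by (intro Min_in Max_in; simp)+
    then have "\<bar>y - real (Min ?S)\<bar> \<le> R" "\<bar>y - real (Max ?S)\<bar> \<le> R" by auto
    then have "real (Max ?S) - real (Min ?S) \<le> 2 * R" by linarith
    moreover have "Min ?S \<le> Max ?S" using fin False by (intro Min_le Max_in)
    ultimately show ?thesis using 1 by linarith
  next
    case True
    show ?thesis unfolding True using assms by simp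
  qed
qed

text \<open>
  The sums over levels are cut at a real number $X$ instead of a level, which spares rounding; a geometric sum is
  comparable to its largest term.
\<close>

lemma geometric_sum_low:
  assumes "finite S" "a > 0" "X > 0"
  shows "(\<Sum>j\<in>{j\<in>S. 2 ^ j \<le> X}. 2 powr (a * real j)) \<le> X powr a / (1 - 2 powr (- a))"
proof (cases "{j\<in>S. 2 ^ j \<le> X} = {}")
  case True
  have "2 powr (- a) < 2 powr 0" using assms by (subst powr_less_cancel_iff) auto
  then show ?thesis unfolding True using assms by simp
next
  case False
  define q where "q = 2 powr (- a)"
  have q: "0 < q" "q < 1" using assms powr_less_cancel_iff[of 2 "-a" 0] by (auto simp: q_def)
  let ?S = "{j\<in>S. 2 ^ j \<le> X}"
  have fin: "finite ?S" using assms by auto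
  define m where "m = Max ?S"
  have "m \<in> ?S" unfolding m_def using fin False by (rule Max_in)
  then have m: "2 powr real m \<le> X" by (simp add: powr_realpow)
  have "(\<Sum>j\<in>?S. 2 powr (a * real j)) \<le> (\<Sum>j\<le>m. 2 powr (a * real j))"
    using fin by (intro sum_mono2) (auto simp: m_def)
  also have "\<dots> = (\<Sum>i\<le>m. 2 powr (a * real m) * q ^ i)"
    by (rule sum.reindex_bij_witness[of _ "\<lambda>i. m - i" "\<lambda>i. m - i"])
      (auto simp: q_def powr_realpow[symmetric] powr_powr powr_add[symmetric] of_nat_diff algebra_simps)
  also have "\<dots> = 2 powr (a * real m) * (\<Sum>i\<le>m. q ^ i)" by (simp add: sum_distrib_left)
  also have "(\<Sum>i\<le>m. q ^ i) \<le> 1 / (1 - q)"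
    using sum_le_suminf[OF summable_geometric[of q], of "{..m}"] q suminf_geometric[of q] by simp
  also have "2 powr (a * real m) = (2 powr real m) powr a" by (simp add: powr_powr mult.commute)
  also have "\<dots> \<le> X powr a" using m assms by (intro powr_mono2) auto
  finally show ?thesis using q by (simp add: q_def mult_right_mono divide_right_mono mult_left_mono)
qed

lemma geometric_sum_tail:
  assumes "finite S" "a > 0" "\<And>j. j \<in> S \<Longrightarrow> m \<le> j"
  shows "(\<Sum>j\<in>S. 2 powr (- a * real j)) \<le> 2 powr (- a * real m) / (1 - 2 powr (- a))"
proof -
  define q where "q = 2 powr (- a)"
  have q: "0 < q" "q < 1" using assms powr_less_cancel_iff[of 2 "-a" 0] by (auto simp: q_def)
  have "(\<Sum>j\<in>S. 2 powr (- a * real j)) = (\<Sum>j\<in>S. q ^ j)"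
    by (simp add: q_def powr_realpow[symmetric] powr_powr)
  also have "\<dots> = (\<Sum>i\<in>(\<lambda>j. j - m) ` S. q ^ m * q ^ i)"
    using assms(3) by (subst sum.reindex) (auto simp: inj_on_def power_add[symmetric] eq_diff_iff intro!: sum.cong)
  also have "\<dots> = q ^ m * (\<Sum>i\<in>(\<lambda>j. j - m) ` S. q ^ i)" by (simp add: sum_distrib_left)
  also have "\<dots> \<le> q ^ m * (1 / (1 - q))"
    using sum_le_suminf[OF summable_geometric[of q], of "(\<lambda>j. j - m) ` S"] q suminf_geometric[of q] assms(1)
    by (intro mult_left_mono) auto
  also have "q ^ m = 2 powr (- a * real m)" by (simp add: q_def powr_realpow[symmetric] powr_powr)
  finally show ?thesis by (simp add: q_def)
qed

lemma geometric_sum_high: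
  assumes "finite S" "a > 0" "X > 0"
  shows "(\<Sum>j\<in>{j\<in>S. 2 ^ j > X}. 2 powr (- a * real j)) \<le> X powr (- a) / (1 - 2 powr (- a))"
proof (cases "{j\<in>S. 2 ^ j > X} = {}")
  case True
  have "2 powr (- a) < 2 powr 0" using assms by (subst powr_less_cancel_iff) auto
  then show ?thesis unfolding True using assms by simp
next
  case False
  let ?S = "{j\<in>S. 2 ^ j > X}"
  have q: "2 powr (- a) < 1" using assms powr_less_cancel_iff[of 2 "-a" 0] by auto
  have fin: "finite ?S" using assms by auto
  define m where "m = Min ?S"
  have "m \<in> ?S" unfolding m_def using fin False by (rule Min_in)
  then have m: "X < 2 powr real m" by (simp add: powr_realpow)
  have "(\<Sum>j\<in>?S. 2 powr (- a * real j)) \<le> 2 powr (- a * real m) / (1 - 2 powr (- a))"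
    using fin assms(2) by (intro geometric_sum_tail) (auto simp: m_def)
  also have "2 powr (- a * real m) = (2 powr real m) powr (- a)" by (simp add: powr_powr mult.commute)
  also have "(2 powr real m) powr (- a) / (1 - 2 powr (- a)) \<le> X powr (- a) / (1 - 2 powr (- a))"
    using m assms q by (intro divide_right_mono powr_mono2') auto
  finally show ?thesis .
qed

section \<open>Localised wavelet bases of the unit interval\<close>

lemma orthonormal_residual_square:
  fixes e :: "'i \<Rightarrow> real \<Rightarrow> real"
  assumes fin: "finite J" and f: "continuous_on {0..1} f" and e: "\<And>i. i \<in> J \<Longrightarrow> continuous_on {0..1} (e i)"
    and orth: "\<And>i j. i \<in> J \<Longrightarrow> j \<in> J \<Longrightarrow> (LINT x|unit_lebesgue. e i x * e j x) = (if i = j then 1 else 0)"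
  shows "(LINT x|unit_lebesgue. (f x - (\<Sum>i\<in>J. c i * e i x))\<^sup>2)
    = (LINT x|unit_lebesgue. (f x)\<^sup>2) - 2 * (\<Sum>i\<in>J. c i * (LINT x|unit_lebesgue. f x * e i x)) + (\<Sum>i\<in>J. (c i)\<^sup>2)"
proof -
  have i1: "integrable unit_lebesgue (\<lambda>x. (f x)\<^sup>2)" by (intro continuous_on_unit_integrable continuous_on_power f)
  have i2: "integrable unit_lebesgue (\<lambda>x. f x * e i x)" if "i \<in> J" for i
    by (intro continuous_on_unit_integrable continuous_on_mult f e that)
  have i3: "integrable unit_lebesgue (\<lambda>x. e i x * e j x)" if "i \<in> J" "j \<in> J" for i j
    by (intro continuous_on_unit_integrable continuous_on_mult e that)
  have "(f x - (\<Sum>i\<in>J. c i * e i x))\<^sup>2 = (f x)\<^sup>2 - 2 * (\<Sum>i\<in>J. c i * (f x * e i x))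
      + (\<Sum>i\<in>J. \<Sum>j\<in>J. c i * c j * (e i x * e j x))" for x
  proof -
    have "(\<Sum>i\<in>J. c i * e i x)\<^sup>2 = (\<Sum>i\<in>J. \<Sum>j\<in>J. c i * c j * (e i x * e j x))"
      unfolding power2_eq_square sum_product by (intro sum.cong refl) (simp add: ac_simps)
    moreover have "f x * (\<Sum>i\<in>J. c i * e i x) = (\<Sum>i\<in>J. c i * (f x * e i x))"
      by (simp add: sum_distrib_left ac_simps)
    ultimately show ?thesis by (simp add: power2_diff)
  qed
  then have "(LINT x|unit_lebesgue. (f x - (\<Sum>i\<in>J. c i * e i x))\<^sup>2)
    = (LINT x|unit_lebesgue. (f x)\<^sup>2 - 2 * (\<Sum>i\<in>J. c i * (f x * e i x))
      + (\<Sum>i\<in>J. \<Sum>j\<in>J. c i * c j * (e i x * e j x)))" by simp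
  also have "\<dots> = (LINT x|unit_lebesgue. (f x)\<^sup>2) - 2 * (\<Sum>i\<in>J. c i * (LINT x|unit_lebesgue. f x * e i x))
      + (\<Sum>i\<in>J. \<Sum>j\<in>J. c i * c j * (LINT x|unit_lebesgue. e i x * e j x))"
  proof -
    have s1: "integrable unit_lebesgue (\<lambda>x. 2 * (\<Sum>i\<in>J. c i * (f x * e i x)))"
      by (intro integrable_mult_right Bochner_Integration.integrable_sum i2)
    have s2: "integrable unit_lebesgue (\<lambda>x. \<Sum>i\<in>J. \<Sum>j\<in>J. c i * c j * (e i x * e j x))"
      by (intro integrable_mult_right Bochner_Integration.integrable_sum i3)
    have v1: "(LINT x|unit_lebesgue. 2 * (\<Sum>i\<in>J. c i * (f x * e i x))) = 2 * (\<Sum>i\<in>J. c i * (LINT x|unit_lebesgue. f x * e i x))"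
      by (subst integral_mult_right_zero, subst Bochner_Integration.integral_sum, intro integrable_mult_right i2, assumption)
        (simp only: integral_mult_right_zero)
    have v2: "(LINT x|unit_lebesgue. (\<Sum>i\<in>J. \<Sum>j\<in>J. c i * c j * (e i x * e j x)))
      = (\<Sum>i\<in>J. \<Sum>j\<in>J. c i * c j * (LINT x|unit_lebesgue. e i x * e j x))"
    proof (subst Bochner_Integration.integral_sum)
      show "integrable unit_lebesgue (\<lambda>x. \<Sum>j\<in>J. c i * c j * (e i x * e j x))" if "i \<in> J" for i
        by (intro Bochner_Integration.integrable_sum integrable_mult_right i3 that)
      show "(\<Sum>i\<in>J. LINT x|unit_lebesgue. (\<Sum>j\<in>J. c i * c j * (e i x * e j x)))
        = (\<Sum>i\<in>J. \<Sum>j\<in>J. c i * c j * (LINT x|unit_lebesgue. e i x * e j x))"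
      proof (intro sum.cong refl)
        fix i assume i: "i \<in> J"
        show "(LINT x|unit_lebesgue. (\<Sum>j\<in>J. c i * c j * (e i x * e j x))) = (\<Sum>j\<in>J. c i * c j * (LINT x|unit_lebesgue. e i x * e j x))"
          by (subst Bochner_Integration.integral_sum, intro integrable_mult_right i3 i, assumption)
            (simp only: integral_mult_right_zero)
      qed
    qed
    show ?thesis
      by (simp only: Bochner_Integration.integral_add[OF Bochner_Integration.integrable_diff[OF i1 s1] s2]
        Bochner_Integration.integral_diff[OF i1 s1] v1 v2)
  qed
  also have "(\<Sum>i\<in>J. \<Sum>j\<in>J. c i * c j * (LINT x|unit_lebesgue. e i x * e j x)) = (\<Sum>i\<in>J. (c i)\<^sup>2)"
  proof (intro sum.cong refl)
    fix i assume i: "i \<in> J"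
    have "(\<Sum>j\<in>J. c i * c j * (LINT x|unit_lebesgue. e i x * e j x)) = (\<Sum>j\<in>J. if i = j then c i * c j else 0)"
      using orth[OF i] by (intro sum.cong refl) auto
    also have "\<dots> = (c i)\<^sup>2" using fin i by (simp add: power2_eq_square)
    finally show "(\<Sum>j\<in>J. c i * c j * (LINT x|unit_lebesgue. e i x * e j x)) = (c i)\<^sup>2" .
  qed
  finally show ?thesis .
qed

lemma continuous_integral_zero_imp_zero:
  assumes h: "continuous_on {0..1} h" "\<And>x. x \<in> {0..1} \<Longrightarrow> h x \<ge> 0"
    and 0: "(LINT x|unit_lebesgue. h x) = 0" and x: "x \<in> {0..1}"
  shows "h x = (0::real)"
proof -
  have "integral {0..1} h = 0"
  proof -
    have "set_integrable lborel {0..1} h" by (rule borel_integrable_atLeastAtMost'[OF h(1)])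
    from set_borel_integral_eq_integral(2)[OF this] show ?thesis
      using 0 unfolding set_lebesgue_integral_unit by simp
  qed
  then show ?thesis using integral_eq_0_iff[of 0 1 h] h x by simp
qed

text \<open>
  What the estimates use of a boundary corrected basis: $R$ bounds the distance of $2^j t$ from the index $k$ on the support of the
  wavelets, and $C$ is a common bound for the scaling functions and, up to the factor $2^{j/2}$, for the wavelets.
\<close>

locale wavelet_system =
  fixes \<phi>0 :: "nat \<Rightarrow> real \<Rightarrow> real" and \<psi> :: "nat \<Rightarrow> nat \<Rightarrow> real \<Rightarrow> real"
    and r j0 :: nat and R C :: real
  assumes R: "R \<ge> 0" and C: "C \<ge> 1"
    and scaling_continuous: "k \<in> {1..2^j0} \<Longrightarrow> continuous_on {0..1} (\<phi>0 k)"
    and wavelet_continuous: "j \<ge> j0 \<Longrightarrow> k \<in> {1..2^j} \<Longrightarrow> continuous_on {0..1} (\<psi> j k)"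
    and scaling_bound: "k \<in> {1..2^j0} \<Longrightarrow> t \<in> {0..1} \<Longrightarrow> \<bar>\<phi>0 k t\<bar> \<le> C"
    and wavelet_bound: "j \<ge> j0 \<Longrightarrow> k \<in> {1..2^j} \<Longrightarrow> t \<in> {0..1} \<Longrightarrow> \<bar>\<psi> j k t\<bar> \<le> C * 2 powr (real j / 2)"
    and wavelet_support: "j \<ge> j0 \<Longrightarrow> k \<in> {1..2^j} \<Longrightarrow> t \<in> {0..1} \<Longrightarrow> \<psi> j k t \<noteq> 0 \<Longrightarrow> \<bar>2^j * t - real k\<bar> \<le> R"
    and vanishing_moment: "j \<ge> j0 \<Longrightarrow> k \<in> {1..2^j} \<Longrightarrow> i < r \<Longrightarrow> (LINT t|unit_lebesgue. t ^ i * \<psi> j k t) = 0"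
    and basis: "L2_orthonormal_basis unit_lebesgue (Inl ` {1..2^j0} \<union> Inr ` (SIGMA j:{j0..}. {1..2^j}))
       (case_sum \<phi>0 (\<lambda>(j, k). \<psi> j k))"
begin

definition scaling_coeff :: "(real \<Rightarrow> real) \<Rightarrow> nat \<Rightarrow> real" where
  "scaling_coeff f k = (LINT t|unit_lebesgue. f t * \<phi>0 k t)"

definition wavelet_coeff :: "(real \<Rightarrow> real) \<Rightarrow> nat \<Rightarrow> nat \<Rightarrow> real" where
  "wavelet_coeff f j k = (LINT t|unit_lebesgue. f t * \<psi> j k t)"

definition partial_expansion :: "nat \<Rightarrow> (real \<Rightarrow> real) \<Rightarrow> real \<Rightarrow> real" where
  "partial_expansion m f x = (\<Sum>k=1..2^j0. scaling_coeff f k * \<phi>0 k x) +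
     (\<Sum>j\<in>{j0..<m}. \<Sum>k=1..2^j. wavelet_coeff f j k * \<psi> j k x)"

lemma wavelet_orthonormal:
  assumes "j \<ge> j0" "k \<in> {1..2^j}" "j' \<ge> j0" "k' \<in> {1..2^j'}"
  shows "(LINT t|unit_lebesgue. \<psi> j k t * \<psi> j' k' t) = (if j = j' \<and> k = k' then 1 else 0)"
proof -
  have "Inr (j, k) \<in> Inl ` {1..2^j0} \<union> Inr ` (SIGMA j:{j0..}. {1..2^j})"
    "Inr (j', k') \<in> Inl ` {1..2^j0} \<union> Inr ` (SIGMA j:{j0..}. {1..2^j})" using assms by auto
  then have "(LINT x|unit_lebesgue. case_sum \<phi>0 (\<lambda>(j, k). \<psi> j k) (Inr (j, k)) x * case_sum \<phi>0 (\<lambda>(j, k). \<psi> j k) (Inr (j', k')) x)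
     = (if (Inr (j, k) :: nat + nat \<times> nat) = Inr (j', k') then 1 else 0)"
    using basis unfolding L2_orthonormal_basis_def by blast
  then show ?thesis by simp
qed

lemma scaling_normalized:
  assumes "k \<in> {1..2^j0}"
  shows "(LINT t|unit_lebesgue. \<phi>0 k t * \<phi>0 k t) = 1"
proof -
  have "Inl k \<in> Inl ` {1..2^j0} \<union> Inr ` (SIGMA j:{j0..}. {1..2^j})" using assms by auto
  then have "(LINT x|unit_lebesgue. case_sum \<phi>0 (\<lambda>(j, k). \<psi> j k) (Inl k) x * case_sum \<phi>0 (\<lambda>(j, k). \<psi> j k) (Inl k) x)
     = (if (Inl k :: nat + nat \<times> nat) = Inl k then 1 else 0)"
    using basis unfolding L2_orthonormal_basis_def by blast
  then show ?thesis by simp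
qed

lemma wavelet_annihilates_polynomial:
  assumes "j \<ge> j0" "k \<in> {1..2^j}" "d < r"
  shows "(LINT t|unit_lebesgue. (\<Sum>i\<le>d. a i * (t - t0) ^ i) * \<psi> j k t) = 0"
proof -
  have int: "integrable unit_lebesgue (\<lambda>t. t ^ l * \<psi> j k t)" for l
    by (intro continuous_on_unit_integrable continuous_on_mult continuous_on_power continuous_on_id wavelet_continuous assms)
  have "(\<Sum>i\<le>d. a i * (t - t0) ^ i) * \<psi> j k t
    = (\<Sum>i\<le>d. \<Sum>l\<le>i. (a i * real (i choose l) * (- t0) ^ (i - l)) * (t ^ l * \<psi> j k t))" for t
  proof -
    have "(t - t0) ^ i = (\<Sum>l\<le>i. real (i choose l) * t ^ l * (- t0) ^ (i - l))" for i
      using binomial_ring[of t "- t0" i] by simp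
    then show ?thesis by (simp add: sum_distrib_left sum_distrib_right ac_simps)
  qed
  then have "(LINT t|unit_lebesgue. (\<Sum>i\<le>d. a i * (t - t0) ^ i) * \<psi> j k t)
     = (LINT t|unit_lebesgue. (\<Sum>i\<le>d. \<Sum>l\<le>i. (a i * real (i choose l) * (- t0) ^ (i - l)) * (t ^ l * \<psi> j k t)))" by simp
  also have "\<dots> = (\<Sum>i\<le>d. \<Sum>l\<le>i. (a i * real (i choose l) * (- t0) ^ (i - l)) * (LINT t|unit_lebesgue. t ^ l * \<psi> j k t))"
    using int by simp
  also have "\<dots> = 0" using vanishing_moment[OF assms(1,2)] assms(3) by (intro sum.neutral ballI) simp
  finally show ?thesis .
qed

text \<open>
  The Taylor polynomial at $t_0 = k/2^j$ is annihilated by the wavelet, which lives within $R/2^j$ of $t_0$ and is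
  bounded by $C 2^{j/2}$.
\<close>

lemma wavelet_coeff_bound:
  assumes f: "f \<in> holder_class \<alpha> M" and "\<alpha> > 0" "M > 0" "real r > \<alpha>" and j: "j \<ge> j0" "k \<in> {1..2^j}"
  shows "\<bar>wavelet_coeff f j k\<bar> \<le> (2 * R * M * R powr \<alpha> * C) * 2 powr (- (\<alpha> + 1/2) * real j)"
proof -
  interpret U: prob_space unit_lebesgue by (rule prob_space_unit_lebesgue)
  define t0 where "t0 = real k / 2 ^ j"
  have t0: "t0 \<in> {0..1}" using j by (simp add: t0_def field_simps)
  obtain d a where d: "d < r" and ap: "\<And>t. t \<in> {0..1} \<Longrightarrow> \<bar>f t - (\<Sum>i\<le>d. a i * (t - t0) ^ i)\<bar> \<le> M * \<bar>t - t0\<bar> powr \<alpha>"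
    using holder_class_taylor[OF f assms(2-4) t0] by metis
  let ?T = "\<lambda>t. \<Sum>i\<le>d. a i * (t - t0) ^ i"
  define \<rho> where "\<rho> = R / 2 ^ j"
  have \<rho>: "\<rho> \<ge> 0" using R by (simp add: \<rho>_def)
  define b where "b = M * \<rho> powr \<alpha> * (C * 2 powr (real j / 2))"
  have b: "b \<ge> 0" using assms C by (simp add: b_def)
  have cf: "continuous_on {0..1} f" by (rule holder_class_continuous[OF f assms(2,3)])
  note c\<psi> = wavelet_continuous[OF j]
  have cT: "continuous_on {0..1} ?T" by (intro continuous_intros)
  have "wavelet_coeff f j k = (LINT t|unit_lebesgue. f t * \<psi> j k t) - (LINT t|unit_lebesgue. ?T t * \<psi> j k t)"
    using wavelet_annihilates_polynomial[OF j d] by (simp add: wavelet_coeff_def)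
  also have "\<dots> = (LINT t|unit_lebesgue. f t * \<psi> j k t - ?T t * \<psi> j k t)"
    by (rule Bochner_Integration.integral_diff[symmetric]) (intro continuous_on_unit_integrable continuous_on_mult cf c\<psi> cT)+
  finally have "\<bar>wavelet_coeff f j k\<bar> \<le> (LINT t|unit_lebesgue. \<bar>f t * \<psi> j k t - ?T t * \<psi> j k t\<bar>)"
    by (simp add: integral_abs_bound)
  also have "\<dots> \<le> (LINT t|unit_lebesgue. b * indicator {t0 - \<rho>..t0 + \<rho>} t)"
  proof (rule integral_mono)
    show "integrable unit_lebesgue (\<lambda>t. \<bar>f t * \<psi> j k t - ?T t * \<psi> j k t\<bar>)"
      by (intro continuous_on_unit_integrable continuous_on_rabs continuous_on_diff continuous_on_mult cf c\<psi> cT)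
    show "integrable unit_lebesgue (\<lambda>t. b * indicator {t0 - \<rho>..t0 + \<rho>} t)"
      by (rule bounded_integrable_unit[of _ b]) (use b in \<open>auto intro!: borel_measurable_unit split: split_indicator\<close>)
    fix t assume "t \<in> space unit_lebesgue"
    then have t: "t \<in> {0..1}" by (simp add: space_restrict_space)
    show "\<bar>f t * \<psi> j k t - ?T t * \<psi> j k t\<bar> \<le> b * indicator {t0 - \<rho>..t0 + \<rho>} t"
    proof (cases "\<psi> j k t = 0")
      case False
      from wavelet_support[OF j t False] have "\<bar>2^j * (t - t0)\<bar> \<le> R" by (simp add: t0_def algebra_simps)
      then have "2^j * \<bar>t - t0\<bar> \<le> R" by (simp only: abs_mult) simp
      then have near: "\<bar>t - t0\<bar> \<le> \<rho>" by (simp add: \<rho>_def pos_le_divide_eq mult.commute)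
      have "\<bar>f t * \<psi> j k t - ?T t * \<psi> j k t\<bar> = \<bar>f t - ?T t\<bar> * \<bar>\<psi> j k t\<bar>"
        by (simp add: abs_mult[symmetric] left_diff_distrib)
      also have "\<dots> \<le> (M * \<rho> powr \<alpha>) * (C * 2 powr (real j / 2))"
      proof (rule mult_mono)
        have "\<bar>t - t0\<bar> powr \<alpha> \<le> \<rho> powr \<alpha>" using near assms by (intro powr_mono2) auto
        then have "M * \<bar>t - t0\<bar> powr \<alpha> \<le> M * \<rho> powr \<alpha>" using assms by simp
        with ap[OF t] show "\<bar>f t - ?T t\<bar> \<le> M * \<rho> powr \<alpha>" by linarith
      qed (use wavelet_bound[OF j t] assms in auto)
      also have "\<dots> = b * indicator {t0 - \<rho>..t0 + \<rho>} t" using near by (auto simp: b_def indicator_def)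
      finally show ?thesis .
    qed (use b in simp)
  qed
  also have "\<dots> = b * measure unit_lebesgue ({t0 - \<rho>..t0 + \<rho>} \<inter> {0..1})"
  proof -
    have "(LINT t|unit_lebesgue. indicator {t0 - \<rho>..t0 + \<rho>} t) = (LINT t|unit_lebesgue. (indicator ({t0 - \<rho>..t0 + \<rho>} \<inter> {0..1}) t :: real))"
      by (intro Bochner_Integration.integral_cong) (auto simp: space_restrict_space split: split_indicator)
    also have "\<dots> = measure unit_lebesgue ({t0 - \<rho>..t0 + \<rho>} \<inter> {0..1})"
      by (subst Bochner_Integration.integral_indicator) (auto simp: space_restrict_space Int_absorb2)
    finally show ?thesis by simp
  qed
  also have "measure unit_lebesgue ({t0 - \<rho>..t0 + \<rho>} \<inter> {0..1}) = measure lborel ({t0 - \<rho>..t0 + \<rho>} \<inter> {0..1})"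
    by (rule measure_restrict_space) auto
  also have "\<dots> \<le> measure lborel {t0 - \<rho>..t0 + \<rho>}"
  proof (rule measure_mono_fmeasurable)
    show "{t0 - \<rho>..t0 + \<rho>} \<in> fmeasurable lborel" by (rule fmeasurableI) (use \<rho> in auto)
  qed auto
  also have "\<dots> = 2 * \<rho>" using \<rho> by simp
  finally have "\<bar>wavelet_coeff f j k\<bar> \<le> b * (2 * \<rho>)" using b by (simp add: mult_left_mono)
  also have "b * (2 * \<rho>) = (2 * R * M * R powr \<alpha> * C) * 2 powr (- (\<alpha> + 1/2) * real j)"
  proof -
    have p: "(2::real) ^ j = 2 powr real j" by (simp add: powr_realpow)
    have \<rho>2: "\<rho> = R * 2 powr (- real j)" unfolding \<rho>_def p by (simp add: powr_minus divide_inverse)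
    moreover have "\<rho> powr \<alpha> = R powr \<alpha> * 2 powr (- \<alpha> * real j)"
      using R unfolding \<rho>2 by (subst powr_mult) (simp_all add: powr_powr mult.commute)
    moreover have "2 powr (- \<alpha> * real j) * 2 powr (real j / 2) * 2 powr (- real j) = 2 powr (- (\<alpha> + 1/2) * real j)"
    proof -
      have "- \<alpha> * real j + real j / 2 + - real j = - (\<alpha> + 1/2) * real j" by (simp add: field_simps)
      then show ?thesis by (simp only: powr_add[symmetric])
    qed
    ultimately show ?thesis unfolding b_def by (simp add: ac_simps)
  qed
  finally show ?thesis .
qed

text \<open>
  At a point at most $2R+1$ wavelets of a level are nonzero.
\<close>

lemma wavelet_sum_bound:
  assumes j: "j \<ge> j0" and x: "x \<in> {0..1}" and c: "\<And>k. k \<in> {1..2^j} \<Longrightarrow> \<bar>c k\<bar> \<le> D"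
  shows "\<bar>\<Sum>k=1..2^j. c k * \<psi> j k x\<bar> \<le> (2 * R + 1) * C * 2 powr (real j / 2) * D"
proof -
  let ?S = "{k\<in>{1..2^j}. \<bar>2^j * x - real k\<bar> \<le> R}"
  have D: "D \<ge> 0" using c[of 1] by auto
  have "(\<Sum>k=1..2^j. c k * \<psi> j k x) = (\<Sum>k\<in>?S. c k * \<psi> j k x)"
    using wavelet_support[OF j _ x] by (intro sum.mono_neutral_right) auto
  also have "\<bar>\<dots>\<bar> \<le> (\<Sum>k\<in>?S. D * (C * 2 powr (real j / 2)))"
  proof (rule order_trans[OF sum_abs sum_mono])
    fix k assume "k \<in> ?S"
    then have k: "k \<in> {1..2^j}" by simp
    show "\<bar>c k * \<psi> j k x\<bar> \<le> D * (C * 2 powr (real j / 2))"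
      unfolding abs_mult by (intro mult_mono c k wavelet_bound[OF j k x] D) auto
  qed
  also have "\<dots> = real (card ?S) * (D * (C * 2 powr (real j / 2)))" by simp
  also have "\<dots> \<le> (2 * R + 1) * (D * (C * 2 powr (real j / 2)))"
    using card_near_le[of "{1..2^j}" R] R C D by (intro mult_right_mono) auto
  finally show ?thesis by (simp add: ac_simps)
qed

lemma partial_expansion_continuous: "continuous_on {0..1} (partial_expansion m f)"
  unfolding partial_expansion_def[abs_def]
  by (intro continuous_on_add continuous_on_sum continuous_on_mult continuous_on_const scaling_continuous wavelet_continuous) auto

text \<open>
  A finite linear combination of basis functions involves only levels below some $m'$, and among the combinations of these
  the partial expansion is the best approximation.
\<close>

lemma partial_expansion_best_approx:
  assumes f: "continuous_on {0..1} f" and \<epsilon>: "\<epsilon> > 0"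
  shows "\<exists>m'\<ge>m. (LINT x|unit_lebesgue. (f x - partial_expansion m' f x)\<^sup>2) < \<epsilon>"
proof -
  let ?e = "case_sum \<phi>0 (\<lambda>(j, k). \<psi> j k)"
  let ?I = "Inl ` {1..2^j0} \<union> Inr ` (SIGMA j:{j0..}. {1..2^j}) :: (nat + nat \<times> nat) set"
  have "square_integrable unit_lebesgue f"
    unfolding square_integrable_def
    by (intro conjI continuous_on_unit_measurable continuous_on_unit_integrable continuous_on_power f)
  then have "\<exists>A c. finite A \<and> A \<subseteq> ?I \<and> (LINT x|unit_lebesgue. (f x - (\<Sum>i\<in>A. c i * ?e i x))\<^sup>2) < \<epsilon>"
    using basis \<epsilon> unfolding L2_orthonormal_basis_def by blast
  then obtain A c where A: "finite A" "A \<subseteq> ?I" "(LINT x|unit_lebesgue. (f x - (\<Sum>i\<in>A. c i * ?e i x))\<^sup>2) < \<epsilon>"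
    by blast
  \<comment> \<open>a level beyond all the basis functions in $A$\<close>
  define m' where "m' = Max (insert m ((\<lambda>i. case i of Inl _ \<Rightarrow> 0 | Inr (j, k) \<Rightarrow> Suc j) ` A))"
  have m': "m' \<ge> m" unfolding m'_def using A(1) by (intro Max_ge) auto
  have m'2: "Suc j \<le> m'" if "Inr (j, k) \<in> A" for j k
    unfolding m'_def using A(1) that by (intro Max_ge) (force simp: image_iff)+
  let ?J = "Inl ` {1..2^j0} \<union> Inr ` (SIGMA j:{j0..<m'}. {1..2^j}) :: (nat + nat \<times> nat) set"
  have AJ: "A \<subseteq> ?J"
  proof
    fix i assume i: "i \<in> A"
    then show "i \<in> ?J" using A(2) m'2 by (cases i) (auto dest!: subsetD simp: Suc_le_eq)
  qed
  have finJ: "finite ?J" by auto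
  have eJ: "continuous_on {0..1} (?e i)" if "i \<in> ?J" for i
    using that scaling_continuous wavelet_continuous by auto
  have orth: "(LINT x|unit_lebesgue. ?e i x * ?e j x) = (if i = j then 1 else 0)" if "i \<in> ?J" "j \<in> ?J" for i j
  proof -
    have "i \<in> ?I" "j \<in> ?I" using that by auto
    then show ?thesis using basis unfolding L2_orthonormal_basis_def by blast
  qed
  define b where "b i = (LINT x|unit_lebesgue. f x * ?e i x)" for i
  define c' where "c' i = (if i \<in> A then c i else 0)" for i
  have expand: "partial_expansion m' f x = (\<Sum>i\<in>?J. b i * ?e i x)" for x
  proof -
    have "(\<Sum>i\<in>?J. b i * ?e i x) = (\<Sum>i\<in>Inl ` {1..2^j0}. b i * ?e i x) + (\<Sum>i\<in>Inr ` (SIGMA j:{j0..<m'}. {1..2^j}). b i * ?e i x)"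
      by (rule sum.union_disjoint) auto
    also have "(\<Sum>i\<in>Inl ` {1..2^j0}. b i * ?e i x) = (\<Sum>k=1..2^j0. scaling_coeff f k * \<phi>0 k x)"
      by (subst sum.reindex) (auto simp: b_def scaling_coeff_def)
    also have "(\<Sum>i\<in>Inr ` (SIGMA j:{j0..<m'}. {1..2^j}). b i * ?e i x)
      = (\<Sum>(j, k)\<in>(SIGMA j:{j0..<m'}. {1..2^j}). wavelet_coeff f j k * \<psi> j k x)"
      by (subst sum.reindex) (auto simp: b_def wavelet_coeff_def intro!: sum.cong)
    also have "\<dots> = (\<Sum>j\<in>{j0..<m'}. \<Sum>k=1..2^j. wavelet_coeff f j k * \<psi> j k x)"
      by (rule sum.Sigma[symmetric]) auto
    finally show ?thesis by (simp add: partial_expansion_def)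
  qed
  have cA: "(\<Sum>i\<in>A. c i * ?e i x) = (\<Sum>i\<in>?J. c' i * ?e i x)" for x
    using finJ AJ by (intro sum.mono_neutral_cong_left) (auto simp: c'_def)
  have res: "(LINT x|unit_lebesgue. (f x - (\<Sum>i\<in>?J. d i * ?e i x))\<^sup>2)
    = (LINT x|unit_lebesgue. (f x)\<^sup>2) - 2 * (\<Sum>i\<in>?J. d i * b i) + (\<Sum>i\<in>?J. (d i)\<^sup>2)" for d
    unfolding b_def by (rule orthonormal_residual_square[OF finJ f eJ orth])
  have "(LINT x|unit_lebesgue. (f x - partial_expansion m' f x)\<^sup>2) \<le> (LINT x|unit_lebesgue. (f x - (\<Sum>i\<in>A. c i * ?e i x))\<^sup>2)"
  proof -
    have "(\<Sum>i\<in>?J. (b i)\<^sup>2) - 2 * (\<Sum>i\<in>?J. b i * b i) \<le> (\<Sum>i\<in>?J. (c' i)\<^sup>2) - 2 * (\<Sum>i\<in>?J. c' i * b i)"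
    proof -
      have "0 \<le> (\<Sum>i\<in>?J. (c' i - b i)\<^sup>2)" by (intro sum_nonneg) auto
      also have "\<dots> = (\<Sum>i\<in>?J. (c' i)\<^sup>2) - 2 * (\<Sum>i\<in>?J. c' i * b i) + (\<Sum>i\<in>?J. b i * b i)"
      proof -
        have "(c' i - b i)\<^sup>2 = (c' i)\<^sup>2 - 2 * (c' i * b i) + b i * b i" for i
          by (simp add: power2_eq_square algebra_simps)
        then show ?thesis by (simp only: sum.distrib sum_subtractf sum_distrib_left)
      qed
      finally show ?thesis by (simp add: power2_eq_square)
    qed
    then show ?thesis using res[of b] res[of c'] unfolding expand cA by linarith
  qed
  with A(3) m' show ?thesis by (intro exI[of _ m'] conjI) linarith+
qed

text \<open>
  The partial expansions form a uniformly Cauchy sequence with the stated rate.  That their limit is $f$ at every point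
  follows from convergence in mean square: the excess of $|f - S_m|$ over the bound is at most $|f - S_{m'}|$ for all $m' \ge m$, so
  it vanishes almost everywhere, and it is continuous.
\<close>

lemma expansion_error_bound:
  assumes f: "f \<in> holder_class \<alpha> M" and \<alpha>: "\<alpha> > 0" "M > 0" "real r > \<alpha>" and m: "m \<ge> j0" and x: "x \<in> {0..1}"
  shows "\<bar>f x - partial_expansion m f x\<bar>
    \<le> ((2 * R + 1) * C * (2 * R * M * R powr \<alpha> * C) / (1 - 2 powr (- \<alpha>))) * 2 powr (- \<alpha> * real m)" (is "_ \<le> ?K")
proof -
  have cf: "continuous_on {0..1} f" by (rule holder_class_continuous[OF f \<alpha>(1,2)])
  have step: "\<bar>partial_expansion m' f y - partial_expansion m f y\<bar> \<le> ?K" if m': "m' \<ge> m" and y: "y \<in> {0..1}" for m' y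
  proof -
    have "{j0..<m'} = {j0..<m} \<union> {m..<m'}" using m m' by auto
    then have diff: "partial_expansion m' f y - partial_expansion m f y = (\<Sum>j\<in>{m..<m'}. \<Sum>k=1..2^j. wavelet_coeff f j k * \<psi> j k y)"
      unfolding partial_expansion_def by (simp add: sum.union_disjoint)
    have "\<bar>\<Sum>j\<in>{m..<m'}. \<Sum>k=1..2^j. wavelet_coeff f j k * \<psi> j k y\<bar>
      \<le> (\<Sum>j\<in>{m..<m'}. (2 * R + 1) * C * (2 * R * M * R powr \<alpha> * C) * 2 powr (- \<alpha> * real j))"
    proof (rule order_trans[OF sum_abs sum_mono])
      fix j assume "j \<in> {m..<m'}"
      then have j: "j \<ge> j0" using m by auto
      have "\<bar>\<Sum>k=1..2^j. wavelet_coeff f j k * \<psi> j k y\<bar>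
         \<le> (2 * R + 1) * C * 2 powr (real j / 2) * ((2 * R * M * R powr \<alpha> * C) * 2 powr (- (\<alpha> + 1/2) * real j))"
        by (rule wavelet_sum_bound[OF j y wavelet_coeff_bound[OF f \<alpha> j]])
      also have "\<dots> = (2 * R + 1) * C * (2 * R * M * R powr \<alpha> * C) * (2 powr (real j / 2) * 2 powr (- (\<alpha> + 1/2) * real j))"
        by (simp only: ac_simps)
      also have "2 powr (real j / 2) * 2 powr (- (\<alpha> + 1/2) * real j) = 2 powr (- \<alpha> * real j)"
        by (simp add: powr_add[symmetric] algebra_simps)
      finally show "\<bar>\<Sum>k=1..2^j. wavelet_coeff f j k * \<psi> j k y\<bar>
         \<le> (2 * R + 1) * C * (2 * R * M * R powr \<alpha> * C) * 2 powr (- \<alpha> * real j)" .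
    qed
    also have "\<dots> = (2 * R + 1) * C * (2 * R * M * R powr \<alpha> * C) * (\<Sum>j\<in>{m..<m'}. 2 powr (- \<alpha> * real j))"
      by (simp add: sum_distrib_left)
    also have "\<dots> \<le> (2 * R + 1) * C * (2 * R * M * R powr \<alpha> * C) * (2 powr (- \<alpha> * real m) / (1 - 2 powr (- \<alpha>)))"
      using R C \<alpha> by (intro mult_left_mono geometric_sum_tail) auto
    finally show ?thesis unfolding diff by simp
  qed
  define h where "h y = (max 0 (\<bar>f y - partial_expansion m f y\<bar> - ?K))\<^sup>2" for y
  have ch: "continuous_on {0..1} h"
    unfolding h_def by (intro continuous_intros cf partial_expansion_continuous)
  have "(LINT y|unit_lebesgue. h y) \<le> \<epsilon>" if \<epsilon>: "\<epsilon> > 0" for \<epsilon>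
  proof -
    obtain m' where m': "m' \<ge> m" "(LINT y|unit_lebesgue. (f y - partial_expansion m' f y)\<^sup>2) < \<epsilon>"
      using partial_expansion_best_approx[OF cf \<epsilon>] by blast
    have "(LINT y|unit_lebesgue. h y) \<le> (LINT y|unit_lebesgue. (f y - partial_expansion m' f y)\<^sup>2)"
    proof (rule integral_mono)
      show "integrable unit_lebesgue h" by (rule continuous_on_unit_integrable[OF ch])
      show "integrable unit_lebesgue (\<lambda>y. (f y - partial_expansion m' f y)\<^sup>2)"
        by (intro continuous_on_unit_integrable continuous_intros cf partial_expansion_continuous)
      fix y assume "y \<in> space unit_lebesgue"
      then have "y \<in> {0..1}" by (simp add: space_restrict_space)
      from step[OF m'(1) this] have "\<bar>max 0 (\<bar>f y - partial_expansion m f y\<bar> - ?K)\<bar> \<le> \<bar>f y - partial_expansion m' f y\<bar>" by linarith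
      then show "h y \<le> (f y - partial_expansion m' f y)\<^sup>2" unfolding h_def by (simp only: abs_le_square_iff)
    qed
    with m'(2) show ?thesis by simp
  qed
  then have "(LINT y|unit_lebesgue. h y) \<le> 0" by (rule field_le_epsilon[of _ 0, simplified])
  moreover have "0 \<le> (LINT y|unit_lebesgue. h y)" by (intro integral_nonneg_AE) (simp add: h_def)
  ultimately have "(LINT y|unit_lebesgue. h y) = 0" by simp
  from continuous_integral_zero_imp_zero[OF ch _ this x] have "h x = 0" by (simp add: h_def)
  then show ?thesis by (simp add: h_def)
qed

lemma nn_integral_wavelet_sum_square:
  assumes A: "finite A" "\<And>j k. (j, k) \<in> A \<Longrightarrow> j \<ge> j0 \<and> k \<in> {1..2^j}"
  shows "(\<integral>\<^sup>+x. ennreal ((\<Sum>(j, k)\<in>A. c j k * \<psi> j k x)\<^sup>2) \<partial>unit_lebesgue) = ennreal (\<Sum>(j, k)\<in>A. (c j k)\<^sup>2)"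
proof -
  let ?e = "\<lambda>i. \<psi> (fst i) (snd i)"
  have e: "continuous_on {0..1} (?e i)" if "i \<in> A" for i
    using A(2)[of "fst i" "snd i"] that by (intro wavelet_continuous) auto
  have orth: "(LINT x|unit_lebesgue. ?e i x * ?e i' x) = (if i = i' then 1 else 0)" if "i \<in> A" "i' \<in> A" for i i'
    using A(2)[of "fst i" "snd i"] A(2)[of "fst i'" "snd i'"] that
    by (subst wavelet_orthonormal) (auto simp: prod_eq_iff)
  have int: "integrable unit_lebesgue (\<lambda>x. (\<Sum>i\<in>A. c (fst i) (snd i) * ?e i x)\<^sup>2)"
    by (intro continuous_on_unit_integrable continuous_on_power continuous_on_sum continuous_on_mult continuous_on_const e)
  have "(\<integral>\<^sup>+x. ennreal ((\<Sum>i\<in>A. c (fst i) (snd i) * ?e i x)\<^sup>2) \<partial>unit_lebesgue)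
    = ennreal (LINT x|unit_lebesgue. (\<Sum>i\<in>A. c (fst i) (snd i) * ?e i x)\<^sup>2)"
    by (rule nn_integral_eq_integral[OF int]) simp
  also have "(LINT x|unit_lebesgue. (\<Sum>i\<in>A. c (fst i) (snd i) * ?e i x)\<^sup>2) = (\<Sum>i\<in>A. (c (fst i) (snd i))\<^sup>2)"
    using orthonormal_residual_square[OF A(1) continuous_on_const[of _ 0] e orth, of "\<lambda>i. c (fst i) (snd i)"]
    by simp
  finally show ?thesis by (simp add: case_prod_beta)
qed

end

section \<open>Regularity of boundary corrected wavelets\<close>

lemma finite_comb_continuous_bounded:
  assumes \<phi>: "continuous_on UNIV \<phi>" "\<And>x. \<bar>\<phi> x\<bar> \<le> b" and \<eta>: "finite_comb_on S \<phi> s \<eta>"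
  shows "continuous_on S \<eta> \<and> (\<exists>c. \<forall>x\<in>S. \<bar>\<eta> x\<bar> \<le> c)"
proof -
  obtain h :: "int \<Rightarrow> real" where h: "finite {k. h k \<noteq> 0}"
    "\<And>x. x \<in> S \<Longrightarrow> \<eta> x = (\<Sum>k | h k \<noteq> 0. h k * \<phi> (s * x - of_int k))"
    using \<eta> unfolding finite_comb_on_def by blast
  have "continuous_on S (\<lambda>x. \<Sum>k | h k \<noteq> 0. h k * \<phi> (s * x - of_int k))"
    by (intro continuous_intros continuous_on_compose2[OF \<phi>(1)]) auto
  then have "continuous_on S \<eta>" using h(2) by (simp cong: continuous_on_cong)
  moreover have "\<bar>\<eta> x\<bar> \<le> (\<Sum>k | h k \<noteq> 0. \<bar>h k\<bar> * b)" if "x \<in> S" for x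
    unfolding h(2)[OF that]
    by (rule order_trans[OF sum_abs]) (auto simp: abs_mult intro!: sum_mono mult_left_mono \<phi>(2))
  ultimately show ?thesis by blast
qed

text \<open>
  In each of the three zones, left edge, interior and right edge, the member $k$ of level $j$ is a dilate of one of finitely
  many bounded functions, supported where $|2^j t - k| \le 2N$.
\<close>

lemma boundary_corrected_regularity:
  assumes \<phi>: "continuous_on UNIV \<phi>" "\<And>x. \<bar>\<phi> x\<bar> \<le> b"
    and \<eta>: "finite_comb_on UNIV \<phi> s' \<eta>" "\<And>x. real N < \<bar>x\<bar> \<Longrightarrow> \<eta> x = 0"
    and N: "2 * N \<le> 2 ^ j0" and bc: "boundary_corrected N \<phi> s j0 \<eta> \<eta>I"
  shows "\<exists>C\<ge>1. \<forall>j\<ge>j0. \<forall>k\<in>{1..2^j}. continuous_on {0..1} (\<eta>I j k) \<and>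
    (\<forall>t\<in>{0..1}. \<bar>\<eta>I j k t\<bar> \<le> C * 2 powr (real j / 2) \<and> (\<eta>I j k t \<noteq> 0 \<longrightarrow> \<bar>2^j * t - real k\<bar> \<le> 2 * real N))"
proof -
  obtain \<eta>L \<eta>R where edge: "\<And>i. i \<in> {1..N} \<Longrightarrow> finite_comb_on {0..} \<phi> s (\<eta>L i)"
      "\<And>i x. i \<in> {1..N} \<Longrightarrow> x > 2 * real N \<Longrightarrow> \<eta>L i x = 0"
      "\<And>i. i \<in> {1..N} \<Longrightarrow> finite_comb_on {..0} \<phi> s (\<eta>R i)"
      "\<And>i x. i \<in> {1..N} \<Longrightarrow> x < - 2 * real N \<Longrightarrow> \<eta>R i x = 0"
    and I: "\<And>j k t. j \<ge> j0 \<Longrightarrow> k \<in> {1..2^j} \<Longrightarrow> t \<in> {0..1} \<Longrightarrow> \<eta>I j k t =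
             (if k \<le> N then dilate (\<eta>L k) j 0 t
              else if k \<le> 2 ^ j - N then dilate \<eta> j (int k) t
              else dilate (\<eta>R (2 ^ j + 1 - k)) j (2 ^ j) t)"
    using bc unfolding boundary_corrected_def by blast
  obtain c0 where c0: "\<And>x. \<bar>\<eta> x\<bar> \<le> c0" and cont: "continuous_on UNIV \<eta>"
    using finite_comb_continuous_bounded[OF \<phi> \<eta>(1)] by auto
  have "\<forall>i\<in>{1..N}. \<exists>c. \<forall>x\<in>{0..}. \<bar>\<eta>L i x\<bar> \<le> c" "\<forall>i\<in>{1..N}. \<exists>c. \<forall>x\<in>{..0}. \<bar>\<eta>R i x\<bar> \<le> c"
    using finite_comb_continuous_bounded[OF \<phi> edge(1)] finite_comb_continuous_bounded[OF \<phi> edge(3)] by blast+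
  then obtain cL cR where cL: "\<And>i x. i \<in> {1..N} \<Longrightarrow> x \<ge> 0 \<Longrightarrow> \<bar>\<eta>L i x\<bar> \<le> cL i"
    and cR: "\<And>i x. i \<in> {1..N} \<Longrightarrow> x \<le> 0 \<Longrightarrow> \<bar>\<eta>R i x\<bar> \<le> cR i"
    unfolding bchoice_iff by (metis atLeast_iff atMost_iff)
  have contL: "continuous_on {0..} (\<eta>L i)" and contR: "continuous_on {..0} (\<eta>R i)" if "i \<in> {1..N}" for i
    using finite_comb_continuous_bounded[OF \<phi> edge(1)[OF that]] finite_comb_continuous_bounded[OF \<phi> edge(3)[OF that]] by auto
  \<comment> \<open>one bound for the interior function and all the edge functions\<close>
  define C where "C = 1 + \<bar>c0\<bar> + (\<Sum>i\<in>{1..N}. \<bar>cL i\<bar>) + (\<Sum>i\<in>{1..N}. \<bar>cR i\<bar>)"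
  have s0: "0 \<le> (\<Sum>i\<in>{1..N}. \<bar>cL i\<bar>)" "0 \<le> (\<Sum>i\<in>{1..N}. \<bar>cR i\<bar>)" by (auto intro: sum_nonneg)
  have C1: "C \<ge> 1" "c0 \<le> C" using s0 abs_ge_self[of c0] unfolding C_def by linarith+
  have CL: "cL i \<le> C" "cR i \<le> C" if "i \<in> {1..N}" for i
    using s0 member_le_sum[OF that, of "\<lambda>i. \<bar>cL i\<bar>"] member_le_sum[OF that, of "\<lambda>i. \<bar>cR i\<bar>"] by (auto simp: C_def)
  have "continuous_on {0..1} (\<eta>I j k) \<and>
    (\<forall>t\<in>{0..1}. \<bar>\<eta>I j k t\<bar> \<le> C * 2 powr (real j / 2) \<and> (\<eta>I j k t \<noteq> 0 \<longrightarrow> \<bar>2^j * t - real k\<bar> \<le> 2 * real N))"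
    if j: "j \<ge> j0" and k: "k \<in> {1..2^j}" for j k
  proof -
    have N2: "2 * N \<le> 2 ^ j" using N power_increasing[OF j, of "2::nat"] by linarith
    have main: ?thesis
      if rep: "\<And>t. t \<in> {0..1} \<Longrightarrow> \<eta>I j k t = 2 powr (real j / 2) * g (2^j * t - a)"
        and gc: "continuous_on ((\<lambda>t. 2^j * t - a) ` {0..1}) g"
        and gb: "\<And>t. t \<in> {0..1} \<Longrightarrow> \<bar>g (2^j * t - a)\<bar> \<le> C"
        and gs: "\<And>t. t \<in> {0..1} \<Longrightarrow> g (2^j * t - a) \<noteq> 0 \<Longrightarrow> \<bar>2^j * t - real k\<bar> \<le> 2 * real N" for g a
    proof -
      have "continuous_on {0..1} (\<lambda>t. 2 powr (real j / 2) * g (2^j * t - a))"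
        by (intro continuous_intros continuous_on_compose2[OF gc]) auto
      then have "continuous_on {0..1} (\<eta>I j k)" by (rule continuous_on_eq) (simp add: rep)
      then show ?thesis using gb gs by (auto simp: rep abs_mult mult.commute[of C])
    qed
    consider "k \<le> N" | "\<not> k \<le> N" "k \<le> 2^j - N" | "\<not> k \<le> N" "\<not> k \<le> 2^j - N" by blast
    then show ?thesis
    proof cases
      case 1
      then have kN: "k \<in> {1..N}" using k by auto
      show ?thesis
      proof (rule main[of "\<eta>L k" 0])
        show "\<eta>I j k t = 2 powr (real j / 2) * \<eta>L k (2^j * t - 0)" if "t \<in> {0..1}" for t
          using I[OF j k that] 1 by (simp add: dilate_def)
        show "continuous_on ((\<lambda>t. 2^j * t - 0) ` {0..1}) (\<eta>L k)"
          by (rule continuous_on_subset[OF contL[OF kN]]) auto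
        show "\<bar>\<eta>L k (2^j * t - 0)\<bar> \<le> C" if "t \<in> {0..1}" for t
          using cL[OF kN, of "2^j * t - 0"] CL[OF kN] that by auto
        show "\<bar>2^j * t - real k\<bar> \<le> 2 * real N" if "t \<in> {0..1}" "\<eta>L k (2^j * t - 0) \<noteq> 0" for t
        proof -
          have "2^j * t \<le> 2 * real N" using edge(2)[OF kN, of "2^j * t"] that(2) by force
          moreover have "0 \<le> 2^j * t" using that by simp
          ultimately show ?thesis using 1 by linarith
        qed
      qed
    next
      case 2
      show ?thesis
      proof (rule main[of \<eta> "real k"])
        show "\<eta>I j k t = 2 powr (real j / 2) * \<eta> (2^j * t - real k)" if "t \<in> {0..1}" for t
          using I[OF j k that] 2 by (simp add: dilate_def)
        show "continuous_on ((\<lambda>t. 2^j * t - real k) ` {0..1}) \<eta>"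
          by (rule continuous_on_subset[OF cont]) auto
        show "\<bar>\<eta> (2^j * t - real k)\<bar> \<le> C" for t using c0[of "2^j * t - real k"] C1 by linarith
        show "\<bar>2^j * t - real k\<bar> \<le> 2 * real N" if "\<eta> (2^j * t - real k) \<noteq> 0" for t
          using \<eta>(2)[of "2^j * t - real k"] that by force
      qed
    next
      case 3
      define i where "i = 2^j + 1 - k"
      have i: "i \<in> {1..N}" using 3 k N2 by (auto simp: i_def)
      have ik: "real i = 2^j + 1 - real k" using k by (simp add: i_def of_nat_diff)
      show ?thesis
      proof (rule main[of "\<eta>R i" "2^j"])
        show "\<eta>I j k t = 2 powr (real j / 2) * \<eta>R i (2^j * t - 2^j)" if "t \<in> {0..1}" for t
          using I[OF j k that] 3 by (simp add: dilate_def i_def)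
        show "continuous_on ((\<lambda>t. 2^j * t - 2^j) ` {0..1}) (\<eta>R i)"
          by (rule continuous_on_subset[OF contR[OF i]]) auto
        show "\<bar>\<eta>R i (2^j * t - 2^j)\<bar> \<le> C" if "t \<in> {0..1}" for t
          using cR[OF i, of "2^j * t - 2^j"] CL[OF i] that by auto
        show "\<bar>2^j * t - real k\<bar> \<le> 2 * real N" if "t \<in> {0..1}" "\<eta>R i (2^j * t - 2^j) \<noteq> 0" for t
        proof -
          have "2^j * t - 2^j \<ge> - 2 * real N" using edge(4)[OF i, of "2^j * t - 2^j"] that(2) by force
          moreover have "2^j * t \<le> 2^j" using that by simp
          moreover have "real i \<le> real N" "1 \<le> real i" using i by auto
          ultimately show ?thesis using ik by linarith
        qed
      qed
    qed
  qed
  with C1 show ?thesis by blast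
qed

lemma wavelet_system_of_basis:
  assumes pair: "wavelet_pair \<phi> \<psi>" and basis: "interval_wavelet_basis \<phi> \<psi> r j0 \<phi>I \<psi>I"
  obtains R C where "wavelet_system (\<phi>I j0) \<psi>I r j0 R C"
proof -
  obtain N where N: "2 * N \<le> 2 ^ j0" and supp: "\<And>x. real N < \<bar>x\<bar> \<Longrightarrow> \<phi> x = 0 \<and> \<psi> x = 0"
    and bc: "boundary_corrected N \<phi> 1 j0 \<phi> \<phi>I" "boundary_corrected N \<phi> 2 j0 \<psi> \<psi>I"
    using basis unfolding interval_wavelet_basis_def by blast
  have cont: "continuous_on UNIV \<phi>" and comb: "finite_comb_on UNIV \<phi> 2 \<phi>" "finite_comb_on UNIV \<phi> 2 \<psi>"
    using pair unfolding wavelet_pair_def by blast+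
  have "bounded (\<phi> ` {- real N..real N})"
    by (intro compact_imp_bounded compact_continuous_image continuous_on_subset[OF cont]) auto
  then obtain b where "b > 0" "\<forall>y\<in>\<phi> ` {- real N..real N}. norm y \<le> b"
    unfolding bounded_pos by blast
  then have b: "\<And>x. \<bar>x\<bar> \<le> real N \<Longrightarrow> \<bar>\<phi> x\<bar> \<le> b" "b > 0"
    by (auto simp: abs_le_iff)
  have bb: "\<bar>\<phi> x\<bar> \<le> b" for x using b(1)[of x] b(2) supp[of x] by force
  obtain C1 where C1: "C1 \<ge> 1" "\<And>j k. j \<ge> j0 \<Longrightarrow> k \<in> {1..2^j} \<Longrightarrow> continuous_on {0..1} (\<phi>I j k)"
    "\<And>j k t. j \<ge> j0 \<Longrightarrow> k \<in> {1..2^j} \<Longrightarrow> t \<in> {0..1} \<Longrightarrow> \<bar>\<phi>I j k t\<bar> \<le> C1 * 2 powr (real j / 2)"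
    using boundary_corrected_regularity[OF cont bb comb(1) _ N bc(1)] supp by blast
  obtain C2 where C2: "C2 \<ge> 1" "\<And>j k. j \<ge> j0 \<Longrightarrow> k \<in> {1..2^j} \<Longrightarrow> continuous_on {0..1} (\<psi>I j k)"
    "\<And>j k t. j \<ge> j0 \<Longrightarrow> k \<in> {1..2^j} \<Longrightarrow> t \<in> {0..1} \<Longrightarrow> \<bar>\<psi>I j k t\<bar> \<le> C2 * 2 powr (real j / 2)"
    "\<And>j k t. j \<ge> j0 \<Longrightarrow> k \<in> {1..2^j} \<Longrightarrow> t \<in> {0..1} \<Longrightarrow> \<psi>I j k t \<noteq> 0 \<Longrightarrow> \<bar>2^j * t - real k\<bar> \<le> 2 * real N"
    using boundary_corrected_regularity[OF cont bb comb(2) _ N bc(2)] supp by blast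
  define C where "C = C1 * 2 powr (real j0 / 2) + C2"
  have C: "C2 \<le> C" "C1 * 2 powr (real j0 / 2) \<le> C" using C1(1) C2(1) by (auto simp: C_def)
  have "wavelet_system (\<phi>I j0) \<psi>I r j0 (2 * real N) C"
  proof
    show "\<bar>\<psi>I j k t\<bar> \<le> C * 2 powr (real j / 2)" if "j \<ge> j0" "k \<in> {1..2^j}" "t \<in> {0..1}" for j k t
      by (rule order_trans[OF C2(3)[OF that] mult_right_mono[OF C(1)]]) simp
    show "(LINT t|unit_lebesgue. t ^ i * \<psi>I j k t) = 0" if "j \<ge> j0" "k \<in> {1..2^j}" "i < r" for i j k
      using basis that unfolding interval_wavelet_basis_def set_lebesgue_integral_unit by blast
    show "L2_orthonormal_basis unit_lebesgue (Inl ` {1..2 ^ j0} \<union> Inr ` (SIGMA j:{j0..}. {1..2 ^ j}))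
       (case_sum (\<phi>I j0) (\<lambda>(j, k). \<psi>I j k))"
      using basis unfolding interval_wavelet_basis_def by blast
    show "\<bar>\<phi>I j0 k t\<bar> \<le> C" if "k \<in> {1..2^j0}" "t \<in> {0..1}" for k t
      using C1(3)[OF order_refl that] C(2) by linarith
  qed (use C C2 C1 in auto)
  then show ?thesis by (rule that)
qed

section \<open>Blocks and their shrinkage\<close>

lemma lambda_star: "lambda_star > 1" "lambda_star - ln lambda_star - 1 = 2"
proof -
  have inc: "a - ln a < b - ln b" if "1 < a" "a < b" for a b :: real
  proof -
    have "ln b - ln a = ln (b / a)" using that by (simp add: ln_div)
    also have "\<dots> \<le> b / a - 1" using that by (intro ln_le_minus_one) simp
    also have "\<dots> = (b - a) / a" using that by (simp add: diff_divide_distrib)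
    also have "\<dots> < b - a" using that by (simp add: divide_less_eq)
    finally show ?thesis by simp
  qed
  have "ln (9::real) \<le> 4"
  proof -
    have "ln (9::real) = ln (3 * 3)" by simp
    also have "\<dots> = ln 3 + ln 3" by (rule ln_mult_pos) auto
    also have "ln (3::real) \<le> 2" using ln_le_minus_one[of "3::real"] by simp
    finally show ?thesis by simp
  qed
  then have "\<exists>x\<ge>1. x \<le> 9 \<and> x - ln x - 1 = (2::real)"
    by (intro IVT') (auto intro!: continuous_intros)
  then obtain l :: real where l: "l \<ge> 1" "l - ln l - 1 = 2" by blast
  then have "l > 1" by (cases "l = 1") auto
  have "\<exists>!l. l > 1 \<and> l - ln l - 1 = (2::real)"
  proof (rule ex1I)
    show "l > 1 \<and> l - ln l - 1 = 2" using \<open>l > 1\<close> l by simp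
    fix l' :: real assume "l' > 1 \<and> l' - ln l' - 1 = 2"
    then show "l' = l" using inc[of l l'] inc[of l' l] \<open>l > 1\<close> l by (cases l l' rule: linorder_cases) auto
  qed
  from theI'[OF this] show "lambda_star > 1" "lambda_star - ln lambda_star - 1 = 2"
    unfolding lambda_star_def by auto
qed

lemma block_eq:
  assumes L: "block_length n \<ge> 1" and b: "b \<ge> 1"
  shows "block n j b = {k \<in> {1..2 ^ j}. block_of n k = b}"
proof -
  have "(b - 1) * block_length n + 1 \<le> k \<and> k \<le> b * block_length n \<longleftrightarrow> block_of n k = b" if k: "k \<ge> 1" for k
  proof
    obtain b' where b': "b = Suc b'" using b by (cases b) auto
    assume "(b - 1) * block_length n + 1 \<le> k \<and> k \<le> b * block_length n"
    then have "b' * block_length n + 1 \<le> k" "k \<le> block_length n + b' * block_length n"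
      by (auto simp: b')
    then have "(k - 1) div block_length n = b'"
      using L k by (intro div_nat_eqI) (auto simp: mult.commute)
    then show "block_of n k = b" by (simp add: block_of_def b')
  next
    assume *: "block_of n k = b"
    then have d: "(k - 1) div block_length n = b - 1" by (simp add: block_of_def)
    have "(b - 1) * block_length n \<le> k - 1" unfolding d[symmetric] by (rule div_times_less_eq_dividend)
    moreover have "k - 1 < (b - 1) * block_length n + block_length n"
      unfolding d[symmetric] using L dividend_less_div_times[of "block_length n" "k - 1"] by simp
    moreover have "(b - 1) * block_length n + block_length n = b * block_length n"
      using b by (cases b) auto
    ultimately show "(b - 1) * block_length n + 1 \<le> k \<and> k \<le> b * block_length n" using k by linarith
  qed
  then show ?thesis unfolding block_def by auto
qed

lemma card_block_le: "card (block n j b) \<le> block_length n"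
proof -
  have "card (block n j b) \<le> card {(b - 1) * block_length n + 1..b * block_length n}"
    by (intro card_mono) (auto simp: block_def)
  also have "\<dots> \<le> block_length n" by (cases b) auto
  finally show ?thesis .
qed

lemma finite_block [simp]: "finite (block n j b)" by (simp add: block_def)

text \<open>
  Separated from the estimator, so that the error analysis of a block is about real numbers only.
\<close>

definition shrunk :: "real \<Rightarrow> real \<Rightarrow> real \<Rightarrow> real" where
  "shrunk \<tau> S y = max 0 (1 - \<tau> / S) * y"

lemma shrunk_error_trivial:
  assumes "\<tau> \<ge> 0" "S \<ge> 0"
  shows "\<bar>shrunk \<tau> S y - \<theta>\<bar> \<le> \<bar>\<theta>\<bar> + \<bar>y - \<theta>\<bar>"
proof -
  let ?g = "max 0 (1 - \<tau> / S)"
  have g: "0 \<le> ?g" "?g \<le> 1" using assms by auto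
  have "shrunk \<tau> S y - \<theta> = ?g * (y - \<theta>) + - ((1 - ?g) * \<theta>)" by (simp add: shrunk_def algebra_simps)
  also have "\<bar>\<dots>\<bar> \<le> \<bar>?g * (y - \<theta>)\<bar> + \<bar>(1 - ?g) * \<theta>\<bar>" by linarith
  also have "\<dots> \<le> 1 * \<bar>y - \<theta>\<bar> + 1 * \<bar>\<theta>\<bar>"
    unfolding abs_mult using g by (intro add_mono mult_right_mono) auto
  finally show ?thesis by simp
qed

text \<open>
  The shrinkage moves $y$ by $y \min(1, \tau/S)$.  Summed over a block of energy $S$ the squares of these moves amount to
  at most $\tau$, see \<open>shrinkage_weights_sum\<close>.
\<close>

lemma shrunk_error_large:
  assumes "\<tau> > 0" "S \<ge> 0" and y0: "S = 0 \<Longrightarrow> y = 0"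
  shows "(shrunk \<tau> S y - \<theta>)\<^sup>2 \<le> 2 * (y - \<theta>)\<^sup>2 + 2 * (y\<^sup>2 * min 1 (\<tau> / S))"
proof -
  have w: "(y - shrunk \<tau> S y)\<^sup>2 \<le> y\<^sup>2 * min 1 (\<tau> / S)"
  proof (cases "S = 0")
    case False
    then have S: "S > 0" using assms by simp
    have "y - shrunk \<tau> S y = y * min 1 (\<tau> / S)" by (simp add: shrunk_def max_def min_def algebra_simps)
    moreover have "(min 1 (\<tau> / S))\<^sup>2 \<le> min 1 (\<tau> / S)"
      unfolding power2_eq_square using S assms by (intro mult_left_le) auto
    ultimately show ?thesis by (simp add: power_mult_distrib mult_left_mono)
  qed (use y0 in \<open>simp add: shrunk_def\<close>)
  have "(shrunk \<tau> S y - \<theta>)\<^sup>2 = ((y - \<theta>) + - (y - shrunk \<tau> S y))\<^sup>2" by simp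
  also have "\<dots> \<le> 2 * (y - \<theta>)\<^sup>2 + 2 * (- (y - shrunk \<tau> S y))\<^sup>2"
    using sum_squares_bound[of "y - \<theta>" "- (y - shrunk \<tau> S y)"] unfolding power2_sum by linarith
  finally show ?thesis using w unfolding power2_minus by linarith
qed

text \<open>
  If the block survives, then $\sqrt\tau < \|y\| \le \|y - \theta\| + \|\theta\|$, so the noise alone has norm above
  $(1 - e) \sqrt\tau$.
\<close>

lemma shrunk_error_small_signal:
  fixes y \<theta> :: "'k \<Rightarrow> real"
  assumes fin: "finite K" and k: "k \<in> K" and \<tau>: "\<tau> > 0" and e: "0 \<le> e" "e \<le> 1"
    and small: "(\<Sum>k\<in>K. (\<theta> k)\<^sup>2) \<le> e\<^sup>2 * \<tau>"
  defines "S \<equiv> \<Sum>k\<in>K. (y k)\<^sup>2"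
  shows "(shrunk \<tau> S (y k) - \<theta> k)\<^sup>2
    \<le> 2 * (\<theta> k)\<^sup>2 + 2 * ((\<Sum>k\<in>K. (y k - \<theta> k)\<^sup>2) * of_bool ((\<Sum>k\<in>K. (y k - \<theta> k)\<^sup>2) > (1 - e)\<^sup>2 * \<tau>))"
proof (cases "S \<le> \<tau>")
  case True
  have "shrunk \<tau> S (y k) = 0"
  proof (cases "S = 0")
    case True
    then have "(y k)\<^sup>2 = 0" using fin k unfolding S_def by (subst (asm) sum_nonneg_eq_0_iff) auto
    then show ?thesis by (simp add: shrunk_def)
  next
    case False
    moreover have "S \<ge> 0" unfolding S_def by (intro sum_nonneg) auto
    ultimately show ?thesis using True by (simp add: shrunk_def max_def)
  qed
  moreover have "0 \<le> (\<Sum>k\<in>K. (y k - \<theta> k)\<^sup>2)" by (intro sum_nonneg) auto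
  ultimately show ?thesis by simp
next
  case False
  let ?Z = "\<Sum>k\<in>K. (y k - \<theta> k)\<^sup>2"
  have Z0: "?Z \<ge> 0" by (intro sum_nonneg) auto
  have S0: "S \<ge> 0" unfolding S_def by (intro sum_nonneg) auto
  have "sqrt \<tau> < sqrt S" using False by simp
  also have "sqrt S = L2_set (\<lambda>k. (y k - \<theta> k) + \<theta> k) K" by (simp add: L2_set_def S_def)
  also have "\<dots> \<le> sqrt ?Z + sqrt (\<Sum>k\<in>K. (\<theta> k)\<^sup>2)"
    using L2_set_triangle_ineq[of "\<lambda>k. y k - \<theta> k" \<theta> K] by (simp add: L2_set_def)
  also have "sqrt (\<Sum>k\<in>K. (\<theta> k)\<^sup>2) \<le> e * sqrt \<tau>"
    using real_sqrt_le_mono[OF small] e by (simp add: real_sqrt_mult)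
  finally have "(1 - e) * sqrt \<tau> < sqrt ?Z" by (simp add: algebra_simps)
  then have "((1 - e) * sqrt \<tau>)\<^sup>2 < (sqrt ?Z)\<^sup>2" using e \<tau> by (intro power_strict_mono) auto
  then have big: "?Z > (1 - e)\<^sup>2 * \<tau>" using \<tau> Z0 by (simp add: power_mult_distrib)
  have zk: "(y k - \<theta> k)\<^sup>2 \<le> ?Z" using fin k by (intro member_le_sum) auto
  have "\<bar>shrunk \<tau> S (y k) - \<theta> k\<bar> \<le> \<bar>\<theta> k\<bar> + \<bar>y k - \<theta> k\<bar>"
    by (rule shrunk_error_trivial) (use \<tau> S0 in auto)
  then have "(shrunk \<tau> S (y k) - \<theta> k)\<^sup>2 \<le> (\<bar>\<theta> k\<bar> + \<bar>y k - \<theta> k\<bar>)\<^sup>2"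
    by (rule power2_le_iff_abs_le[THEN iffD2, rotated]) auto
  also have "\<dots> \<le> 2 * (\<theta> k)\<^sup>2 + 2 * (y k - \<theta> k)\<^sup>2"
    using sum_squares_bound[of "\<bar>\<theta> k\<bar>" "\<bar>y k - \<theta> k\<bar>"] by (simp add: power2_sum)
  finally show ?thesis using big zk by simp
qed

lemma shrinkage_weights_sum:
  fixes y :: "'k \<Rightarrow> real"
  assumes "\<tau> > 0"
  shows "(\<Sum>k\<in>K. (y k)\<^sup>2 * min 1 (\<tau> / (\<Sum>k\<in>K. (y k)\<^sup>2))) \<le> \<tau>"
proof -
  let ?S = "\<Sum>k\<in>K. (y k)\<^sup>2"
  have S: "?S \<ge> 0" by (intro sum_nonneg) auto
  have "(\<Sum>k\<in>K. (y k)\<^sup>2 * min 1 (\<tau> / ?S)) = ?S * min 1 (\<tau> / ?S)" by (simp add: sum_distrib_right)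
  also have "\<dots> \<le> \<tau>"
  proof (cases "?S = 0")
    case False
    then have "?S * min 1 (\<tau> / ?S) \<le> ?S * (\<tau> / ?S)" using S by (intro mult_left_mono) auto
    then show ?thesis using False by simp
  qed (use assms in simp)
  finally show ?thesis .
qed

section \<open>The tail of the noise energy of a block\<close>

text \<open>
  At $e = 0$ the exponent is $-(\lambda_* - 1 - \log \lambda_*)/2 = -1$, which is the defining equation of $\lambda_*$; the claim
  follows by continuity.
\<close>

lemma tail_exponent:
  assumes "\<delta> > 0"
  obtains e where "0 < e" "e < 1" "2 * e < 1 / lambda_star"
    "- (lambda_star - 1) / 2 * (1 - e)\<^sup>2 - ln (1 / lambda_star - 2 * e) / 2 \<le> - 1 + \<delta>"
proof -
  let ?l = lambda_star
  let ?g = "\<lambda>e. - (?l - 1) / 2 * (1 - e)\<^sup>2 - ln (1 / ?l - 2 * e) / 2"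
  note l = lambda_star
  have "(?g \<longlongrightarrow> - (?l - 1) / 2 * (1 - 0)\<^sup>2 - ln (1 / ?l - 2 * 0) / 2) (at_right 0)"
    using l(1) by (intro tendsto_intros) auto
  moreover have "- (?l - 1) / 2 * (1 - 0)\<^sup>2 - ln (1 / ?l - 2 * 0) / 2 = - 1"
    using l by (simp add: ln_div field_simps)
  ultimately have "(?g \<longlongrightarrow> - 1) (at_right 0)" by simp
  then have 1: "eventually (\<lambda>e. ?g e < - 1 + \<delta>) (at_right 0)"
    by (rule order_tendstoD(2)) (use assms in simp)
  have 2: "eventually (\<lambda>e. e \<in> {0<..<min 1 (1 / (2 * ?l))}) (at_right 0)"
    using l(1) by (intro eventually_at_right_real) auto
  from eventually_conj[OF 1 2] obtain e where "?g e < - 1 + \<delta>" "e \<in> {0<..<min 1 (1 / (2 * ?l))}"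
    using eventually_happens'[OF trivial_limit_at_right_real] by blast
  then have e: "0 < e" "e < 1" "e < 1 / (2 * ?l)" "?g e \<le> - 1 + \<delta>" by auto
  then have "2 * e < 1 / ?l" using l(1) by (simp add: field_simps)
  with e show ?thesis by (intro that)
qed

text \<open>
  The exponential bound at $s_0 + e$, where $s_0 = (1 - 1/\lambda_*)/2$ is the optimal parameter for the tail at $\lambda_* \log n$; the additional
  $e$ absorbs the factor in front of the indicator.  The block length exceeds $\log n$ by at most one half, because of rounding.
\<close>

lemma chi_square_tail:
  fixes V :: "'k \<Rightarrow> 'w \<Rightarrow> real"
  assumes "prob_space P" "finite K" and V[measurable]: "\<And>k. k \<in> K \<Longrightarrow> V k \<in> borel_measurable P"
    and mgf: "\<And>u. (\<integral>\<^sup>+\<omega>. ennreal (exp (\<Sum>k\<in>K. u k * V k \<omega>)) \<partial>P) \<le> ennreal (exp ((\<Sum>k\<in>K. (u k)\<^sup>2) / 2))"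
    and e: "0 < e" "e < 1" "2 * e < 1 / lambda_star"
      "- (lambda_star - 1) / 2 * (1 - e)\<^sup>2 - ln (1 / lambda_star - 2 * e) / 2 \<le> - 1 + \<delta>"
    and n: "n \<ge> 2" and card: "real (card K) \<le> ln (real n) + 1/2"
  shows "(\<integral>\<^sup>+\<omega>. ennreal ((\<Sum>k\<in>K. (V k \<omega>)\<^sup>2) * of_bool ((\<Sum>k\<in>K. (V k \<omega>)\<^sup>2) > (1 - e)\<^sup>2 * (lambda_star * ln (real n)))) \<partial>P)
    \<le> ennreal (1 / e * (1 / lambda_star - 2 * e) powr (- 1 / 4) * real n powr (- 1 + \<delta>))"
proof -
  let ?l = lambda_star
  note l = lambda_star(1)
  define s0 where "s0 = (1 - 1 / ?l) / 2"
  define q where "q = 1 / ?l - 2 * e"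
  define T where "T = (1 - e)\<^sup>2 * (?l * ln (real n))"
  have s0: "s0 \<ge> 0" using l by (simp add: s0_def)
  have "1 / ?l < 1" using l by simp
  then have q: "0 < q" "q < 1" using e(1,3) unfolding q_def by linarith+
  have q3: "1 - 2 * (s0 + e) = q" by (simp add: q_def s0_def diff_divide_distrib)
  have ln0: "ln (real n) > 0" using n by simp
  let ?X = "\<lambda>\<omega>. \<Sum>k\<in>K. (V k \<omega>)\<^sup>2"
  have Xm[measurable]: "?X \<in> borel_measurable P" by measurable
  have "?X \<omega> * of_bool (?X \<omega> > T) \<le> 1 / e * exp (- s0 * T) * exp ((s0 + e) * ?X \<omega>)" for \<omega>
  proof (cases "?X \<omega> > T")
    case True
    have "e * ?X \<omega> \<le> exp (e * ?X \<omega>)" using exp_ge_add_one_self[of "e * ?X \<omega>"] by linarith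
    then have 1: "?X \<omega> \<le> 1 / e * exp (e * ?X \<omega>)" using e by (simp add: field_simps)
    have "1 \<le> exp (s0 * (?X \<omega> - T))" using s0 True by simp
    then have "1 / e * exp (e * ?X \<omega>) * 1 \<le> 1 / e * exp (e * ?X \<omega>) * exp (s0 * (?X \<omega> - T))"
      using e by (intro mult_left_mono) auto
    also have "\<dots> = 1 / e * exp (- s0 * T) * exp ((s0 + e) * ?X \<omega>)"
      by (simp add: mult_exp_exp algebra_simps)
    finally show ?thesis using 1 True by simp
  qed (use e in simp)
  then have "(\<integral>\<^sup>+\<omega>. ennreal (?X \<omega> * of_bool (?X \<omega> > T)) \<partial>P)
      \<le> (\<integral>\<^sup>+\<omega>. ennreal (1 / e * exp (- s0 * T)) * ennreal (exp ((s0 + e) * ?X \<omega>)) \<partial>P)"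
    using e by (intro nn_integral_mono) (simp add: ennreal_mult[symmetric])
  also have "\<dots> = ennreal (1 / e * exp (- s0 * T)) * (\<integral>\<^sup>+\<omega>. ennreal (exp ((s0 + e) * ?X \<omega>)) \<partial>P)"
    by (rule nn_integral_cmult) simp
  also have "\<dots> \<le> ennreal (1 / e * exp (- s0 * T)) * ennreal (q powr (- real (card K) / 2))"
    unfolding q3[symmetric] using q q3 s0 e
    by (intro mult_left_mono chi_square_exp_moment[OF assms(1,2) V mgf]) auto
  also have "\<dots> = ennreal (1 / e * exp (- s0 * T) * q powr (- real (card K) / 2))"
    using e by (intro ennreal_mult[symmetric]) auto
  also have "\<dots> \<le> ennreal (1 / e * q powr (- 1 / 4) * real n powr (- 1 + \<delta>))"
  proof (intro ennreal_leI)
    have "q powr (- real (card K) / 2) \<le> q powr (- (ln (real n) + 1/2) / 2)"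
      using q card by (intro powr_mono') auto
    also have "\<dots> = q powr (- 1 / 4) * exp (- ln (real n) / 2 * ln q)"
    proof -
      have "- (ln (real n) + 1/2) / 2 = - 1 / 4 + - ln (real n) / 2" by (simp add: field_simps)
      then have "q powr (- (ln (real n) + 1/2) / 2) = q powr (- 1 / 4) * q powr (- ln (real n) / 2)"
        by (simp only: powr_add)
      then show ?thesis using q(1) by (simp add: powr_def)
    qed
    finally have "1 / e * exp (- s0 * T) * q powr (- real (card K) / 2)
       \<le> 1 / e * exp (- s0 * T) * (q powr (- 1 / 4) * exp (- ln (real n) / 2 * ln q))"
      using e by (intro mult_left_mono) auto
    also have "\<dots> = 1 / e * q powr (- 1 / 4) * exp (- s0 * T + - ln (real n) / 2 * ln q)"
      unfolding exp_add by (simp only: ac_simps)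
    also have "\<dots> \<le> 1 / e * q powr (- 1 / 4) * real n powr (- 1 + \<delta>)"
    proof (rule mult_left_mono)
      have "- s0 * T + - ln (real n) / 2 * ln q = ln (real n) * (- (?l - 1) / 2 * (1 - e)\<^sup>2 - ln q / 2)"
        using l by (simp add: s0_def T_def field_simps)
      also have "\<dots> \<le> ln (real n) * (- 1 + \<delta>)"
        using e(4) ln0 unfolding q_def[symmetric] by (simp add: mult_left_mono)
      finally have "exp (- s0 * T + - ln (real n) / 2 * ln q) \<le> exp (ln (real n) * (- 1 + \<delta>))" by simp
      also have "\<dots> = real n powr (- 1 + \<delta>)" using n by (simp add: powr_def mult.commute)
      finally show "exp (- s0 * T + - ln (real n) / 2 * ln q) \<le> real n powr (- 1 + \<delta>)" .
    qed (use e in simp)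
    finally show "1 / e * exp (- s0 * T) * q powr (- real (card K) / 2) \<le> 1 / e * q powr (- 1 / 4) * real n powr (- 1 + \<delta>)" .
  qed
  finally show ?thesis unfolding T_def q_def .
qed

section \<open>Mean squares of coefficient errors\<close>

definition mean_square :: "'w measure \<Rightarrow> ('w \<Rightarrow> real) \<Rightarrow> ennreal" where
  "mean_square P X = (\<integral>\<^sup>+\<omega>. ennreal ((X \<omega>)\<^sup>2) \<partial>P)"

lemma mean_square_mono:
  "(\<And>\<omega>. \<bar>X \<omega>\<bar> \<le> \<bar>Y \<omega>\<bar>) \<Longrightarrow> mean_square P X \<le> mean_square P Y"
  unfolding mean_square_def by (intro nn_integral_mono ennreal_leI) (simp add: abs_le_square_iff)

text \<open>
  Minkowski's inequality, from the Cauchy--Schwarz inequality with weights $q_i$.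
\<close>

lemma mean_square_sum_le:
  fixes X :: "'i \<Rightarrow> 'w \<Rightarrow> real"
  assumes fin: "finite S" and X: "\<And>i. i \<in> S \<Longrightarrow> X i \<in> borel_measurable P"
    and q: "\<And>i. i \<in> S \<Longrightarrow> q i > 0" "\<And>i. i \<in> S \<Longrightarrow> mean_square P (X i) \<le> ennreal ((q i)\<^sup>2)"
  shows "mean_square P (\<lambda>\<omega>. \<Sum>i\<in>S. X i \<omega>) \<le> ennreal ((\<Sum>i\<in>S. q i)\<^sup>2)"
proof -
  let ?Q = "\<Sum>i\<in>S. q i"
  have Q: "?Q \<ge> 0" using q(1) by (intro sum_nonneg) (simp add: less_imp_le)
  have m: "(\<lambda>\<omega>. ennreal (1 / q i) * ennreal ((X i \<omega>)\<^sup>2)) \<in> borel_measurable P" if "i \<in> S" for i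
  proof -
    note X[OF that, measurable]
    show ?thesis by measurable
  qed
  have "mean_square P (\<lambda>\<omega>. \<Sum>i\<in>S. X i \<omega>) \<le> (\<integral>\<^sup>+\<omega>. ennreal ?Q * (\<Sum>i\<in>S. ennreal (1 / q i) * ennreal ((X i \<omega>)\<^sup>2)) \<partial>P)"
    unfolding mean_square_def
  proof (intro nn_integral_mono)
    fix \<omega>
    have "(\<Sum>i\<in>S. X i \<omega>) = (\<Sum>i\<in>S. sqrt (q i) * (X i \<omega> / sqrt (q i)))"
      using q(1) by (intro sum.cong) (auto dest: less_imp_neq[THEN not_sym])
    then have "(\<Sum>i\<in>S. X i \<omega>)\<^sup>2 \<le> (\<Sum>i\<in>S. (sqrt (q i))\<^sup>2) * (\<Sum>i\<in>S. (X i \<omega> / sqrt (q i))\<^sup>2)"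
      using Cauchy_Schwarz_ineq_sum[of "\<lambda>i. sqrt (q i)" "\<lambda>i. X i \<omega> / sqrt (q i)" S] by simp
    also have "(\<Sum>i\<in>S. (sqrt (q i))\<^sup>2) = ?Q" using q(1) by (intro sum.cong) (auto simp: less_imp_le)
    also have "(\<Sum>i\<in>S. (X i \<omega> / sqrt (q i))\<^sup>2) = (\<Sum>i\<in>S. 1 / q i * (X i \<omega>)\<^sup>2)"
      using q(1) by (intro sum.cong) (auto simp: power_divide less_imp_le)
    finally have "ennreal ((\<Sum>i\<in>S. X i \<omega>)\<^sup>2) \<le> ennreal (?Q * (\<Sum>i\<in>S. 1 / q i * (X i \<omega>)\<^sup>2))" by (rule ennreal_leI)
    also have "\<dots> = ennreal ?Q * (\<Sum>i\<in>S. ennreal (1 / q i * (X i \<omega>)\<^sup>2))"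
      using Q q(1) by (subst sum_ennreal) (auto simp: ennreal_mult[symmetric] less_imp_le intro!: ennreal_mult sum_nonneg)
    also have "(\<Sum>i\<in>S. ennreal (1 / q i * (X i \<omega>)\<^sup>2)) = (\<Sum>i\<in>S. ennreal (1 / q i) * ennreal ((X i \<omega>)\<^sup>2))"
      using q(1) by (intro sum.cong refl ennreal_mult) (auto simp: less_imp_le)
    finally show "ennreal ((\<Sum>i\<in>S. X i \<omega>)\<^sup>2) \<le> ennreal ?Q * (\<Sum>i\<in>S. ennreal (1 / q i) * ennreal ((X i \<omega>)\<^sup>2))" .
  qed
  also have "\<dots> = ennreal ?Q * (\<Sum>i\<in>S. (\<integral>\<^sup>+\<omega>. ennreal (1 / q i) * ennreal ((X i \<omega>)\<^sup>2) \<partial>P))"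
    by (subst nn_integral_cmult, rule borel_measurable_sum, erule m, subst nn_integral_sum, erule m, rule refl)
  also have "\<dots> \<le> ennreal ?Q * (\<Sum>i\<in>S. ennreal (q i))"
  proof (intro mult_left_mono sum_mono)
    fix i assume i: "i \<in> S"
    note X[OF i, measurable]
    have "(\<integral>\<^sup>+\<omega>. ennreal (1 / q i) * ennreal ((X i \<omega>)\<^sup>2) \<partial>P) = ennreal (1 / q i) * mean_square P (X i)"
      unfolding mean_square_def by (rule nn_integral_cmult) simp
    also have "\<dots> \<le> ennreal (1 / q i) * ennreal ((q i)\<^sup>2)" using q(2)[OF i] by (intro mult_left_mono) auto
    also have "\<dots> = ennreal (q i)" using q(1)[OF i] by (simp add: ennreal_mult[symmetric] power2_eq_square)
    finally show "(\<integral>\<^sup>+\<omega>. ennreal (1 / q i) * ennreal ((X i \<omega>)\<^sup>2) \<partial>P) \<le> ennreal (q i)" .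
  qed simp
  also have "\<dots> = ennreal (?Q\<^sup>2)"
    using q(1) Q by (subst sum_ennreal) (auto simp: less_imp_le ennreal_mult[symmetric] power2_eq_square)
  finally show ?thesis .
qed

lemma mean_square_add_le:
  assumes [measurable]: "X \<in> borel_measurable P" "Y \<in> borel_measurable P"
    and "mean_square P X \<le> ennreal a" "mean_square P Y \<le> ennreal b" "a \<ge> 0" "b \<ge> 0"
  shows "mean_square P (\<lambda>\<omega>. X \<omega> + Y \<omega>) \<le> ennreal (2 * a + 2 * b)"
proof -
  have "mean_square P (\<lambda>\<omega>. X \<omega> + Y \<omega>) \<le> (\<integral>\<^sup>+\<omega>. 2 * ennreal ((X \<omega>)\<^sup>2) + 2 * ennreal ((Y \<omega>)\<^sup>2) \<partial>P)"
    unfolding mean_square_def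
  proof (intro nn_integral_mono)
    fix \<omega>
    have "(X \<omega> + Y \<omega>)\<^sup>2 \<le> 2 * (X \<omega>)\<^sup>2 + 2 * (Y \<omega>)\<^sup>2"
      using sum_squares_bound[of "X \<omega>" "Y \<omega>"] unfolding power2_sum by linarith
    then have "ennreal ((X \<omega> + Y \<omega>)\<^sup>2) \<le> ennreal (2 * (X \<omega>)\<^sup>2 + 2 * (Y \<omega>)\<^sup>2)" by (rule ennreal_leI)
    also have "\<dots> = 2 * ennreal ((X \<omega>)\<^sup>2) + 2 * ennreal ((Y \<omega>)\<^sup>2)" by (simp add: ennreal_mult)
    finally show "ennreal ((X \<omega> + Y \<omega>)\<^sup>2) \<le> 2 * ennreal ((X \<omega>)\<^sup>2) + 2 * ennreal ((Y \<omega>)\<^sup>2)" .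
  qed
  also have "\<dots> = 2 * mean_square P X + 2 * mean_square P Y"
    unfolding mean_square_def by (subst nn_integral_add) (simp_all add: nn_integral_cmult)
  also have "\<dots> \<le> 2 * ennreal a + 2 * ennreal b" using assms by (intro add_mono mult_left_mono) auto
  also have "\<dots> = ennreal (2 * a + 2 * b)" using assms by (simp add: ennreal_mult)
  finally show ?thesis .
qed

locale noisy_wavelets = wavelet_system \<phi>0 \<psi> r j0 R C for \<phi>0 \<psi> r j0 R C +
  fixes P :: "'w measure" and B :: "real \<Rightarrow> 'w \<Rightarrow> real"
  assumes B: "brownian_motion P B"
begin

sublocale prob_space P using B by (simp add: brownian_motion_def)

definition obs :: "nat \<Rightarrow> (real \<Rightarrow> real) \<Rightarrow> nat \<Rightarrow> nat \<Rightarrow> 'w \<Rightarrow> real" where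
  "obs n f j k = stoch_integral P (observation B n f) (\<psi> j k)"

definition obs0 :: "nat \<Rightarrow> (real \<Rightarrow> real) \<Rightarrow> nat \<Rightarrow> 'w \<Rightarrow> real" where
  "obs0 n f k = stoch_integral P (observation B n f) (\<phi>0 k)"

definition noise :: "nat \<Rightarrow> (real \<Rightarrow> real) \<Rightarrow> nat \<Rightarrow> nat \<Rightarrow> 'w \<Rightarrow> real" where
  "noise n f j k \<omega> = sqrt (real n) * (obs n f j k \<omega> - wavelet_coeff f j k)"

definition noise0 :: "nat \<Rightarrow> (real \<Rightarrow> real) \<Rightarrow> nat \<Rightarrow> 'w \<Rightarrow> real" where
  "noise0 n f k \<omega> = sqrt (real n) * (obs0 n f k \<omega> - scaling_coeff f k)"

definition err :: "nat \<Rightarrow> (real \<Rightarrow> real) \<Rightarrow> nat \<Rightarrow> nat \<Rightarrow> 'w \<Rightarrow> real" where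
  "err n f j k \<omega> = block_js_coeff n (\<lambda>j k. obs n f j k \<omega>) j k - wavelet_coeff f j k"

definition threshold :: "nat \<Rightarrow> real" where
  "threshold n = lambda_star * ln (real n) / real n"

context
  fixes n :: nat and f :: "real \<Rightarrow> real"
  assumes n: "n \<ge> 1" and f: "continuous_on {0..1} f"
begin

lemma noise_stoch_integral:
  assumes "j \<ge> j0" "k \<in> {1..2^j}"
  shows "has_stoch_integral P B (\<psi> j k) (noise n f j k)"
  using noise_has_stoch_integral[OF B f wavelet_continuous[OF assms] n stoch_integral_observation[OF B f wavelet_continuous[OF assms] n]]
  unfolding noise_def[abs_def] obs_def wavelet_coeff_def .

lemma noise0_stoch_integral:
  assumes "k \<in> {1..2^j0}"
  shows "has_stoch_integral P B (\<phi>0 k) (noise0 n f k)"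
  using noise_has_stoch_integral[OF B f scaling_continuous[OF assms] n stoch_integral_observation[OF B f scaling_continuous[OF assms] n]]
  unfolding noise0_def[abs_def] obs0_def scaling_coeff_def .

lemma obs_measurable:
  assumes "j \<ge> j0" "k \<in> {1..2^j}"
  shows "obs n f j k \<in> borel_measurable P"
  using stoch_integral_observation[OF B f wavelet_continuous[OF assms] n]
  unfolding obs_def has_stoch_integral_def by blast

lemma obs0_measurable:
  assumes "k \<in> {1..2^j0}"
  shows "obs0 n f k \<in> borel_measurable P"
  using stoch_integral_observation[OF B f scaling_continuous[OF assms] n]
  unfolding obs0_def has_stoch_integral_def by blast

lemma noise_measurable:
  assumes "j \<ge> j0" "k \<in> {1..2^j}"
  shows "noise n f j k \<in> borel_measurable P"
  using noise_stoch_integral[OF assms] unfolding has_stoch_integral_def by blast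

text \<open>
  By orthonormality the combined integrand has squared norm $|u|^2$.
\<close>

lemma noise_exp_moment:
  assumes j: "j \<ge> j0" and K: "K \<subseteq> {1..2^j}"
  shows "(\<integral>\<^sup>+\<omega>. ennreal (exp (\<Sum>k\<in>K. u k * noise n f j k \<omega>)) \<partial>P) \<le> ennreal (exp ((\<Sum>k\<in>K. (u k)\<^sup>2) / 2))"
proof (rule wiener_exp_moment[OF B])
  show fin: "finite K" using K finite_subset by blast
  show "has_stoch_integral P B (\<psi> j k) (noise n f j k)" "continuous_on {0..1} (\<psi> j k)" if "k \<in> K" for k
    using that K by (auto intro!: noise_stoch_integral wavelet_continuous j)
  have "(\<integral>\<^sup>+x. ennreal ((\<Sum>(j, k)\<in>{j} \<times> K. u k * \<psi> j k x)\<^sup>2) \<partial>unit_lebesgue) = ennreal (\<Sum>(j, k)\<in>{j} \<times> K. (u k)\<^sup>2)"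
    by (rule nn_integral_wavelet_sum_square) (use fin K j in auto)
  then show "(\<integral>\<^sup>+t. ennreal ((\<Sum>k\<in>K. u k * \<psi> j k t)\<^sup>2) \<partial>unit_lebesgue) \<le> ennreal (\<Sum>k\<in>K. (u k)\<^sup>2)"
    by (simp add: sum.cartesian_product[symmetric])
qed (simp add: sum_nonneg)

lemma noise_mean_square:
  assumes "j \<ge> j0" "k \<in> {1..2^j}"
  shows "mean_square P (noise n f j k) \<le> ennreal 8"
proof -
  have "(\<integral>\<^sup>+\<omega>. ennreal (exp (s * noise n f j k \<omega>)) \<partial>P) \<le> ennreal (exp (s\<^sup>2 * 1 / 2))" for s
    using noise_exp_moment[OF assms(1), of "{k}" "\<lambda>_. s"] assms(2) by simp
  from second_moment_from_exp_moments[OF noise_measurable[OF assms] _ this] show ?thesis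
    by (simp add: mean_square_def)
qed

lemma noise0_mean_square:
  assumes k: "k \<in> {1..2^j0}"
  shows "mean_square P (noise0 n f k) \<le> ennreal 8"
proof -
  have m: "noise0 n f k \<in> borel_measurable P"
    using noise0_stoch_integral[OF k] unfolding has_stoch_integral_def by blast
  have "(\<integral>\<^sup>+\<omega>. ennreal (exp (s * noise0 n f k \<omega>)) \<partial>P) \<le> ennreal (exp (s\<^sup>2 * 1 / 2))" for s
  proof -
    have "(\<integral>\<^sup>+\<omega>. ennreal (exp (\<Sum>i\<in>{k}. s * noise0 n f i \<omega>)) \<partial>P) \<le> ennreal (exp (s\<^sup>2 * 1 / 2))"
    proof (rule wiener_exp_moment[OF B])
      have "(\<integral>\<^sup>+t. ennreal ((s * \<phi>0 k t)\<^sup>2) \<partial>unit_lebesgue) = ennreal (LINT t|unit_lebesgue. (s * \<phi>0 k t)\<^sup>2)"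
        by (rule nn_integral_eq_integral)
          (auto intro!: continuous_on_unit_integrable continuous_intros scaling_continuous k)
      also have "(LINT t|unit_lebesgue. (s * \<phi>0 k t)\<^sup>2) = s\<^sup>2"
      proof -
        have "(LINT t|unit_lebesgue. (s * \<phi>0 k t)\<^sup>2) = (LINT t|unit_lebesgue. s\<^sup>2 * (\<phi>0 k t * \<phi>0 k t))"
          by (simp only: power_mult_distrib power2_eq_square[of "\<phi>0 k _"])
        then show ?thesis by (simp only: integral_mult_right_zero scaling_normalized[OF k] mult_1_right)
      qed
      finally show "(\<integral>\<^sup>+t. ennreal ((\<Sum>i\<in>{k}. s * \<phi>0 i t)\<^sup>2) \<partial>unit_lebesgue) \<le> ennreal (s\<^sup>2 * 1)" by simp
    qed (use k noise0_stoch_integral scaling_continuous in auto)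
    then show ?thesis by simp
  qed
  from second_moment_from_exp_moments[OF m _ this] show ?thesis by (simp add: mean_square_def)
qed

lemma obs_eq: "obs n f j k \<omega> - wavelet_coeff f j k = noise n f j k \<omega> / sqrt (real n)"
  using n by (simp add: noise_def)

context
  fixes j :: nat
  assumes j: "j \<ge> j0" and jn: "int j < \<lfloor>log 2 (real n)\<rfloor>" and n2: "n \<ge> 2"
begin

lemma threshold_pos: "threshold n > 0"
  using n2 lambda_star(1) by (simp add: threshold_def)

lemma block_length_pos: "block_length n \<ge> 1"
proof -
  have "exp (1/2 :: real) \<le> 2" using exp_bound[of "1/2 :: real"] by (simp add: power2_eq_square)
  then have "exp (1/2) \<le> real n" using n2 by linarith
  then have "ln (real n) \<ge> 1/2" using n2 ln_ge_iff[of "real n" "1/2"] by simp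
  then have "round (ln (real n)) \<ge> 1" by (simp add: round_def le_floor_iff)
  then show ?thesis by (simp add: block_length_def)
qed

lemma block_length_le: "real (block_length n) \<le> ln (real n) + 1/2"
proof -
  have "round (ln (real n)) \<ge> 0" using block_length_pos by (simp add: block_length_def)
  then show ?thesis using of_int_round_le[of "ln (real n)"] by (simp add: block_length_def)
qed

lemma err_eq:
  assumes "k \<in> {1..2^j}"
  shows "err n f j k \<omega> = shrunk (threshold n) (\<Sum>i\<in>block n j (block_of n k). (obs n f j i \<omega>)\<^sup>2) (obs n f j k \<omega>) - wavelet_coeff f j k"
  using jn by (simp add: err_def block_js_coeff_def shrunk_def threshold_def block_energy_def)

lemma in_own_block:
  assumes "k \<in> {1..2^j}"
  shows "k \<in> block n j (block_of n k)"
  using assms block_eq[OF block_length_pos, of "block_of n k" j] by (simp add: block_of_def)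

lemma block_subset: "block n j b \<subseteq> {1..2^j}"
  by (auto simp: block_def)

lemma err_measurable:
  assumes "k \<in> {1..2^j}"
  shows "err n f j k \<in> borel_measurable P"
proof -
  have [measurable]: "obs n f j i \<in> borel_measurable P" if "i \<in> block n j (block_of n k)" for i
    by (rule obs_measurable[OF j subsetD[OF block_subset that]])
  have [measurable]: "obs n f j k \<in> borel_measurable P" by (intro obs_measurable j assms)
  show ?thesis unfolding err_eq[OF assms, abs_def] shrunk_def by measurable
qed

text \<open>
  Used for levels where the signal is already below the threshold but not yet negligible in a whole block.
\<close>

lemma err_mean_square_trivial:
  assumes k: "k \<in> {1..2^j}"
  shows "mean_square P (err n f j k) \<le> ennreal (2 * (wavelet_coeff f j k)\<^sup>2 + 16 / real n)"
proof -
  let ?\<theta> = "wavelet_coeff f j k"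
  have "mean_square P (err n f j k) \<le> mean_square P (\<lambda>\<omega>. \<bar>?\<theta>\<bar> + \<bar>noise n f j k \<omega> / sqrt (real n)\<bar>)"
  proof (rule mean_square_mono)
    fix \<omega>
    have "\<bar>err n f j k \<omega>\<bar> \<le> \<bar>?\<theta>\<bar> + \<bar>obs n f j k \<omega> - ?\<theta>\<bar>"
      unfolding err_eq[OF k] using threshold_pos by (intro shrunk_error_trivial sum_nonneg) auto
    then show "\<bar>err n f j k \<omega>\<bar> \<le> \<bar>\<bar>?\<theta>\<bar> + \<bar>noise n f j k \<omega> / sqrt (real n)\<bar>\<bar>" unfolding obs_eq by linarith
  qed
  also have "\<dots> \<le> ennreal (2 * ?\<theta>\<^sup>2 + 2 * (8 / real n))"
  proof (rule mean_square_add_le)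
    show "(\<lambda>\<omega>. \<bar>noise n f j k \<omega> / sqrt (real n)\<bar>) \<in> borel_measurable P"
      using noise_measurable[OF j k] by measurable
    have "mean_square P (\<lambda>\<omega>. \<bar>noise n f j k \<omega> / sqrt (real n)\<bar>) = (\<integral>\<^sup>+\<omega>. ennreal (1 / real n) * ennreal ((noise n f j k \<omega>)\<^sup>2) \<partial>P)"
      unfolding mean_square_def by (intro nn_integral_cong) (simp add: ennreal_mult[symmetric] power_divide)
    also have "\<dots> = ennreal (1 / real n) * mean_square P (noise n f j k)"
      unfolding mean_square_def using noise_measurable[OF j k] by (intro nn_integral_cmult) measurable
    also have "\<dots> \<le> ennreal (1 / real n) * ennreal 8" by (intro mult_left_mono noise_mean_square j k) simp
    also have "\<dots> = ennreal (8 / real n)" by (subst ennreal_mult[symmetric]) auto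
    finally show "mean_square P (\<lambda>\<omega>. \<bar>noise n f j k \<omega> / sqrt (real n)\<bar>) \<le> ennreal (8 / real n)" .
  qed (auto simp: mean_square_def emeasure_space_1)
  finally show ?thesis by simp
qed

text \<open>
  The cost of estimating the coefficients in $A$ is of order $1/n$ for each coefficient and of order $\tau$ for each block that $A$ meets.
\<close>

lemma err_sum_mean_square:
  assumes A: "A \<subseteq> {1..2^j}"
  shows "(\<Sum>k\<in>A. mean_square P (err n f j k)) \<le> ennreal (16 * real (card A) / real n + 2 * real (card (block_of n ` A)) * threshold n)"
proof -
  have finA: "finite A" using A finite_subset by blast
  let ?S = "\<lambda>b \<omega>. \<Sum>i\<in>block n j b. (obs n f j i \<omega>)\<^sup>2"
  let ?w = "\<lambda>k \<omega>. (obs n f j k \<omega>)\<^sup>2 * min 1 (threshold n / ?S (block_of n k) \<omega>)"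
  let ?m = "real (card (block_of n ` A))"
  have w0: "?w k \<omega> \<ge> 0" for k \<omega>
  proof -
    have "?S (block_of n k) \<omega> \<ge> 0" by (intro sum_nonneg) auto
    then show ?thesis using threshold_pos by (intro mult_nonneg_nonneg) auto
  qed
  have wsum: "(\<Sum>k\<in>A. ?w k \<omega>) \<le> ?m * threshold n" for \<omega>
  proof -
    have "(\<Sum>k\<in>A. ?w k \<omega>) = (\<Sum>b\<in>block_of n ` A. \<Sum>k\<in>{k\<in>A. block_of n k = b}. ?w k \<omega>)"
      by (rule sum.image_gen[OF finA])
    also have "\<dots> \<le> (\<Sum>b\<in>block_of n ` A. threshold n)"
    proof (rule sum_mono)
      fix b assume "b \<in> block_of n ` A"
      then have b: "b \<ge> 1" by (auto simp: block_of_def)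
      have "(\<Sum>k\<in>{k\<in>A. block_of n k = b}. ?w k \<omega>) \<le> (\<Sum>k\<in>block n j b. ?w k \<omega>)"
      proof (rule sum_mono2)
        show "{k\<in>A. block_of n k = b} \<subseteq> block n j b" unfolding block_eq[OF block_length_pos b] using A by auto
      qed (simp, rule w0)
      also have "\<dots> = (\<Sum>k\<in>block n j b. (obs n f j k \<omega>)\<^sup>2 * min 1 (threshold n / ?S b \<omega>))"
        using block_eq[OF block_length_pos b] by (intro sum.cong) auto
      also have "\<dots> \<le> threshold n" by (rule shrinkage_weights_sum[OF threshold_pos])
      finally show "(\<Sum>k\<in>{k\<in>A. block_of n k = b}. ?w k \<omega>) \<le> threshold n" .
    qed
    finally show ?thesis by simp
  qed
  have Vm: "noise n f j k \<in> borel_measurable P" if "k \<in> A" for k using that A by (intro noise_measurable j) auto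
  have em: "(\<lambda>\<omega>. ennreal ((err n f j k \<omega>)\<^sup>2)) \<in> borel_measurable P" if "k \<in> A" for k
  proof -
    have [measurable]: "err n f j k \<in> borel_measurable P" using that A by (intro err_measurable) auto
    show ?thesis by measurable
  qed
  have vm: "(\<lambda>\<omega>. ennreal (2 / real n) * ennreal ((noise n f j k \<omega>)\<^sup>2)) \<in> borel_measurable P" if "k \<in> A" for k
    using Vm[OF that] by measurable
  have "(\<Sum>k\<in>A. mean_square P (err n f j k)) = (\<integral>\<^sup>+\<omega>. (\<Sum>k\<in>A. ennreal ((err n f j k \<omega>)\<^sup>2)) \<partial>P)"
    unfolding mean_square_def by (subst nn_integral_sum, erule em, rule refl)
  also have "\<dots> \<le> (\<integral>\<^sup>+\<omega>. (\<Sum>k\<in>A. ennreal (2 / real n) * ennreal ((noise n f j k \<omega>)\<^sup>2)) + ennreal (2 * (?m * threshold n)) \<partial>P)"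
  proof (intro nn_integral_mono)
    fix \<omega>
    have "(\<Sum>k\<in>A. (err n f j k \<omega>)\<^sup>2) \<le> (\<Sum>k\<in>A. 2 / real n * (noise n f j k \<omega>)\<^sup>2 + 2 * ?w k \<omega>)"
    proof (rule sum_mono)
      fix k assume "k \<in> A"
      then have k: "k \<in> {1..2^j}" using A by auto
      have "(err n f j k \<omega>)\<^sup>2 \<le> 2 * (obs n f j k \<omega> - wavelet_coeff f j k)\<^sup>2 + 2 * ?w k \<omega>"
        unfolding err_eq[OF k]
      proof (rule shrunk_error_large[OF threshold_pos])
        show "?S (block_of n k) \<omega> \<ge> 0" by (intro sum_nonneg) auto
        show "obs n f j k \<omega> = 0" if "?S (block_of n k) \<omega> = 0"
        proof -
          have "\<forall>i\<in>block n j (block_of n k). (obs n f j i \<omega>)\<^sup>2 = 0"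
            using that by (subst (asm) sum_nonneg_eq_0_iff) auto
          then show ?thesis using in_own_block[OF k] by simp
        qed
      qed
      then show "(err n f j k \<omega>)\<^sup>2 \<le> 2 / real n * (noise n f j k \<omega>)\<^sup>2 + 2 * ?w k \<omega>"
        unfolding obs_eq by (simp add: power_divide)
    qed
    also have "\<dots> = (\<Sum>k\<in>A. 2 / real n * (noise n f j k \<omega>)\<^sup>2) + 2 * (\<Sum>k\<in>A. ?w k \<omega>)"
      by (simp add: sum.distrib sum_distrib_left)
    also have "\<dots> \<le> (\<Sum>k\<in>A. 2 / real n * (noise n f j k \<omega>)\<^sup>2) + 2 * (?m * threshold n)"
      using wsum[of \<omega>] by simp
    finally have "ennreal (\<Sum>k\<in>A. (err n f j k \<omega>)\<^sup>2) \<le> ennreal ((\<Sum>k\<in>A. 2 / real n * (noise n f j k \<omega>)\<^sup>2) + 2 * (?m * threshold n))"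
      by (rule ennreal_leI)
    also have "\<dots> = ennreal (\<Sum>k\<in>A. 2 / real n * (noise n f j k \<omega>)\<^sup>2) + ennreal (2 * (?m * threshold n))"
      using threshold_pos by (intro ennreal_plus sum_nonneg) auto
    also have "ennreal (\<Sum>k\<in>A. 2 / real n * (noise n f j k \<omega>)\<^sup>2) = (\<Sum>k\<in>A. ennreal (2 / real n) * ennreal ((noise n f j k \<omega>)\<^sup>2))"
    proof -
      have "ennreal (\<Sum>k\<in>A. 2 / real n * (noise n f j k \<omega>)\<^sup>2) = (\<Sum>k\<in>A. ennreal (2 / real n * (noise n f j k \<omega>)\<^sup>2))"
        by (rule sum_ennreal[symmetric]) simp
      also have "\<dots> = (\<Sum>k\<in>A. ennreal (2 / real n) * ennreal ((noise n f j k \<omega>)\<^sup>2))"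
        by (intro sum.cong refl ennreal_mult) auto
      finally show ?thesis .
    qed
    finally show "(\<Sum>k\<in>A. ennreal ((err n f j k \<omega>)\<^sup>2)) \<le> (\<Sum>k\<in>A. ennreal (2 / real n) * ennreal ((noise n f j k \<omega>)\<^sup>2)) + ennreal (2 * (?m * threshold n))"
      by simp
  qed
  also have "\<dots> = (\<Sum>k\<in>A. \<integral>\<^sup>+\<omega>. ennreal (2 / real n) * ennreal ((noise n f j k \<omega>)\<^sup>2) \<partial>P) + ennreal (2 * (?m * threshold n))"
    by (subst nn_integral_add, rule borel_measurable_sum, erule vm, simp, subst nn_integral_sum, erule vm)
      (simp add: emeasure_space_1)
  also have "\<dots> \<le> (\<Sum>k\<in>A. ennreal (16 / real n)) + ennreal (2 * (?m * threshold n))"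
  proof (intro add_mono sum_mono order_refl)
    fix k assume k: "k \<in> A"
    have "(\<integral>\<^sup>+\<omega>. ennreal (2 / real n) * ennreal ((noise n f j k \<omega>)\<^sup>2) \<partial>P) = ennreal (2 / real n) * mean_square P (noise n f j k)"
      unfolding mean_square_def using Vm[OF k] by (intro nn_integral_cmult) measurable
    also have "\<dots> \<le> ennreal (2 / real n) * ennreal 8" using k A by (intro mult_left_mono noise_mean_square j) auto
    also have "\<dots> = ennreal (16 / real n)" by (subst ennreal_mult[symmetric]) auto
    finally show "(\<integral>\<^sup>+\<omega>. ennreal (2 / real n) * ennreal ((noise n f j k \<omega>)\<^sup>2) \<partial>P) \<le> ennreal (16 / real n)" .
  qed
  also have "(\<Sum>k\<in>A. ennreal (16 / real n)) = ennreal (16 * real (card A) / real n)"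
    by (subst sum_ennreal) (auto simp: field_simps)
  also have "ennreal (16 * real (card A) / real n) + ennreal (2 * (?m * threshold n)) = ennreal (16 * real (card A) / real n + 2 * ?m * threshold n)"
    using threshold_pos by (subst ennreal_plus[symmetric]) (auto simp: mult.assoc)
  finally show ?thesis .
qed

text \<open>
  When the signal is small in every block of the level, noise can do harm only if its energy passes the threshold.
\<close>

lemma err_mean_square_small_signal:
  assumes k: "k \<in> {1..2^j}"
    and e: "0 < e" "e < 1" "2 * e < 1 / lambda_star"
      "- (lambda_star - 1) / 2 * (1 - e)\<^sup>2 - ln (1 / lambda_star - 2 * e) / 2 \<le> - 1 + \<delta>"
    and t: "\<And>i. i \<in> {1..2^j} \<Longrightarrow> \<bar>wavelet_coeff f j i\<bar> \<le> t"
    and small: "(ln (real n) + 1/2) * t\<^sup>2 \<le> e\<^sup>2 * threshold n"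
  shows "mean_square P (err n f j k) \<le> ennreal (2 * t\<^sup>2 + 2 * (1 / e * (1 / lambda_star - 2 * e) powr (- 1 / 4)) * real n powr (- 2 + \<delta>))"
proof -
  let ?K = "block n j (block_of n k)"
  let ?X = "\<lambda>\<omega>. \<Sum>i\<in>?K. (noise n f j i \<omega>)\<^sup>2"
  let ?T = "(1 - e)\<^sup>2 * (lambda_star * ln (real n))"
  let ?c = "1 / e * (1 / lambda_star - 2 * e) powr (- 1 / 4)"
  have t0: "t \<ge> 0" using t[OF k] by linarith
  have Vm[measurable]: "noise n f j i \<in> borel_measurable P" if "i \<in> ?K" for i
    by (rule noise_measurable[OF j subsetD[OF block_subset that]])
  have card: "real (card ?K) \<le> ln (real n) + 1/2"
    using card_block_le[of n j "block_of n k"] block_length_le by linarith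
  have small': "(\<Sum>i\<in>?K. (wavelet_coeff f j i)\<^sup>2) \<le> e\<^sup>2 * threshold n"
  proof -
    have "(\<Sum>i\<in>?K. (wavelet_coeff f j i)\<^sup>2) \<le> (\<Sum>i\<in>?K. t\<^sup>2)"
    proof (rule sum_mono)
      fix i assume "i \<in> ?K"
      then have "\<bar>wavelet_coeff f j i\<bar> \<le> \<bar>t\<bar>" using t[OF subsetD[OF block_subset]] t0 by auto
      then show "(wavelet_coeff f j i)\<^sup>2 \<le> t\<^sup>2" by (simp only: abs_le_square_iff)
    qed
    also have "\<dots> \<le> (ln (real n) + 1/2) * t\<^sup>2" using card by (simp add: mult_right_mono)
    finally show ?thesis using small by linarith
  qed
  have le: "(err n f j k \<omega>)\<^sup>2 \<le> 2 * t\<^sup>2 + 2 / real n * (?X \<omega> * of_bool (?X \<omega> > ?T))" for \<omega>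
  proof -
    have Z: "(\<Sum>i\<in>?K. (obs n f j i \<omega> - wavelet_coeff f j i)\<^sup>2) = ?X \<omega> / real n"
      unfolding obs_eq by (simp add: power_divide sum_divide_distrib)
    have iff: "(1 - e)\<^sup>2 * threshold n < ?X \<omega> / real n \<longleftrightarrow> ?T < ?X \<omega>"
      using n by (simp add: threshold_def field_simps)
    have "(err n f j k \<omega>)\<^sup>2 \<le> 2 * (wavelet_coeff f j k)\<^sup>2 + 2 * (?X \<omega> / real n * of_bool (?X \<omega> / real n > (1 - e)\<^sup>2 * threshold n))"
      unfolding err_eq[OF k] Z[symmetric]
      by (rule shrunk_error_small_signal[OF finite_block in_own_block[OF k] threshold_pos _ _ small']) (use e in auto)
    also have "\<dots> \<le> 2 * t\<^sup>2 + 2 * (?X \<omega> / real n * of_bool (?X \<omega> / real n > (1 - e)\<^sup>2 * threshold n))"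
    proof -
      have "\<bar>wavelet_coeff f j k\<bar> \<le> \<bar>t\<bar>" using t[OF k] t0 by auto
      then have "(wavelet_coeff f j k)\<^sup>2 \<le> t\<^sup>2" by (simp only: abs_le_square_iff)
      then show ?thesis by simp
    qed
    finally show ?thesis unfolding iff by simp
  qed
  have Xm[measurable]: "?X \<in> borel_measurable P" by measurable
  have X0: "?X \<omega> \<ge> 0" for \<omega> by (intro sum_nonneg) auto
  have "mean_square P (err n f j k) \<le> (\<integral>\<^sup>+\<omega>. ennreal (2 * t\<^sup>2) + ennreal (2 / real n) * ennreal (?X \<omega> * of_bool (?X \<omega> > ?T)) \<partial>P)"
    unfolding mean_square_def
  proof (intro nn_integral_mono)
    fix \<omega>
    have "ennreal ((err n f j k \<omega>)\<^sup>2) \<le> ennreal (2 * t\<^sup>2 + 2 / real n * (?X \<omega> * of_bool (?X \<omega> > ?T)))"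
      by (rule ennreal_leI[OF le])
    also have "\<dots> = ennreal (2 * t\<^sup>2) + ennreal (2 / real n) * ennreal (?X \<omega> * of_bool (?X \<omega> > ?T))"
      using X0[of \<omega>] by (subst ennreal_mult[symmetric]) (auto intro!: ennreal_plus)
    finally show "ennreal ((err n f j k \<omega>)\<^sup>2) \<le> ennreal (2 * t\<^sup>2) + ennreal (2 / real n) * ennreal (?X \<omega> * of_bool (?X \<omega> > ?T))" .
  qed
  also have "\<dots> = ennreal (2 * t\<^sup>2) + ennreal (2 / real n) * (\<integral>\<^sup>+\<omega>. ennreal (?X \<omega> * of_bool (?X \<omega> > ?T)) \<partial>P)"
    by (subst nn_integral_add) (simp_all add: nn_integral_cmult emeasure_space_1)
  also have "\<dots> \<le> ennreal (2 * t\<^sup>2) + ennreal (2 / real n) * ennreal (?c * real n powr (- 1 + \<delta>))"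
    by (intro add_mono mult_left_mono order_refl chi_square_tail[OF prob_space_axioms finite_block Vm _ e n2 card]
        noise_exp_moment[OF j block_subset]) auto
  also have "\<dots> = ennreal (2 * t\<^sup>2 + 2 / real n * (?c * real n powr (- 1 + \<delta>)))"
    using e by (subst ennreal_mult[symmetric]) (auto simp: ennreal_plus[symmetric] simp del: ennreal_plus)
  also have "2 / real n * (?c * real n powr (- 1 + \<delta>)) = 2 * ?c * real n powr (- 2 + \<delta>)"
  proof -
    have "- 2 + \<delta> = (- 1 + \<delta>) + - 1" by simp
    then have "real n powr (- 2 + \<delta>) = real n powr (- 1 + \<delta>) * real n powr (- 1)" by (simp only: powr_add)
    then show ?thesis using n by (simp add: powr_minus_divide)
  qed
  finally show ?thesis .
qed

end

end

end

section \<open>Uniform error bounds over the Hoelder class\<close>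

locale holder_estimation = noisy_wavelets "\<phi>I j0" \<psi> r j0 R C P B
  for \<phi>I :: "nat \<Rightarrow> nat \<Rightarrow> real \<Rightarrow> real" and \<psi> r j0 R C and P :: "'w measure" and B +
  fixes \<alpha> M :: real
  assumes \<alpha>: "\<alpha> > 0" and M: "M > 0" and r: "real r > \<alpha>"
begin

text \<open>
  With $s = 1/(1+2\alpha)$ the minimax rate is $n^{-2 \alpha s}$, and $2^j \approx n^s$ is the resolution at which the noise and the
  coefficients of a function in the Hoelder class have the same size.
\<close>

definition s where "s = 1 / (1 + 2 * \<alpha>)"

lemma s_props: "0 < s" "s < 1" "1 - s = 2 * (\<alpha> * s)" "\<alpha> * s < 1/2" "0 < \<alpha> * s" "\<alpha> * s \<le> \<alpha>" "(1 + 2 * \<alpha>) * s = 1"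
  using \<alpha> by (auto simp: s_def field_simps)

text \<open>
  The constant in the bound $K 2^{-j(\alpha+1/2)}$ for the wavelet coefficients.
\<close>

definition K where "K = 2 * R * M * R powr \<alpha> * C"

lemma K_nonneg: "K \<ge> 0" using R M C by (simp add: K_def)

definition levels :: "nat \<Rightarrow> nat set" where
  "levels n = {j0..<max j0 (nat \<lfloor>log 2 (real n)\<rfloor>)}"

lemma finite_levels [simp]: "finite (levels n)" by (simp add: levels_def)

lemma levelsD:
  assumes "j \<in> levels n" "n \<ge> 1"
  shows "j \<ge> j0" "int j < \<lfloor>log 2 (real n)\<rfloor>" "2 ^ j \<le> real n"
proof -
  show "j \<ge> j0" and 1: "int j < \<lfloor>log 2 (real n)\<rfloor>" using assms(1) by (auto simp: levels_def)
  then have "real j \<le> log 2 (real n)" by linarith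
  then have "2 powr real j \<le> real n" using assms(2) by (simp add: le_log_iff)
  then show "2 ^ j \<le> real n" by (simp add: powr_realpow)
qed

lemma ln_ge_1: "n \<ge> 3 \<Longrightarrow> ln (real n) \<ge> 1"
  using ln_ge_iff[of "real n" 1] exp_le by simp

text \<open>
  The three bounds for the coefficient errors, with constants that are uniform over the Hoelder class.  The first is the best one on coarse levels, the second
  on intermediate levels, and the third beyond $2^j \approx n^{1/(1+2\alpha)}$, where the noise is negligible.
\<close>

definition coeff_error_bounds :: "real \<Rightarrow> real \<Rightarrow> bool" where
  "coeff_error_bounds A \<kappa> \<longleftrightarrow> A > 0 \<and> \<kappa> \<ge> 1 \<and>
    (\<forall>n\<ge>3. \<forall>f\<in>holder_class \<alpha> M. \<forall>j\<in>levels n. \<forall>k\<in>{1..2^j}.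
      mean_square P (err n f j k) \<le> ennreal (A * (ln (real n) / real n)) \<and>
      mean_square P (err n f j k) \<le> ennreal (A * (2 powr (- (1 + 2 * \<alpha>) * real j) + 1 / real n)) \<and>
      (2 ^ j > (\<kappa> * real n) powr s \<longrightarrow>
        mean_square P (err n f j k) \<le> ennreal (A * (2 powr (- (1 + 2 * \<alpha>) * real j) + real n powr (- 2 + s)))))"

lemma coeff_error_boundsD:
  assumes "coeff_error_bounds A \<kappa>"
  shows "A > 0" "\<kappa> \<ge> 1"
    and "n \<ge> 3 \<Longrightarrow> f \<in> holder_class \<alpha> M \<Longrightarrow> j \<in> levels n \<Longrightarrow> k \<in> {1..2^j} \<Longrightarrow>
      mean_square P (err n f j k) \<le> ennreal (A * (ln (real n) / real n))"
    and "n \<ge> 3 \<Longrightarrow> f \<in> holder_class \<alpha> M \<Longrightarrow> j \<in> levels n \<Longrightarrow> k \<in> {1..2^j} \<Longrightarrow>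
      mean_square P (err n f j k) \<le> ennreal (A * (2 powr (- (1 + 2 * \<alpha>) * real j) + 1 / real n))"
    and "n \<ge> 3 \<Longrightarrow> f \<in> holder_class \<alpha> M \<Longrightarrow> j \<in> levels n \<Longrightarrow> k \<in> {1..2^j} \<Longrightarrow> (\<kappa> * real n) powr s < 2 ^ j \<Longrightarrow>
      mean_square P (err n f j k) \<le> ennreal (A * (2 powr (- (1 + 2 * \<alpha>) * real j) + real n powr (- 2 + s)))"
  using assms unfolding coeff_error_bounds_def by blast+

text \<open>
  Beyond the resolution $(\kappa n)^{1/(1+2\alpha)}$ the bound $K 2^{-j(\alpha+1/2)}$ makes the energy of a block smaller than $e^2 \tau$; this determines $\kappa$.
  The loss $\delta = 1/(1+2\alpha)$ in the tail bound is what the sum over the levels $2^j \le n$ can afford.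
\<close>

lemma coeff_error_bounds_exist: "\<exists>A \<kappa>. coeff_error_bounds A \<kappa>"
proof -
  obtain e where e: "0 < e" "e < 1" "2 * e < 1 / lambda_star"
    "- (lambda_star - 1) / 2 * (1 - e)\<^sup>2 - ln (1 / lambda_star - 2 * e) / 2 \<le> - 1 + s"
    using tail_exponent[OF s_props(1)] .
  note l = lambda_star(1)
  define ce where "ce = 1 / e * (1 / lambda_star - 2 * e) powr (- 1 / 4)"
  have ce: "ce \<ge> 0" using e by (simp add: ce_def)
  define A where "A = 16 + 2 * lambda_star + 2 * K\<^sup>2 + 2 * ce"
  define \<kappa> where "\<kappa> = 1 + 2 * K\<^sup>2 / (e\<^sup>2 * lambda_star)"
  have A: "A > 0" "16 + 2 * lambda_star \<le> A" "2 * K\<^sup>2 \<le> A" "16 \<le> A" "2 * ce \<le> A"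
    using l ce by (auto simp: A_def add_pos_nonneg)
  have el: "e\<^sup>2 * lambda_star > 0" using e l by simp
  then have \<kappa>: "\<kappa> \<ge> 1" by (simp add: \<kappa>_def)
  have coef: "\<bar>wavelet_coeff f j k\<bar> \<le> K * 2 powr (- (\<alpha> + 1/2) * real j)"
    if "f \<in> holder_class \<alpha> M" "j \<ge> j0" "k \<in> {1..2^j}" for f j k
    using wavelet_coeff_bound[OF that(1) \<alpha> M r that(2,3)] by (simp add: K_def)
  have sq: "(K * 2 powr (- (\<alpha> + 1/2) * real j))\<^sup>2 = K\<^sup>2 * 2 powr (- (1 + 2 * \<alpha>) * real j)" for j
  proof -
    have "(- (\<alpha> + 1/2) * real j) + (- (\<alpha> + 1/2) * real j) = - (1 + 2 * \<alpha>) * real j" by (simp add: field_simps)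
    then show ?thesis by (simp only: power_mult_distrib power2_eq_square[of "2 powr _"] powr_add[symmetric])
  qed
  show ?thesis unfolding coeff_error_bounds_def
  proof (rule exI[of _ A], rule exI[of _ \<kappa>], intro conjI[OF A(1)] conjI[OF \<kappa>] ballI allI impI)
    fix n :: nat and f :: "real \<Rightarrow> real" and j k :: nat
    assume n3: "n \<ge> 3" and f: "f \<in> holder_class \<alpha> M" and j: "j \<in> levels n" and k: "k \<in> {1..2^j}"
    then have n: "n \<ge> 1" "n \<ge> 2" by auto
    note jj = levelsD(1,2)[OF j n(1)]
    note cf = holder_class_continuous[OF f \<alpha> M]
    note L1 = ln_ge_1[OF n3]
    have "(\<Sum>i\<in>{k}. mean_square P (err n f j i)) \<le> ennreal (16 * real (card {k}) / real n + 2 * real (card (block_of n ` {k})) * threshold n)"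
      by (rule err_sum_mean_square[OF n(1) cf jj n(2)]) (use k in simp)
    then have "mean_square P (err n f j k) \<le> ennreal (16 / real n + 2 * threshold n)" by simp
    also have "16 / real n + 2 * threshold n \<le> A * (ln (real n) / real n)"
    proof -
      have "16 / real n + 2 * threshold n \<le> (16 + 2 * lambda_star) * (ln (real n) / real n)"
        using L1 n by (simp add: threshold_def field_simps)
      also have "\<dots> \<le> A * (ln (real n) / real n)" using A(2) L1 by (intro mult_right_mono) auto
      finally show ?thesis .
    qed
    finally have h1: "mean_square P (err n f j k) \<le> ennreal (A * (ln (real n) / real n))" by (simp add: ennreal_leI)
    let ?u = "2 powr (- (1 + 2 * \<alpha>) * real j)"
    have "(wavelet_coeff f j k)\<^sup>2 \<le> (K * 2 powr (- (\<alpha> + 1/2) * real j))\<^sup>2"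
      using coef[OF f jj(1) k] K_nonneg by (simp add: abs_le_square_iff[symmetric])
    then have \<theta>2: "(wavelet_coeff f j k)\<^sup>2 \<le> K\<^sup>2 * ?u" by (simp only: sq)
    have h2: "mean_square P (err n f j k) \<le> ennreal (A * (?u + 1 / real n))"
    proof (rule order_trans[OF err_mean_square_trivial[OF n(1) cf jj n(2) k] ennreal_leI])
      have "2 * (wavelet_coeff f j k)\<^sup>2 \<le> 2 * K\<^sup>2 * ?u" using \<theta>2 by simp
      also have "\<dots> \<le> A * ?u" using A(3) by (intro mult_right_mono) auto
      finally have "2 * (wavelet_coeff f j k)\<^sup>2 \<le> A * ?u" .
      moreover have "16 / real n \<le> A * (1 / real n)" using A(4) by (simp add: divide_right_mono)
      ultimately show "2 * (wavelet_coeff f j k)\<^sup>2 + 16 / real n \<le> A * (?u + 1 / real n)" by (simp add: distrib_left)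
    qed
    have h3: "mean_square P (err n f j k) \<le> ennreal (A * (?u + real n powr (- 2 + s)))"
      if big: "2 ^ j > (\<kappa> * real n) powr s"
    proof -
    have small: "(ln (real n) + 1/2) * (K * 2 powr (- (\<alpha> + 1/2) * real j))\<^sup>2 \<le> e\<^sup>2 * threshold n"
    proof -
      have "((\<kappa> * real n) powr s) powr (1 + 2 * \<alpha>) < (2 ^ j) powr (1 + 2 * \<alpha>)"
        using big \<alpha> by (intro powr_less_mono2) auto
      then have "\<kappa> * real n < 2 powr ((1 + 2 * \<alpha>) * real j)"
        using s_props(7) \<kappa> n by (simp add: powr_powr mult.commute powr_realpow[symmetric])
      then have "\<kappa> * real n * ?u < 2 powr ((1 + 2 * \<alpha>) * real j) * ?u" by (intro mult_strict_right_mono) auto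
      also have "\<dots> = 1"
      proof -
        have "(1 + 2 * \<alpha>) * real j + - (1 + 2 * \<alpha>) * real j = 0" by (simp add: algebra_simps)
        then show ?thesis by (simp only: powr_add[symmetric]) simp
      qed
      finally have 1: "\<kappa> * (real n * ?u) < 1" by (simp add: mult.assoc)
      have "q * (1 + y / q) = q + y" if "q > 0" for q y :: real using that by (simp add: distrib_left)
      from this[OF el, of "2 * K\<^sup>2"] have "2 * K\<^sup>2 \<le> e\<^sup>2 * lambda_star * \<kappa>"
        using el unfolding \<kappa>_def by linarith
      then have "2 * K\<^sup>2 * (real n * ?u) \<le> e\<^sup>2 * lambda_star * \<kappa> * (real n * ?u)" by (rule mult_right_mono) simp
      also have "\<dots> = e\<^sup>2 * lambda_star * (\<kappa> * (real n * ?u))" by (simp only: mult.assoc)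
      also have "\<dots> \<le> e\<^sup>2 * lambda_star * 1" using 1 el by (intro mult_left_mono) auto
      finally have 2: "2 * K\<^sup>2 * (real n * ?u) \<le> e\<^sup>2 * lambda_star" by simp
      have "(ln (real n) + 1/2) * (K\<^sup>2 * ?u) \<le> (2 * ln (real n)) * (K\<^sup>2 * ?u)" using L1 by (intro mult_right_mono) auto
      also have "\<dots> = ln (real n) / real n * (2 * K\<^sup>2 * (real n * ?u))" using n by (simp add: field_simps)
      also have "\<dots> \<le> ln (real n) / real n * (e\<^sup>2 * lambda_star)" using 2 L1 by (intro mult_left_mono) auto
      finally show ?thesis unfolding sq by (simp add: threshold_def ac_simps)
    qed
    have "mean_square P (err n f j k) \<le> ennreal (2 * (K * 2 powr (- (\<alpha> + 1/2) * real j))\<^sup>2 + 2 * ce * real n powr (- 2 + s))"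
      unfolding ce_def by (rule err_mean_square_small_signal[OF n(1) cf jj n(2) k e coef[OF f jj(1)] small])
    also have "\<dots> \<le> ennreal (A * (?u + real n powr (- 2 + s)))"
    proof (rule ennreal_leI)
      have "2 * K\<^sup>2 * ?u \<le> A * ?u" using A(3) by (intro mult_right_mono) auto
      moreover have "2 * ce * real n powr (- 2 + s) \<le> A * real n powr (- 2 + s)" using A(5) by (intro mult_right_mono) auto
      ultimately show "2 * (K * 2 powr (- (\<alpha> + 1/2) * real j))\<^sup>2 + 2 * ce * real n powr (- 2 + s) \<le> A * (?u + real n powr (- 2 + s))"
        unfolding sq distrib_left mult.assoc by linarith
    qed
    finally show ?thesis .
    qed
    show "mean_square P (err n f j k) \<le> ennreal (A * (ln (real n) / real n)) \<and>
      mean_square P (err n f j k) \<le> ennreal (A * (?u + 1 / real n)) \<and>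
      (2 ^ j > (\<kappa> * real n) powr s \<longrightarrow> mean_square P (err n f j k) \<le> ennreal (A * (?u + real n powr (- 2 + s))))"
      using h1 h2 h3 by blast
  qed
qed

text \<open>
  With all levels in $T$ this is the error of the estimator at $x$ (\<open>block_js_error\<close>); with the coarse levels it is the part of the error that is
  bounded point by point when the risk over an interval is estimated.
\<close>

definition error_part :: "nat set \<Rightarrow> nat \<Rightarrow> (real \<Rightarrow> real) \<Rightarrow> real \<Rightarrow> 'w \<Rightarrow> real" where
  "error_part T n f x \<omega> = (\<Sum>k=1..2^j0. (obs0 n f k \<omega> - scaling_coeff f k) * \<phi>I j0 k x) +
     (\<Sum>j\<in>T. \<Sum>k=1..2^j. err n f j k \<omega> * \<psi> j k x) +
     (partial_expansion (max j0 (nat \<lfloor>log 2 (real n)\<rfloor>)) f x - f x)"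

lemma block_js_error:
  assumes n: "n \<ge> 1"
  shows "block_js P \<phi>I \<psi> j0 n (observation B n f) \<omega> x - f x = error_part (levels n) n f x \<omega>"
proof -
  let ?J = "max j0 (nat \<lfloor>log 2 (real n)\<rfloor>)"
  let ?c = "\<lambda>j k. block_js_coeff n (\<lambda>j k. obs n f j k \<omega>) j k"
  have "(\<Sum>i. \<Sum>k=1..2^(j0 + i). ?c (j0 + i) k * \<psi> (j0 + i) k x)
    = (\<Sum>i\<in>{..<?J - j0}. \<Sum>k=1..2^(j0 + i). ?c (j0 + i) k * \<psi> (j0 + i) k x)"
  proof (rule suminf_finite)
    fix i assume "i \<notin> {..<?J - j0}"
    then have "\<not> int (j0 + i) < \<lfloor>log 2 (real n)\<rfloor>" by auto
    then show "(\<Sum>k=1..2^(j0 + i). ?c (j0 + i) k * \<psi> (j0 + i) k x) = 0" by (simp add: block_js_coeff_def)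
  qed simp
  also have "\<dots> = (\<Sum>j\<in>levels n. \<Sum>k=1..2^j. ?c j k * \<psi> j k x)"
    unfolding levels_def by (rule sum.reindex_bij_witness[of _ "\<lambda>j. j - j0" "\<lambda>i. j0 + i"]) auto
  finally have "block_js P \<phi>I \<psi> j0 n (observation B n f) \<omega> x
    = (\<Sum>k=1..2^j0. obs0 n f k \<omega> * \<phi>I j0 k x) + (\<Sum>j\<in>levels n. \<Sum>k=1..2^j. ?c j k * \<psi> j k x)"
    unfolding block_js_def obs_def obs0_def by simp
  then show ?thesis
    unfolding error_part_def partial_expansion_def err_def levels_def
    by (simp add: left_diff_distrib sum_subtractf)
qed

lemma error_part_measurable:
  assumes n: "n \<ge> 2" and f: "continuous_on {0..1} f" and T: "T \<subseteq> levels n"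
  shows "(\<lambda>(x, \<omega>). error_part T n f x \<omega>) \<in> borel_measurable (unit_lebesgue \<Otimes>\<^sub>M P)"
proof -
  have n1: "n \<ge> 1" using n by simp
  have s: "(\<lambda>z. a (snd z)) \<in> borel_measurable (unit_lebesgue \<Otimes>\<^sub>M P)" if "a \<in> borel_measurable P" for a :: "'w \<Rightarrow> real"
    using that by (rule measurable_compose[OF measurable_snd])
  have c: "(\<lambda>z. g (fst z)) \<in> borel_measurable (unit_lebesgue \<Otimes>\<^sub>M P)" if "continuous_on {0..1} g" for g :: "real \<Rightarrow> real"
    using continuous_on_unit_measurable[OF that] by (rule measurable_compose[OF measurable_fst])
  have e: "err n f j k \<in> borel_measurable P" "continuous_on {0..1} (\<psi> j k)" if "j \<in> T" "k \<in> {1..2^j}" for j k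
    using levelsD(1,2)[OF _ n1, of j] that T n1 n f
    by (auto intro!: err_measurable wavelet_continuous)
  show ?thesis
    unfolding error_part_def case_prod_beta'
    by (intro borel_measurable_add borel_measurable_diff borel_measurable_sum borel_measurable_times borel_measurable_const
        s c e obs0_measurable[OF n1 f] scaling_continuous partial_expansion_continuous f)
qed

lemma local_integral_swap:
  assumes n: "n \<ge> 2" and f: "continuous_on {0..1} f" and T: "T \<subseteq> levels n" and I: "{a..b} \<subseteq> {0..1}" "a \<le> b"
    and le: "\<And>x. x \<in> {0..1} \<Longrightarrow> mean_square P (error_part T n f x) \<le> ennreal D" and D: "D \<ge> 0"
  shows "(\<integral>\<^sup>+\<omega>. (\<integral>\<^sup>+x\<in>{a..b}. ennreal ((error_part T n f x \<omega>)\<^sup>2) \<partial>lborel) \<partial>P) \<le> ennreal ((b - a) * D)"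
proof -
  interpret U: prob_space unit_lebesgue by (rule prob_space_unit_lebesgue)
  interpret pair_sigma_finite unit_lebesgue P by unfold_locales
  note [measurable] = error_part_measurable[OF n f T, unfolded case_prod_beta']
  have i[measurable]: "(indicator {a..b} :: real \<Rightarrow> ennreal) \<in> borel_measurable unit_lebesgue"
    by (intro measurable_restrict_space1) simp
  have restr: "(\<integral>\<^sup>+x\<in>{a..b}. h x \<partial>lborel) = (\<integral>\<^sup>+x. h x * indicator {a..b} x \<partial>unit_lebesgue)" for h :: "real \<Rightarrow> ennreal"
    unfolding set_nn_integral_unit[symmetric] using I by (intro nn_integral_cong) (auto split: split_indicator)
  have "(\<integral>\<^sup>+\<omega>. (\<integral>\<^sup>+x\<in>{a..b}. ennreal ((error_part T n f x \<omega>)\<^sup>2) \<partial>lborel) \<partial>P)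
    = (\<integral>\<^sup>+x. (\<integral>\<^sup>+\<omega>. ennreal ((error_part T n f x \<omega>)\<^sup>2) * indicator {a..b} x \<partial>P) \<partial>unit_lebesgue)"
    unfolding restr
  proof (rule Fubini')
    have "(\<lambda>z. ennreal ((error_part T n f (fst z) (snd z))\<^sup>2) * indicator {a..b} (fst z)) \<in> borel_measurable (unit_lebesgue \<Otimes>\<^sub>M P)"
      by measurable
    then show "(\<lambda>(x, \<omega>). ennreal ((error_part T n f x \<omega>)\<^sup>2) * indicator {a..b} x) \<in> borel_measurable (unit_lebesgue \<Otimes>\<^sub>M P)"
      by (simp only: case_prod_beta')
  qed
  also have "\<dots> \<le> (\<integral>\<^sup>+x. ennreal D * indicator {a..b} x \<partial>unit_lebesgue)"
  proof (intro nn_integral_mono)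
    fix x assume "x \<in> space unit_lebesgue"
    then have x: "x \<in> {0..1}" by (simp add: space_restrict_space)
    show "(\<integral>\<^sup>+\<omega>. ennreal ((error_part T n f x \<omega>)\<^sup>2) * indicator {a..b} x \<partial>P) \<le> ennreal D * indicator {a..b} x"
      using le[OF x] by (simp add: mean_square_def split: split_indicator)
  qed
  also have "\<dots> = (\<integral>\<^sup>+x\<in>{a..b}. ennreal D \<partial>lborel)" by (rule restr[symmetric])
  also have "\<dots> = ennreal ((b - a) * D)"
    using I(2) D by (simp add: nn_integral_cmult_indicator ennreal_mult[symmetric] mult.commute)
  finally show ?thesis .
qed

text \<open>
  Constants for the scaling part, the levels and the bias; the factor 3 covers the bound $8 \le 3^2$ for the mean square of the noise.
\<close>

definition scaling_const where "scaling_const = (2 ^ j0 * (3 * C))\<^sup>2"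
definition level_const where "level_const = ((2 * R + 1) * C)\<^sup>2"
definition bias_const where "bias_const = (2 * R + 1) * C * (2 * R * M * R powr \<alpha> * C) / (1 - 2 powr (- \<alpha>))"
definition error_const where
  "error_const = 1 + 4 * scaling_const + 4 * level_const + 2 * (bias_const * 2 powr \<alpha>)\<^sup>2"

lemma error_const_pos: "error_const > 0"
  by (simp add: error_const_def scaling_const_def level_const_def add_pos_nonneg)

text \<open>
  Level $j$ enters with the weight $2^{j/2}$, the size of its wavelets; the root mean squares of the levels are added.
\<close>

lemma error_part_mean_square:
  assumes n: "n \<ge> 2" and f: "f \<in> holder_class \<alpha> M" and x: "x \<in> {0..1}" and T: "T \<subseteq> levels n"
    and g: "\<And>j. j \<in> T \<Longrightarrow> g j > 0"
    and ms: "\<And>j k. j \<in> T \<Longrightarrow> k \<in> {1..2^j} \<Longrightarrow> mean_square P (err n f j k) \<le> ennreal ((g j)\<^sup>2)"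
  shows "mean_square P (error_part T n f x)
    \<le> ennreal (error_const * (1 / real n + (\<Sum>j\<in>T. 2 powr (real j / 2) * g j)\<^sup>2 + real n powr (- 2 * \<alpha>)))"
proof -
  have c: "scaling_const \<ge> 0" "level_const \<ge> 0" by (auto simp: scaling_const_def level_const_def)
  have D: "4 * scaling_const \<le> error_const" "4 * level_const \<le> error_const"
    "2 * (bias_const * 2 powr \<alpha>)\<^sup>2 \<le> error_const"
    using c by (auto simp: error_const_def)
  have n1: "n \<ge> 1" using n by simp
  note cf = holder_class_continuous[OF f \<alpha> M]
  have finT: "finite T" using T finite_levels finite_subset by blast
  let ?Sc = "\<lambda>\<omega>. \<Sum>k=1..2^j0. (obs0 n f k \<omega> - scaling_coeff f k) * \<phi>I j0 k x"
  let ?W = "\<lambda>\<omega>. \<Sum>j\<in>T. \<Sum>k=1..2^j. err n f j k \<omega> * \<psi> j k x"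
  let ?b = "partial_expansion (max j0 (nat \<lfloor>log 2 (real n)\<rfloor>)) f x - f x"
  let ?G = "\<Sum>j\<in>T. 2 powr (real j / 2) * g j"
  have o0: "obs0 n f k \<in> borel_measurable P" if "k \<in> {1..2^j0}" for k by (rule obs0_measurable[OF n1 cf that])
  have em: "err n f j k \<in> borel_measurable P" if "j \<in> T" "k \<in> {1..2^j}" for j k
    using levelsD(1,2)[OF _ n1, of j] that T by (auto intro!: err_measurable n1 n cf)
  have Scm: "?Sc \<in> borel_measurable P"
    by (intro borel_measurable_sum borel_measurable_times borel_measurable_diff borel_measurable_const o0)
  have Wm: "?W \<in> borel_measurable P"
    by (intro borel_measurable_sum borel_measurable_times borel_measurable_const em)
  have "mean_square P ?Sc \<le> ennreal ((\<Sum>k\<in>{1..2^j0 :: nat}. 3 * C / sqrt (real n))\<^sup>2)"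
  proof (rule mean_square_sum_le)
    fix k :: nat assume k: "k \<in> {1..2^j0}"
    show "(\<lambda>\<omega>. (obs0 n f k \<omega> - scaling_coeff f k) * \<phi>I j0 k x) \<in> borel_measurable P"
      by (intro borel_measurable_times borel_measurable_diff borel_measurable_const o0 k)
    show "3 * C / sqrt (real n) > 0" using C n by simp
    have "mean_square P (\<lambda>\<omega>. (obs0 n f k \<omega> - scaling_coeff f k) * \<phi>I j0 k x)
      \<le> (\<integral>\<^sup>+\<omega>. ennreal (C\<^sup>2 / real n) * ennreal ((noise0 n f k \<omega>)\<^sup>2) \<partial>P)"
      unfolding mean_square_def
    proof (rule nn_integral_mono)
      fix \<omega>
      have "(obs0 n f k \<omega> - scaling_coeff f k) * \<phi>I j0 k x = noise0 n f k \<omega> / sqrt (real n) * \<phi>I j0 k x"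
        using n by (simp add: noise0_def)
      moreover have "(\<phi>I j0 k x)\<^sup>2 \<le> C\<^sup>2" using scaling_bound[OF k x] C by (simp add: abs_le_square_iff[symmetric])
      ultimately have "((obs0 n f k \<omega> - scaling_coeff f k) * \<phi>I j0 k x)\<^sup>2 \<le> C\<^sup>2 / real n * (noise0 n f k \<omega>)\<^sup>2"
        by (simp add: power_mult_distrib power_divide divide_right_mono mult_mono mult.commute)
      then show "ennreal (((obs0 n f k \<omega> - scaling_coeff f k) * \<phi>I j0 k x)\<^sup>2) \<le> ennreal (C\<^sup>2 / real n) * ennreal ((noise0 n f k \<omega>)\<^sup>2)"
        by (simp add: ennreal_mult[symmetric] ennreal_leI)
    qed
    also have "\<dots> = ennreal (C\<^sup>2 / real n) * mean_square P (noise0 n f k)"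
    proof -
      have "noise0 n f k \<in> borel_measurable P" using noise0_stoch_integral[OF n1 cf k] by (simp add: has_stoch_integral_def)
      then show ?thesis unfolding mean_square_def by (intro nn_integral_cmult) measurable
    qed
    also have "\<dots> \<le> ennreal (C\<^sup>2 / real n) * ennreal 9"
      by (intro mult_left_mono order_trans[OF noise0_mean_square[OF n1 cf k]]) (auto intro: ennreal_leI)
    also have "\<dots> = ennreal ((3 * C / sqrt (real n))\<^sup>2)"
      by (subst ennreal_mult[symmetric]) (auto simp: power_divide power_mult_distrib)
    finally show "mean_square P (\<lambda>\<omega>. (obs0 n f k \<omega> - scaling_coeff f k) * \<phi>I j0 k x) \<le> ennreal ((3 * C / sqrt (real n))\<^sup>2)" .
  qed simp
  also have "(\<Sum>k\<in>{1..2^j0 :: nat}. 3 * C / sqrt (real n))\<^sup>2 = scaling_const * (1 / real n)"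
    by (simp add: scaling_const_def power_mult_distrib power_divide)
  finally have S1: "mean_square P ?Sc \<le> ennreal (scaling_const * (1 / real n))" .
  have "mean_square P ?W \<le> ennreal ((\<Sum>j\<in>T. (2 * R + 1) * C * (2 powr (real j / 2) * g j))\<^sup>2)"
  proof (rule mean_square_sum_le[OF finT])
    fix j assume j: "j \<in> T"
    have jj: "j \<ge> j0" using levelsD(1)[OF _ n1] j T by auto
    show "(\<lambda>\<omega>. \<Sum>k=1..2^j. err n f j k \<omega> * \<psi> j k x) \<in> borel_measurable P"
      by (intro borel_measurable_sum borel_measurable_times borel_measurable_const em j)
    show "(2 * R + 1) * C * (2 powr (real j / 2) * g j) > 0" using R C g[OF j] by (intro mult_pos_pos) auto
    let ?S = "{k\<in>{1..2^j}. \<bar>2^j * x - real k\<bar> \<le> R}"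
    have "(\<Sum>k=1..2^j. err n f j k \<omega> * \<psi> j k x) = (\<Sum>k\<in>?S. err n f j k \<omega> * \<psi> j k x)" for \<omega>
      using wavelet_support[OF jj _ x] by (intro sum.mono_neutral_right) auto
    then have "mean_square P (\<lambda>\<omega>. \<Sum>k=1..2^j. err n f j k \<omega> * \<psi> j k x)
       = mean_square P (\<lambda>\<omega>. \<Sum>k\<in>?S. err n f j k \<omega> * \<psi> j k x)" by simp
    also have "\<dots> \<le> ennreal ((\<Sum>k\<in>?S. C * 2 powr (real j / 2) * g j)\<^sup>2)"
    proof (rule mean_square_sum_le)
      fix k assume "k \<in> ?S"
      then have k: "k \<in> {1..2^j}" by simp
      show "(\<lambda>\<omega>. err n f j k \<omega> * \<psi> j k x) \<in> borel_measurable P"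
        by (intro borel_measurable_times borel_measurable_const em j k)
      show "C * 2 powr (real j / 2) * g j > 0" using C g[OF j] by simp
      have "mean_square P (\<lambda>\<omega>. err n f j k \<omega> * \<psi> j k x)
        \<le> (\<integral>\<^sup>+\<omega>. ennreal ((C * 2 powr (real j / 2))\<^sup>2) * ennreal ((err n f j k \<omega>)\<^sup>2) \<partial>P)"
        unfolding mean_square_def
      proof (rule nn_integral_mono)
        fix \<omega>
        have "(\<psi> j k x)\<^sup>2 \<le> (C * 2 powr (real j / 2))\<^sup>2"
          using wavelet_bound[OF jj k x] C by (simp add: abs_le_square_iff[symmetric] abs_mult)
        then have "(err n f j k \<omega> * \<psi> j k x)\<^sup>2 \<le> (C * 2 powr (real j / 2))\<^sup>2 * (err n f j k \<omega>)\<^sup>2"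
          by (simp only: power_mult_distrib[of "err n f j k \<omega>"] mult.commute[of "(err n f j k \<omega>)\<^sup>2"]) (rule mult_right_mono, simp_all)
        then show "ennreal ((err n f j k \<omega> * \<psi> j k x)\<^sup>2) \<le> ennreal ((C * 2 powr (real j / 2))\<^sup>2) * ennreal ((err n f j k \<omega>)\<^sup>2)"
          by (simp add: ennreal_mult[symmetric] ennreal_leI)
      qed
      also have "\<dots> = ennreal ((C * 2 powr (real j / 2))\<^sup>2) * mean_square P (err n f j k)"
        unfolding mean_square_def using em[OF j k] by (intro nn_integral_cmult) measurable
      also have "\<dots> \<le> ennreal ((C * 2 powr (real j / 2))\<^sup>2) * ennreal ((g j)\<^sup>2)"
        by (intro mult_left_mono ms j k) simp
      also have "\<dots> = ennreal ((C * 2 powr (real j / 2) * g j)\<^sup>2)"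
        by (subst ennreal_mult[symmetric]) (auto simp: power_mult_distrib)
      finally show "mean_square P (\<lambda>\<omega>. err n f j k \<omega> * \<psi> j k x) \<le> ennreal ((C * 2 powr (real j / 2) * g j)\<^sup>2)" .
    qed simp
    also have "\<dots> \<le> ennreal (((2 * R + 1) * C * (2 powr (real j / 2) * g j))\<^sup>2)"
    proof (intro ennreal_leI power_mono)
      have "(\<Sum>k\<in>?S. C * 2 powr (real j / 2) * g j) = real (card ?S) * (C * (2 powr (real j / 2) * g j))" by simp
      also have "\<dots> \<le> (2 * R + 1) * (C * (2 powr (real j / 2) * g j))"
        using card_near_le[of "{1..2^j}" R] R C g[OF j] by (intro mult_right_mono) auto
      finally show "(\<Sum>k\<in>?S. C * 2 powr (real j / 2) * g j) \<le> (2 * R + 1) * C * (2 powr (real j / 2) * g j)"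
        by (simp add: mult.assoc)
      show "0 \<le> (\<Sum>k\<in>?S. C * 2 powr (real j / 2) * g j)" using C g[OF j] by (intro sum_nonneg) auto
    qed
    finally show "mean_square P (\<lambda>\<omega>. \<Sum>k=1..2^j. err n f j k \<omega> * \<psi> j k x) \<le> ennreal (((2 * R + 1) * C * (2 powr (real j / 2) * g j))\<^sup>2)" .
  qed
  also have "(\<Sum>j\<in>T. (2 * R + 1) * C * (2 powr (real j / 2) * g j))\<^sup>2 = level_const * ?G\<^sup>2"
    by (simp only: sum_distrib_left[symmetric] level_const_def power_mult_distrib)
  finally have S2: "mean_square P ?W \<le> ennreal (level_const * ?G\<^sup>2)" .
  have "\<bar>?b\<bar> \<le> bias_const * 2 powr (- \<alpha> * real (max j0 (nat \<lfloor>log 2 (real n)\<rfloor>)))"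
    using expansion_error_bound[OF f \<alpha> M r _ x, of "max j0 (nat \<lfloor>log 2 (real n)\<rfloor>)"]
    by (simp add: bias_const_def abs_minus_commute)
  also have "\<dots> \<le> bias_const * (2 powr \<alpha> * real n powr (- \<alpha>))"
  proof (rule mult_left_mono)
    have "log 2 (real n) - 1 \<le> real (max j0 (nat \<lfloor>log 2 (real n)\<rfloor>))" by linarith
    then have "- \<alpha> * real (max j0 (nat \<lfloor>log 2 (real n)\<rfloor>)) \<le> - \<alpha> * (log 2 (real n) - 1)"
      using \<alpha> by (intro mult_left_mono_neg) auto
    then have "2 powr (- \<alpha> * real (max j0 (nat \<lfloor>log 2 (real n)\<rfloor>))) \<le> 2 powr (- \<alpha> * (log 2 (real n) - 1))"
      by (intro powr_mono) auto
    also have "- \<alpha> * (log 2 (real n) - 1) = \<alpha> + log 2 (real n) * (- \<alpha>)" by (simp add: algebra_simps)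
    also have "2 powr \<dots> = 2 powr \<alpha> * (2 powr log 2 (real n)) powr (- \<alpha>)" by (simp only: powr_add powr_powr)
    also have "2 powr log 2 (real n) = real n" using n by simp
    finally show "2 powr (- \<alpha> * real (max j0 (nat \<lfloor>log 2 (real n)\<rfloor>))) \<le> 2 powr \<alpha> * real n powr (- \<alpha>)" .
    have "2 powr (- \<alpha>) < 1" using \<alpha> powr_less_cancel_iff[of 2 "- \<alpha>" 0] by auto
    then show "bias_const \<ge> 0" using R C M by (simp add: bias_const_def)
  qed
  finally have b: "\<bar>?b\<bar> \<le> bias_const * 2 powr \<alpha> * real n powr (- \<alpha>)" by (simp add: mult.assoc)
  then have "?b\<^sup>2 \<le> (bias_const * 2 powr \<alpha> * real n powr (- \<alpha>))\<^sup>2" by (rule power2_le_iff_abs_le[THEN iffD2, rotated]) (use b in linarith)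
  also have "\<dots> = (bias_const * 2 powr \<alpha>)\<^sup>2 * real n powr (- 2 * \<alpha>)"
    using n by (simp add: power_mult_distrib power2_eq_square powr_add[symmetric])
  finally have "mean_square P (\<lambda>_. ?b) \<le> ennreal ((bias_const * 2 powr \<alpha>)\<^sup>2 * real n powr (- 2 * \<alpha>))"
    by (simp add: mean_square_def emeasure_space_1 ennreal_leI)
  then have "mean_square P (\<lambda>\<omega>. (?Sc \<omega> + ?W \<omega>) + ?b)
    \<le> ennreal (2 * (2 * (scaling_const * (1 / real n)) + 2 * (level_const * ?G\<^sup>2)) + 2 * ((bias_const * 2 powr \<alpha>)\<^sup>2 * real n powr (- 2 * \<alpha>)))"
    using c by (intro mean_square_add_le borel_measurable_add Scm Wm S1 S2) auto
  also have "\<dots> \<le> ennreal (error_const * (1 / real n + ?G\<^sup>2 + real n powr (- 2 * \<alpha>)))"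
  proof (rule ennreal_leI)
    have "4 * scaling_const * (1 / real n) \<le> error_const * (1 / real n)" "4 * level_const * ?G\<^sup>2 \<le> error_const * ?G\<^sup>2"
      "2 * (bias_const * 2 powr \<alpha>)\<^sup>2 * real n powr (- 2 * \<alpha>) \<le> error_const * real n powr (- 2 * \<alpha>)"
      by (intro mult_right_mono D; simp)+
    then show "2 * (2 * (scaling_const * (1 / real n)) + 2 * (level_const * ?G\<^sup>2)) + 2 * ((bias_const * 2 powr \<alpha>)\<^sup>2 * real n powr (- 2 * \<alpha>)) \<le> error_const * (1 / real n + ?G\<^sup>2 + real n powr (- 2 * \<alpha>))"
      by (simp add: distrib_left)
  qed
  finally show ?thesis
    unfolding error_part_def .
qed

end

section \<open>The risk at a point\<close>

lemma sum_filtered: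
  fixes h :: "'i \<Rightarrow> real"
  assumes "finite S"
  shows "(\<Sum>j\<in>S. h j * (of_bool (Q j) * v)) = v * (\<Sum>j\<in>{j\<in>S. Q j}. h j)"
proof -
  have "(\<Sum>j\<in>S. h j * (of_bool (Q j) * v)) = (\<Sum>j\<in>S. if Q j then v * h j else 0)"
    by (intro sum.cong) auto
  also have "\<dots> = (\<Sum>j\<in>{j\<in>S. Q j}. v * h j)" using assms by (simp add: sum.inter_filter)
  finally show ?thesis by (simp add: sum_distrib_left)
qed

lemma sum_squares_le_square:
  fixes x y z :: real
  assumes "0 \<le> x" "0 \<le> y" "x + y \<le> z"
  shows "x\<^sup>2 + y\<^sup>2 \<le> z\<^sup>2"
proof -
  have "x\<^sup>2 + y\<^sup>2 \<le> (x + y)\<^sup>2" using assms by (simp add: power2_sum)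
  also have "\<dots> \<le> z\<^sup>2" using assms by (intro power_mono) auto
  finally show ?thesis .
qed

context holder_estimation
begin

lemma two_powr_less_1: "a > 0 \<Longrightarrow> 2 powr (- a) < (1::real)"
  using powr_less_cancel_iff[of 2 "- a" 0] by auto

lemma half_powr_sum_low:
  assumes "finite S" "X > 0"
  shows "(\<Sum>j\<in>{j\<in>S. 2 ^ j \<le> X}. 2 powr (real j / 2)) \<le> X powr (1/2) * (1 / (1 - 2 powr (- (1/2))))"
  using geometric_sum_low[OF assms(1) _ assms(2), of "1/2"] by simp

lemma ln_bounds:
  assumes "n \<ge> 3"
  shows "ln (real n) \<ge> 1" "0 < ln (real n) / real n" "ln (real n) / real n \<le> 1" "1 / real n \<le> ln (real n) / real n"
  using ln_ge_1[OF assms] assms ln_le_minus_one[of "real n"] by (auto simp: divide_right_mono)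

text \<open>
  With $l = (\log n)/n$, the three bounds for the coefficient errors change roles at $X_1 = l^{-1/(1+2\alpha)}$ and
  $X_2 = (\kappa n)^{1/(1+2\alpha)}$.  The function $G$ is a common majorant of the root mean squares; each of its four terms sums to
  a multiple of $\rho = l^{\alpha/(1+2\alpha)}$, the target rate.
\<close>

lemma pointwise_error_bound:
  "\<exists>D>0. \<forall>n\<ge>3. \<forall>f\<in>holder_class \<alpha> M. \<forall>x\<in>{0..1}.
      mean_square P (error_part (levels n) n f x) \<le> ennreal (D * (ln (real n) / real n) powr (2 * (\<alpha> * s)))"
proof -
  obtain A \<kappa> where eb: "coeff_error_bounds A \<kappa>" using coeff_error_bounds_exist by blast
  note A = coeff_error_boundsD(1)[OF eb] and \<kappa> = coeff_error_boundsD(2)[OF eb]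
  define c1 where "c1 = 1 / (1 - 2 powr (- (1/2)) :: real)"
  define c2 where "c2 = 1 / (1 - 2 powr (- \<alpha>))"
  have c: "c1 > 0" "c2 > 0" using two_powr_less_1[of "1/2"] two_powr_less_1[OF \<alpha>] by (auto simp: c1_def c2_def)
  define E where "E = sqrt A * (c1 + c2 + \<kappa> powr (s/2) * c1 + c1)"
  define D where "D = error_const * (2 + E\<^sup>2)"
  have D: "D > 0" using error_const_pos by (simp add: D_def add_pos_nonneg)
  show ?thesis
  proof (intro exI[of _ D] conjI ballI allI impI D)
    fix n :: nat and f :: "real \<Rightarrow> real" and x :: real
    assume n3: "n \<ge> 3" and f: "f \<in> holder_class \<alpha> M" and x: "x \<in> {0..1}"
    define l where "l = ln (real n) / real n"
    have l: "0 < l" "l \<le> 1" "1 / real n \<le> l" using ln_bounds[OF n3] by (auto simp: l_def)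
    have n0: "real n > 0" "real n \<ge> 1" using n3 by auto
    define X1 where "X1 = l powr (- s)"
    define X2 where "X2 = (\<kappa> * real n) powr s"
    have X: "X1 > 0" "X2 > 0" using l n0 \<kappa> by (auto simp: X1_def X2_def)
    define \<rho> where "\<rho> = l powr (\<alpha> * s)"
    have half: "1/2 - s/2 = \<alpha> * s" using s_props(3) by simp
    \<comment> \<open>the logarithmic factor of the target rate is at least 1\<close>
    have n\<rho>: "real n powr (- (\<alpha> * s)) \<le> \<rho>"
    proof -
      have "real n powr (- (\<alpha> * s)) = (1 / real n) powr (\<alpha> * s)" using n0 by (simp add: powr_divide powr_minus_divide)
      also have "\<dots> \<le> \<rho>" unfolding \<rho>_def using l s_props by (intro powr_mono2) auto
      finally show ?thesis .
    qed
    define a where "a j = 2 powr (- (\<alpha> + 1/2) * real j)" for j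
    define b where "b = real n powr (- (1/2))"
    define w where "w = real n powr (- 1 + s/2)"
    define G where "G j = of_bool (2 ^ j \<le> X1) * l powr (1/2) + of_bool (X1 < 2 ^ j) * a j + of_bool (2 ^ j \<le> X2) * b + w" for j :: nat
    have pos: "a j > 0" "b > 0" "w > 0" for j using n0 by (auto simp: a_def b_def w_def)
    have sq: "(a j)\<^sup>2 = 2 powr (- (1 + 2 * \<alpha>) * real j)" "b\<^sup>2 = 1 / real n" "w\<^sup>2 = real n powr (- 2 + s)" "(l powr (1/2))\<^sup>2 = l" for j
    proof -
      have "- (\<alpha> + 1/2) * real j + - (\<alpha> + 1/2) * real j = - (1 + 2 * \<alpha>) * real j" by (simp add: field_simps)
      then show "(a j)\<^sup>2 = 2 powr (- (1 + 2 * \<alpha>) * real j)" by (simp only: a_def power2_eq_square powr_add[symmetric])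
      show "b\<^sup>2 = 1 / real n" using n0 by (simp add: b_def power2_eq_square powr_add[symmetric] powr_minus_divide)
      have "(- 1 + s/2) + (- 1 + s/2) = - 2 + s" by simp
      then show "w\<^sup>2 = real n powr (- 2 + s)" by (simp only: w_def power2_eq_square powr_add[symmetric])
      show "(l powr (1/2))\<^sup>2 = l" using l by (simp add: power2_eq_square powr_add[symmetric])
    qed
    have "mean_square P (error_part (levels n) n f x)
      \<le> ennreal (error_const * (1 / real n + (\<Sum>j\<in>levels n. 2 powr (real j / 2) * (sqrt A * G j))\<^sup>2 + real n powr (- 2 * \<alpha>)))"
    proof (rule error_part_mean_square)
      show "sqrt A * G j > 0" for j using A pos(1)[of j] pos(2,3) by (simp add: G_def add_nonneg_pos less_imp_le)
      fix j k :: nat assume j: "j \<in> levels n" and k: "k \<in> {1..2^j}"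
      note e1 = coeff_error_boundsD(3)[OF eb n3 f j k] and e2 = coeff_error_boundsD(4)[OF eb n3 f j k]
        and e3 = coeff_error_boundsD(5)[OF eb n3 f j k, folded X2_def]
      have ms: "mean_square P (err n f j k) \<le> ennreal ((sqrt A * G j)\<^sup>2)"
        if "mean_square P (err n f j k) \<le> ennreal (A * t)" "t \<le> (G j)\<^sup>2" for t
      proof (rule order_trans[OF that(1) ennreal_leI])
        show "A * t \<le> (sqrt A * G j)\<^sup>2" using A that(2) by (simp add: power_mult_distrib)
      qed
      consider "2 ^ j \<le> X1" | "X1 < 2 ^ j" "2 ^ j \<le> X2" | "X1 < 2 ^ j" "X2 < 2 ^ j" by linarith
      then show "mean_square P (err n f j k) \<le> ennreal ((sqrt A * G j)\<^sup>2)"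
      proof cases
        case 1
        have "(l powr (1/2))\<^sup>2 + 0\<^sup>2 \<le> (G j)\<^sup>2" using 1 pos(1)[of j] pos(2,3) by (intro sum_squares_le_square) (auto simp: G_def)
        then have "l \<le> (G j)\<^sup>2" unfolding sq(4) by simp
        then show ?thesis using ms[OF e1[folded l_def]] by simp
      next
        case 2
        have "(a j)\<^sup>2 + b\<^sup>2 \<le> (G j)\<^sup>2" using 2 pos(1)[of j] pos(2,3) by (intro sum_squares_le_square) (auto simp: G_def)
        then show ?thesis using ms[OF e2] by (simp only: sq)
      next
        case 3
        have "(a j)\<^sup>2 + w\<^sup>2 \<le> (G j)\<^sup>2" using 3 pos(1)[of j] pos(2,3) by (intro sum_squares_le_square) (auto simp: G_def)
        then show ?thesis using ms[OF e3[OF 3(2)]] by (simp only: sq)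
      qed
    qed (use n3 f x in auto)
    also have "\<dots> \<le> ennreal (error_const * ((2 + E\<^sup>2) * l powr (2 * (\<alpha> * s))))"
    proof (intro ennreal_leI mult_left_mono)
      let ?h = "\<lambda>j :: nat. 2 powr (real j / 2) :: real"
      have "(\<Sum>j\<in>levels n. ?h j * (sqrt A * G j)) = sqrt A * ((\<Sum>j\<in>levels n. ?h j * (of_bool (2 ^ j \<le> X1) * l powr (1/2)))
          + (\<Sum>j\<in>levels n. (?h j * a j) * (of_bool (X1 < 2 ^ j) * 1))
          + (\<Sum>j\<in>levels n. ?h j * (of_bool (2 ^ j \<le> X2) * b))
          + (\<Sum>j\<in>levels n. ?h j * (of_bool (2 ^ j \<le> real n) * w)))"
      proof -
        have *: "?h j * (sqrt A * G j) = sqrt A * (?h j * (of_bool (2 ^ j \<le> X1) * l powr (1/2))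
          + (?h j * a j) * (of_bool (X1 < 2 ^ j) * 1)
          + ?h j * (of_bool (2 ^ j \<le> X2) * b) + ?h j * (of_bool (2 ^ j \<le> real n) * w))" if "j \<in> levels n" for j
          using levelsD(3)[OF that] n3 by (simp add: G_def algebra_simps)
        show ?thesis unfolding sum.distrib[symmetric] sum_distrib_left[of "sqrt A"] by (rule sum.cong[OF refl *])
      qed
      also have "\<dots> \<le> sqrt A * (l powr (1/2) * (X1 powr (1/2) * c1) + 1 * (X1 powr (- \<alpha>) * c2)
          + b * (X2 powr (1/2) * c1) + w * (real n powr (1/2) * c1))"
      proof (intro mult_left_mono add_mono)
        show "(\<Sum>j\<in>levels n. ?h j * (of_bool (2 ^ j \<le> X1) * l powr (1/2))) \<le> l powr (1/2) * (X1 powr (1/2) * c1)"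
          unfolding sum_filtered[OF finite_levels] c1_def by (intro mult_left_mono half_powr_sum_low X) auto
        show "(\<Sum>j\<in>levels n. ?h j * (of_bool (2 ^ j \<le> X2) * b)) \<le> b * (X2 powr (1/2) * c1)"
          unfolding sum_filtered[OF finite_levels] c1_def using pos by (intro mult_left_mono half_powr_sum_low X) (auto simp: less_imp_le)
        show "(\<Sum>j\<in>levels n. ?h j * (of_bool (2 ^ j \<le> real n) * w)) \<le> w * (real n powr (1/2) * c1)"
          unfolding sum_filtered[OF finite_levels] c1_def using pos n0 by (intro mult_left_mono half_powr_sum_low) (auto simp: less_imp_le)
        have "?h j * a j = 2 powr (- \<alpha> * real j)" for j
        proof -
          have "real j / 2 + - (\<alpha> + 1/2) * real j = - \<alpha> * real j" by (simp add: field_simps)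
          then show ?thesis by (simp only: a_def powr_add[symmetric])
        qed
        then show "(\<Sum>j\<in>levels n. (?h j * a j) * (of_bool (X1 < 2 ^ j) * 1)) \<le> 1 * (X1 powr (- \<alpha>) * c2)"
          unfolding sum_filtered[OF finite_levels] using geometric_sum_high[OF finite_levels \<alpha> X(1), of n] by (simp add: c2_def)
      qed (use A in auto)
      also have "\<dots> \<le> sqrt A * (\<rho> * c1 + \<rho> * c2 + \<rho> * (\<kappa> powr (s/2) * c1) + \<rho> * c1)"
      proof (intro mult_left_mono add_mono)
        have "l powr (1/2) * X1 powr (1/2) = \<rho>"
          unfolding X1_def \<rho>_def half[symmetric] by (simp add: powr_powr powr_add[symmetric])
        then show "l powr (1/2) * (X1 powr (1/2) * c1) \<le> \<rho> * c1" by (simp add: mult.assoc[symmetric])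
        have "X1 powr (- \<alpha>) = \<rho>" unfolding X1_def \<rho>_def by (simp add: powr_powr mult.commute)
        then show "1 * (X1 powr (- \<alpha>) * c2) \<le> \<rho> * c2" by simp
        have "b * X2 powr (1/2) = \<kappa> powr (s/2) * real n powr (- (\<alpha> * s))"
        proof -
          have "- (1/2) + s/2 = - (\<alpha> * s)" using half by simp
          moreover have "X2 powr (1/2) = \<kappa> powr (s/2) * real n powr (s/2)" using \<kappa> by (simp add: X2_def powr_powr powr_mult)
          ultimately show ?thesis by (simp only: b_def mult.left_commute[of "real n powr _"] powr_add[symmetric])
        qed
        also have "\<dots> \<le> \<kappa> powr (s/2) * \<rho>" using n\<rho> by (intro mult_left_mono) auto
        finally show "b * (X2 powr (1/2) * c1) \<le> \<rho> * (\<kappa> powr (s/2) * c1)"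
          using c mult_right_mono[of "b * X2 powr (1/2)" "\<kappa> powr (s/2) * \<rho>" c1] by (simp add: ac_simps)
        have "w * real n powr (1/2) = real n powr (- (\<alpha> * s))"
        proof -
          have "(- 1 + s/2) + 1/2 = - (\<alpha> * s)" using half by simp
          then show ?thesis by (simp only: w_def powr_add[symmetric])
        qed
        then show "w * (real n powr (1/2) * c1) \<le> \<rho> * c1"
          using n\<rho> c by (simp add: mult.assoc[symmetric] mult_right_mono)
      qed (use A in auto)
      also have "\<dots> = E * \<rho>" by (simp add: E_def algebra_simps)
      finally have "(\<Sum>j\<in>levels n. ?h j * (sqrt A * G j)) \<le> E * \<rho>" .
      moreover have "0 \<le> (\<Sum>j\<in>levels n. ?h j * (sqrt A * G j))"
        using A pos l by (intro sum_nonneg mult_nonneg_nonneg) (auto simp: G_def less_imp_le intro!: add_nonneg_nonneg)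
      ultimately have "(\<Sum>j\<in>levels n. ?h j * (sqrt A * G j))\<^sup>2 \<le> (E * \<rho>)\<^sup>2" by (intro power_mono)
      also have "\<dots> = E\<^sup>2 * l powr (2 * (\<alpha> * s))"
        by (simp add: power_mult_distrib \<rho>_def power2_eq_square powr_add[symmetric])
      finally have 1: "(\<Sum>j\<in>levels n. ?h j * (sqrt A * G j))\<^sup>2 \<le> E\<^sup>2 * l powr (2 * (\<alpha> * s))" .
      have inv: "(1 / real n) powr (2 * (\<alpha> * s)) \<le> l powr (2 * (\<alpha> * s))" using l s_props by (intro powr_mono2) auto
      have "1 / real n = (1 / real n) powr 1" using n0 by simp
      also have "\<dots> \<le> (1 / real n) powr (2 * (\<alpha> * s))" using n0 s_props by (intro powr_mono') auto
      finally have 2: "1 / real n \<le> l powr (2 * (\<alpha> * s))" using inv by linarith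
      have "real n powr (- 2 * \<alpha>) = (1 / real n) powr (2 * \<alpha>)" using n0 by (simp add: powr_divide powr_minus_divide)
      also have "\<dots> \<le> (1 / real n) powr (2 * (\<alpha> * s))" using n0 s_props by (intro powr_mono') auto
      finally have 3: "real n powr (- 2 * \<alpha>) \<le> l powr (2 * (\<alpha> * s))" using inv by linarith
      from 1 2 3 show "1 / real n + (\<Sum>j\<in>levels n. ?h j * (sqrt A * G j))\<^sup>2 + real n powr (- 2 * \<alpha>) \<le> (2 + E\<^sup>2) * l powr (2 * (\<alpha> * s))"
        by (simp add: distrib_right)
    qed (use error_const_pos in simp)
    also have "error_const * ((2 + E\<^sup>2) * l powr (2 * (\<alpha> * s))) = D * l powr (2 * (\<alpha> * s))" by (simp add: D_def)
    finally show "mean_square P (error_part (levels n) n f x) \<le> ennreal (D * (ln (real n) / real n) powr (2 * (\<alpha> * s)))"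
      unfolding l_def .
  qed
qed

text \<open>
  For $c > 0$ the bound at the points is averaged over the interval.
\<close>

lemma pointwise_risk_bound:
  "\<exists>D>0. \<forall>n\<ge>3. \<forall>f\<in>holder_class \<alpha> M. \<forall>x0 c. c \<ge> 0 \<longrightarrow> {x0 - c..x0 + c} \<subseteq> {0..1} \<longrightarrow>
      local_risk P (block_js P \<phi>I \<psi> j0 n (observation B n f)) f x0 c
        \<le> ennreal (D * (ln (real n) / real n) powr (2 * (\<alpha> * s)))"
proof -
  obtain D where D: "D > 0" and pe: "\<forall>n\<ge>3. \<forall>f\<in>holder_class \<alpha> M. \<forall>x\<in>{0..1}.
      mean_square P (error_part (levels n) n f x) \<le> ennreal (D * (ln (real n) / real n) powr (2 * (\<alpha> * s)))"
    using pointwise_error_bound by blast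
  show ?thesis
  proof (intro exI[of _ D] conjI ballI allI impI D)
    fix n :: nat and f :: "real \<Rightarrow> real" and x0 c :: real
    assume n3: "n \<ge> 3" and f: "f \<in> holder_class \<alpha> M" and c: "c \<ge> 0" and I: "{x0 - c..x0 + c} \<subseteq> {0..1}"
    let ?b = "D * (ln (real n) / real n) powr (2 * (\<alpha> * s))"
    have n: "n \<ge> 1" "n \<ge> 2" using n3 by auto
    note cf = holder_class_continuous[OF f \<alpha> M]
    show "local_risk P (block_js P \<phi>I \<psi> j0 n (observation B n f)) f x0 c \<le> ennreal ?b"
    proof (cases "c > 0")
      case True
      have "(\<integral>\<^sup>+\<omega>. (\<integral>\<^sup>+x\<in>{x0 - c..x0 + c}. ennreal ((error_part (levels n) n f x \<omega>)\<^sup>2) \<partial>lborel) \<partial>P)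
        \<le> ennreal (((x0 + c) - (x0 - c)) * ?b)"
        using c D by (intro local_integral_swap[OF n(2) cf order_refl I] pe[rule_format, OF n3 f]) auto
      then have "local_risk P (block_js P \<phi>I \<psi> j0 n (observation B n f)) f x0 c \<le> ennreal (1 / (2 * c)) * ennreal (((x0 + c) - (x0 - c)) * ?b)"
        using True by (simp add: local_risk_def block_js_error[OF n(1)] mult_left_mono)
      also have "\<dots> = ennreal ?b" using True D by (simp add: ennreal_mult[symmetric])
      finally show ?thesis .
    next
      case False
      then have "x0 \<in> {0..1}" using c I by auto
      from pe[rule_format, OF n3 f this] show ?thesis
        using False by (simp add: local_risk_def block_js_error[OF n(1)] mean_square_def)
    qed
  qed
qed

end

section \<open>The risk over an interval\<close>

lemma card_block_image_le:
  assumes L: "block_length n \<ge> 1" and S: "finite S" and W: "W \<ge> 0"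
    and near: "\<And>k. k \<in> S \<Longrightarrow> \<bar>y - real k\<bar> \<le> W"
  shows "real (card (block_of n ` S)) \<le> 2 * W / real (block_length n) + 2"
proof (cases "S = {}")
  case False
  let ?l = "block_length n" and ?a = "Min S" and ?b = "Max S"
  have ab: "?a \<in> S" "?b \<in> S" using S False by auto
  then have diff: "real ?b - real ?a \<le> 2 * W" using near[of ?a] near[of ?b] by linarith
  have le: "?a \<le> ?b" using S ab by auto
  have "block_of n ` S \<subseteq> {block_of n ?a..block_of n ?b}"
  proof
    fix b assume "b \<in> block_of n ` S"
    then obtain k where k: "k \<in> S" "b = block_of n k" by auto
    then have "?a \<le> k" "k \<le> ?b" using S by auto
    then show "b \<in> {block_of n ?a..block_of n ?b}" unfolding k(2) block_of_def by (auto intro!: div_le_mono diff_le_mono)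
  qed
  then have "card (block_of n ` S) \<le> card {block_of n ?a..block_of n ?b}" by (intro card_mono) auto
  also have "\<dots> = Suc (block_of n ?b) - block_of n ?a" by simp
  finally have "real (card (block_of n ` S)) \<le> real (Suc (block_of n ?b) - block_of n ?a)" by simp
  also have "\<dots> = real (block_of n ?b) - real (block_of n ?a) + 1"
    using div_le_mono[OF diff_le_mono[OF le, of 1], of ?l] by (simp add: block_of_def of_nat_diff)
  also have "\<dots> \<le> (real ?b - real ?a) / real ?l + 2"
  proof -
    have 1: "real ((?b - 1) div ?l) \<le> real (?b - 1) / real ?l" by (rule of_nat_div_le_of_nat)
    have 2: "real (?a - 1) / real ?l - real ((?a - 1) div ?l) \<le> 1" 
    proof -
      have "real (?a - 1) = real ((?a - 1) div ?l) * real ?l + real ((?a - 1) mod ?l)"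
        by (simp only: of_nat_mult[symmetric] of_nat_add[symmetric] div_mult_mod_eq)
      moreover have "real ((?a - 1) mod ?l) \<le> real ?l" using L by (simp add: less_imp_le)
      ultimately have "real (?a - 1) \<le> (real ((?a - 1) div ?l) + 1) * real ?l" by (simp add: distrib_right)
      then show ?thesis using L by (simp add: pos_divide_le_eq algebra_simps)
    qed
    have "real (?b - 1) - real (?a - 1) \<le> real ?b - real ?a" using le by linarith
    then have "real (?b - 1) / real ?l - real (?a - 1) / real ?l \<le> (real ?b - real ?a) / real ?l"
      unfolding diff_divide_distrib[symmetric] by (intro divide_right_mono) auto
    with 1 2 show ?thesis by (simp add: block_of_def)
  qed
  also have "\<dots> \<le> 2 * W / real ?l + 2" using diff by (simp add: divide_right_mono)
  finally show ?thesis .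
qed (use W in simp)

lemma ln_2_ge_half: "ln (2::real) \<ge> 1/2"
proof -
  have "exp (1/2 :: real) \<le> 2" using exp_bound[of "1/2 :: real"] by (simp add: power2_eq_square)
  then show ?thesis using ln_ge_iff[of 2 "1/2::real"] by simp
qed

text \<open>
  The condition confines $j$ to an interval of length $\log_2 L$.
\<close>

lemma card_levels_window:
  assumes "finite S" "c > 0" "L > 0" "ln L \<ge> 1"
  shows "real (card {j\<in>S. 1 / c < 2 ^ j \<and> 2 ^ j * c \<le> L}) \<le> 3 * ln L"
proof -
  have L: "L > 1" 
  proof -
    have "0 < ln L" using assms(4) by linarith
    then show ?thesis using ln_gt_zero_iff[OF assms(3)] by blast
  qed
  define \<rho> where "\<rho> = log 2 L / 2"
  define y where "y = log 2 (1 / c) + \<rho>"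
  have "{j\<in>S. 1 / c < 2 ^ j \<and> 2 ^ j * c \<le> L} \<subseteq> {j\<in>S. \<bar>y - real j\<bar> \<le> \<rho>}"
  proof
    fix j assume j: "j \<in> {j\<in>S. 1 / c < 2 ^ j \<and> 2 ^ j * c \<le> L}"
    have "log 2 (1 / c) < log 2 (2 ^ j)" using j assms by (intro log_less) auto
    moreover have "log 2 (2 ^ j) \<le> log 2 (1 / c * L)" using j assms by (intro log_mono) (auto simp: field_simps)
    moreover have "log 2 (1 / c * L) = log 2 (1 / c) + log 2 L" using assms L by (intro log_mult_pos) auto
    ultimately have "log 2 (1 / c) < real j" "real j \<le> log 2 (1 / c) + 2 * \<rho>" by (auto simp: \<rho>_def log_nat_power)
    then show "j \<in> {j\<in>S. \<bar>y - real j\<bar> \<le> \<rho>}" using j by (auto simp: y_def abs_le_iff)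
  qed
  then have "real (card {j\<in>S. 1 / c < 2 ^ j \<and> 2 ^ j * c \<le> L}) \<le> real (card {j\<in>S. \<bar>y - real j\<bar> \<le> \<rho>})"
    using assms(1) by (intro of_nat_mono card_mono) auto
  also have "\<dots> \<le> 2 * \<rho> + 1" using L by (intro card_near_le assms(1)) (simp add: \<rho>_def)
  also have "\<dots> = ln L / ln 2 + 1" by (simp add: \<rho>_def log_def)
  also have "ln L / ln 2 \<le> ln L / (1/2)" using assms(4) ln_2_ge_half by (intro divide_left_mono) auto
  finally show ?thesis using assms(4) by simp
qed

context holder_estimation
begin

lemma local_error_measurable:
  assumes n: "n \<ge> 2" and f: "continuous_on {0..1} f" and T: "T \<subseteq> levels n" and I: "{a..b} \<subseteq> {0..1}"
  shows "(\<lambda>\<omega>. \<integral>\<^sup>+x\<in>{a..b}. ennreal ((error_part T n f x \<omega>)\<^sup>2) \<partial>lborel) \<in> borel_measurable P"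
proof -
  interpret U: prob_space unit_lebesgue by (rule prob_space_unit_lebesgue)
  have restr: "(\<integral>\<^sup>+x\<in>{a..b}. h x \<partial>lborel) = (\<integral>\<^sup>+x. h x * indicator {a..b} x \<partial>unit_lebesgue)" for h :: "real \<Rightarrow> ennreal"
    unfolding set_nn_integral_unit[symmetric] using I by (intro nn_integral_cong) (auto split: split_indicator)
  have [measurable]: "(indicator {a..b} :: real \<Rightarrow> ennreal) \<in> borel_measurable unit_lebesgue"
    by (intro measurable_restrict_space1) simp
  have "(\<lambda>z. error_part T n f (fst z) (snd z)) \<in> borel_measurable (unit_lebesgue \<Otimes>\<^sub>M P)"
    using error_part_measurable[OF n f T] by (simp only: case_prod_beta')
  from measurable_compose[OF measurable_pair_swap' this]
  have [measurable]: "(\<lambda>z. error_part T n f (snd z) (fst z)) \<in> borel_measurable (P \<Otimes>\<^sub>M unit_lebesgue)"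
    by (simp add: case_prod_beta')
  have "(\<lambda>z. ennreal ((error_part T n f (snd z) (fst z))\<^sup>2) * indicator {a..b} (snd z)) \<in> borel_measurable (P \<Otimes>\<^sub>M unit_lebesgue)"
    by measurable
  then show ?thesis unfolding restr
    by (intro U.borel_measurable_nn_integral) (simp only: case_prod_beta')
qed

text \<open>
  The four terms are: noise of the individual coefficients and of full blocks; the one incomplete block per level, needed as long as the
  interval meets fewer than about $\log n$ coefficients; the bias of fine levels; and the rare passages of pure noise.  The first two come
  from the levels up to the resolution $X = (\kappa n)^{1/(1+2\alpha)}$, the other two from the levels beyond.
\<close>

lemma high_level_error:
  "\<exists>D>0. \<exists>\<kappa>\<ge>1. \<forall>n\<ge>3. \<forall>f\<in>holder_class \<alpha> M. \<forall>j\<in>levels n. \<forall>c>0. \<forall>x0. 1 / c < 2 ^ j \<longrightarrow>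
     (\<Sum>k\<in>{k\<in>{1..2^j}. \<bar>2^j * x0 - real k\<bar> \<le> 2^j * c + R}. mean_square P (err n f j k))
     \<le> ennreal (D * (2 ^ j * (of_bool (2 ^ j \<le> (\<kappa> * real n) powr s) * (c / real n))
        + of_bool (2 ^ j * c \<le> ln (real n)) * (ln (real n) / real n)
        + 2 powr (- 2 * \<alpha> * real j) * (of_bool ((\<kappa> * real n) powr s < 2 ^ j) * c)
        + 2 ^ j * (c * real n powr (- 2 + s))))"
proof -
  obtain A \<kappa> where eb: "coeff_error_bounds A \<kappa>" using coeff_error_bounds_exist by blast
  note A = coeff_error_boundsD(1)[OF eb] and \<kappa> = coeff_error_boundsD(2)[OF eb]
  note lam = lambda_star(1)
  define D where "D = 16 * (2 * R + 3) + 2 * lambda_star * (6 + 4 * R) + (2 * R + 3) * A"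
  have D: "D > 0" "16 * (2 * R + 3) + 2 * lambda_star * (6 + 4 * R) \<le> D" "4 * lambda_star \<le> D" "(2 * R + 3) * A \<le> D"
    using R A lam by (auto simp: D_def add_pos_nonneg add_nonneg_nonneg algebra_simps intro!: add_pos_nonneg)
  show ?thesis
  proof (rule exI[of _ D], rule conjI[OF D(1)], rule exI[of _ \<kappa>], rule conjI[OF \<kappa>], intro allI impI ballI)
    fix n j :: nat and f :: "real \<Rightarrow> real" and c x0 :: real
    assume n3: "n \<ge> 3" and f: "f \<in> holder_class \<alpha> M" and j: "j \<in> levels n" and c: "c > 0" and jc: "1 / c < 2 ^ j"
    define S where "S = {k\<in>{1..2^j}. \<bar>2^j * x0 - real k\<bar> \<le> 2^j * c + R}"
    have n: "n \<ge> 1" "n \<ge> 2" using n3 by auto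
    note cf = holder_class_continuous[OF f \<alpha> M]
    note jj = levelsD(1,2)[OF j n(1)]
    define L where "L = ln (real n)"
    have L: "L \<ge> 1" using ln_ge_1[OF n3] by (simp add: L_def)
    define X where "X = (\<kappa> * real n) powr s"
    define m where "m = 2 ^ j * c"
    have m: "m > 1" using jc c by (simp add: m_def field_simps)
    have finS: "finite S" by (simp add: S_def)
    have cardS: "real (card S) \<le> (2 * R + 3) * m"
    proof -
      have "real (card S) \<le> 2 * (m + R) + 1" unfolding S_def m_def using R c by (intro card_near_le) auto
      also have "\<dots> \<le> (2 * R + 3) * m" using m R mult_left_mono[of 1 m "2 * R"] by (simp add: distrib_right)
      finally show ?thesis .
    qed
    have SA: "S \<subseteq> {1..2^j}" by (auto simp: S_def)
    let ?t1 = "2 ^ j * (of_bool (2 ^ j \<le> X) * (c / real n))" and ?t2 = "of_bool (m \<le> L) * (L / real n)"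
    let ?t3 = "2 powr (- 2 * \<alpha> * real j) * (of_bool (X < 2 ^ j) * c)" and ?t4 = "2 ^ j * (c * real n powr (- 2 + s))"
    have t0: "?t1 \<ge> 0" "?t2 \<ge> 0" "?t3 \<ge> 0" "?t4 \<ge> 0" using c L by auto
    have "(\<Sum>k\<in>S. mean_square P (err n f j k)) \<le> ennreal (D * (?t1 + ?t2 + ?t3 + ?t4))"
    proof (cases "2 ^ j \<le> X")
      case True
      have lb: "real (block_length n) \<ge> L / 2"
      proof -
        have "L - 1/2 \<le> of_int (round L)" by (rule of_int_round_ge)
        also have "of_int (round L) \<le> real (block_length n)" by (simp add: block_length_def L_def)
        finally show ?thesis using L by linarith
      qed
      have lb1: "block_length n \<ge> 1" by (rule block_length_pos[OF n(1) cf jj n(2)])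
      have "real (card (block_of n ` S)) \<le> 2 * (m + R) / real (block_length n) + 2"
        by (rule card_block_image_le[OF lb1 finS]) (use R m in \<open>auto simp: S_def m_def\<close>)
      also have "2 * (m + R) / real (block_length n) \<le> 2 * (m + R) / (L / 2)"
        using lb L m R by (intro divide_left_mono) auto
      finally have blocks: "real (card (block_of n ` S)) \<le> 4 * (m + R) / L + 2" by (simp add: field_simps)
      have "(\<Sum>k\<in>S. mean_square P (err n f j k)) \<le> ennreal (16 * real (card S) / real n + 2 * real (card (block_of n ` S)) * threshold n)"
        by (rule err_sum_mean_square[OF n(1) cf jj n(2) SA])
      also have "\<dots> \<le> ennreal (D * (?t1 + ?t2 + ?t3 + ?t4))"
      proof (rule ennreal_leI)
        have th: "threshold n = lambda_star * (L / real n)" by (simp add: threshold_def L_def)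
        have "2 * real (card (block_of n ` S)) * threshold n \<le> 2 * (4 * (m + R) / L + 2) * threshold n"
        proof (rule mult_right_mono)
          show "2 * real (card (block_of n ` S)) \<le> 2 * (4 * (m + R) / L + 2)" by (rule mult_left_mono[OF blocks]) simp
        qed (use threshold_pos[OF n(1) cf jj n(2)] in simp)
        also have "\<dots> = 2 * lambda_star * (4 * (m + R) / real n + 2 * (L / real n))"
        proof -
          have "4 * (m + R) / L * (L / real n) = 4 * (m + R) / real n" using L by simp
          then have "4 * (m + R) / real n + 2 * (L / real n) = (4 * (m + R) / L + 2) * (L / real n)"
            by (simp only: distrib_right)
          then show ?thesis unfolding th by (simp only: ac_simps)
        qed
        also have "\<dots> \<le> 2 * lambda_star * ((6 + 4 * R) * (m / real n) + 2 * ?t2)"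
        proof (rule mult_left_mono)
          have "R * 1 \<le> R * m" using R m by (intro mult_left_mono) auto
          then have p: "4 * (m + R) / real n \<le> (4 + 4 * R) * (m / real n)"
            by (simp add: divide_right_mono distrib_right)
          have q: "L / real n \<le> m / real n + ?t2" using m by (cases "m \<le> L") (auto simp: divide_right_mono)
          have lin: "a + 2 * l \<le> b + 2 * x + 2 * t" if "a \<le> b" "l \<le> x + t" for a b l x t :: real
            using that by linarith
          have "(6 + 4 * R) * (m / real n) = (4 + 4 * R) * (m / real n) + 2 * (m / real n)"
            by (simp only: distrib_right[symmetric]) simp
          with lin[OF p q] show "4 * (m + R) / real n + 2 * (L / real n) \<le> (6 + 4 * R) * (m / real n) + 2 * ?t2"
            by (simp only:)
        qed (use lam in simp)
        also have "\<dots> = 2 * lambda_star * (6 + 4 * R) * (m / real n) + 4 * lambda_star * ?t2"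
        proof -
          have "2 * l * (a * x + 2 * t) = 2 * l * a * x + 4 * l * t" for l a x t :: real by (simp add: algebra_simps)
          then show ?thesis .
        qed
        finally have 2: "2 * real (card (block_of n ` S)) * threshold n \<le> 2 * lambda_star * (6 + 4 * R) * (m / real n) + 4 * lambda_star * ?t2" .
        have "16 * real (card S) / real n \<le> 16 * ((2 * R + 3) * m) / real n"
          using cardS by (intro divide_right_mono) auto
        then have 1: "16 * real (card S) / real n \<le> 16 * (2 * R + 3) * (m / real n)"
          by (simp only: times_divide_eq_left times_divide_eq_right mult.assoc)
        have t1: "?t1 = m / real n" using True by (simp add: m_def)
        have "16 * real (card S) / real n + 2 * real (card (block_of n ` S)) * threshold n
          \<le> (16 * (2 * R + 3) + 2 * lambda_star * (6 + 4 * R)) * (m / real n) + 4 * lambda_star * ?t2"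
        proof -
          have "a + b \<le> (u + v) * x + w" if "a \<le> u * x" "b \<le> v * x + w" for a b u v w x :: real
            using that by (simp add: distrib_right)
          from this[OF 1 2] show ?thesis .
        qed
        also have "\<dots> \<le> D * ?t1 + D * ?t2"
          unfolding t1 using D(2,3) m t0(2) by (intro add_mono mult_right_mono) auto
        also have "\<dots> \<le> D * (?t1 + ?t2 + ?t3 + ?t4)"
          using D(1) t0 unfolding distrib_left[symmetric] by (intro mult_left_mono) auto
        finally show "16 * real (card S) / real n + 2 * real (card (block_of n ` S)) * threshold n \<le> D * (?t1 + ?t2 + ?t3 + ?t4)" .
      qed
      finally show ?thesis .
    next
      case False
      let ?u = "2 powr (- (1 + 2 * \<alpha>) * real j)"
      have "(\<Sum>k\<in>S. mean_square P (err n f j k)) \<le> (\<Sum>k\<in>S. ennreal (A * (?u + real n powr (- 2 + s))))"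
      proof (rule sum_mono)
        fix k assume "k \<in> S"
        then have "k \<in> {1..2^j}" using SA by blast
        then show "mean_square P (err n f j k) \<le> ennreal (A * (?u + real n powr (- 2 + s)))"
          using coeff_error_boundsD(5)[OF eb n3 f j] False unfolding X_def by simp
      qed
      also have "\<dots> = ennreal (real (card S) * (A * (?u + real n powr (- 2 + s))))"
        using A by (subst sum_ennreal) auto
      also have "\<dots> \<le> ennreal (D * (?t1 + ?t2 + ?t3 + ?t4))"
      proof (rule ennreal_leI)
        have "real (card S) * (A * (?u + real n powr (- 2 + s))) \<le> (2 * R + 3) * m * (A * (?u + real n powr (- 2 + s)))"
          using cardS A by (intro mult_right_mono) auto
        also have "\<dots> = (2 * R + 3) * A * (m * (?u + real n powr (- 2 + s)))" by (simp only: ac_simps)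
        also have "\<dots> \<le> D * (m * (?u + real n powr (- 2 + s)))" using D(4) m by (intro mult_right_mono) auto
        also have "m * (?u + real n powr (- 2 + s)) = ?t3 + ?t4"
        proof -
          have "real j + - (1 + 2 * \<alpha>) * real j = - 2 * \<alpha> * real j" by (simp add: algebra_simps)
          then have "2 ^ j * ?u = 2 powr (- 2 * \<alpha> * real j)" by (simp only: powr_realpow[symmetric] powr_add[symmetric] zero_less_numeral)
          then have "m * ?u = ?t3" using False by (simp add: m_def mult.commute mult.left_commute)
          then show ?thesis by (simp add: distrib_left m_def)
        qed
        also have "D * (?t3 + ?t4) \<le> D * (?t1 + ?t2 + ?t3 + ?t4)" using D(1) t0 by (intro mult_left_mono) auto
        finally show "real (card S) * (A * (?u + real n powr (- 2 + s))) \<le> D * (?t1 + ?t2 + ?t3 + ?t4)" .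
      qed
      finally show ?thesis .
    qed
    then show "(\<Sum>k\<in>{k\<in>{1..2^j}. \<bar>2^j * x0 - real k\<bar> \<le> 2^j * c + R}. mean_square P (err n f j k))
     \<le> ennreal (D * (2 ^ j * (of_bool (2 ^ j \<le> (\<kappa> * real n) powr s) * (c / real n))
        + of_bool (2 ^ j * c \<le> ln (real n)) * (ln (real n) / real n)
        + 2 powr (- 2 * \<alpha> * real j) * (of_bool ((\<kappa> * real n) powr s < 2 ^ j) * c)
        + 2 ^ j * (c * real n powr (- 2 + s))))"
      unfolding S_def m_def L_def X_def .
  qed
qed

end

context holder_estimation
begin

text \<open>
  The fine levels are bounded by the orthonormality of the basis on all of $[0,1]$, applied to the wavelets that reach into the interval.
\<close>

lemma local_error_split:
  assumes n: "n \<ge> 2" and f: "continuous_on {0..1} f" and c: "c > 0" and I: "{x0 - c..x0 + c} \<subseteq> {0..1}"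
  defines "lo \<equiv> {j\<in>levels n. 2 ^ j \<le> 1 / c}" and "hi \<equiv> {j\<in>levels n. 1 / c < 2 ^ j}"
  defines "near \<equiv> \<lambda>j. {k\<in>{1..2^j}. \<bar>2^j * x0 - real k\<bar> \<le> 2^j * c + R}"
  shows "(\<integral>\<^sup>+x\<in>{x0 - c..x0 + c}. ennreal ((error_part (levels n) n f x \<omega>)\<^sup>2) \<partial>lborel)
    \<le> 2 * (\<integral>\<^sup>+x\<in>{x0 - c..x0 + c}. ennreal ((error_part lo n f x \<omega>)\<^sup>2) \<partial>lborel)
      + 2 * (\<Sum>j\<in>hi. \<Sum>k\<in>near j. ennreal ((err n f j k \<omega>)\<^sup>2))"
proof -
  let ?I = "{x0 - c..x0 + c}"
  let ?A = "SIGMA j:hi. near j"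
  let ?H = "\<lambda>x. \<Sum>(j, k)\<in>?A. err n f j k \<omega> * \<psi> j k x"
  have n1: "n \<ge> 1" using n by simp
  have fin: "finite lo" "finite hi" "finite (near j)" for j by (auto simp: lo_def hi_def near_def)
  have union: "levels n = lo \<union> hi" "lo \<inter> hi = {}" by (auto simp: lo_def hi_def)
  have A: "finite ?A" "\<And>j k. (j, k) \<in> ?A \<Longrightarrow> j \<ge> j0 \<and> k \<in> {1..2^j}"
    using fin levelsD(1)[OF _ n1] by (auto simp: hi_def near_def)
  have split: "error_part (levels n) n f x \<omega> = error_part lo n f x \<omega> + ?H x" if x: "x \<in> ?I" for x
  proof -
    have x01: "x \<in> {0..1}" using x I by blast
    have "(\<Sum>j\<in>hi. \<Sum>k=1..2^j. err n f j k \<omega> * \<psi> j k x) = (\<Sum>j\<in>hi. \<Sum>k\<in>near j. err n f j k \<omega> * \<psi> j k x)"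
    proof (rule sum.cong[OF refl])
      fix j assume j: "j \<in> hi"
      have jj: "j \<ge> j0" using j levelsD(1)[OF _ n1] by (auto simp: hi_def)
      have far: "err n f j k \<omega> * \<psi> j k x = 0" if k: "k \<in> {1..2^j}" "k \<notin> near j" for k
      proof (rule ccontr)
        assume "err n f j k \<omega> * \<psi> j k x \<noteq> 0"
        then have 1: "\<bar>2^j * x - real k\<bar> \<le> R" using wavelet_support[OF jj k(1) x01] by simp
        have "2^j * \<bar>x0 - x\<bar> \<le> 2^j * c" using x by (intro mult_left_mono) auto
        then have "\<bar>2^j * x0 - 2^j * x\<bar> \<le> 2^j * c" by (simp add: right_diff_distrib[symmetric] abs_mult)
        with 1 have "\<bar>2^j * x0 - real k\<bar> \<le> 2^j * c + R" by linarith
        then show False using k by (simp add: near_def)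
      qed
      show "(\<Sum>k=1..2^j. err n f j k \<omega> * \<psi> j k x) = (\<Sum>k\<in>near j. err n f j k \<omega> * \<psi> j k x)"
        by (rule sum.mono_neutral_right) (use far in \<open>auto simp: near_def\<close>)
    qed
    also have "\<dots> = ?H x" using fin by (intro sum.Sigma) auto
    finally show ?thesis
      unfolding error_part_def union(1) using union(2) fin by (simp add: sum.union_disjoint)
  qed
  have restr: "(\<integral>\<^sup>+x\<in>?I. h x \<partial>lborel) = (\<integral>\<^sup>+x. h x * indicator ?I x \<partial>unit_lebesgue)" for h :: "real \<Rightarrow> ennreal"
    unfolding set_nn_integral_unit[symmetric] using I by (intro nn_integral_cong) (auto split: split_indicator)
  have [measurable]: "(indicator ?I :: real \<Rightarrow> ennreal) \<in> borel_measurable unit_lebesgue"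
    by (intro measurable_restrict_space1) simp
  have jj: "j \<ge> j0" if "j \<in> lo" for j using that levelsD(1)[OF _ n1] by (auto simp: lo_def)
  have [measurable]: "(\<lambda>x. error_part lo n f x \<omega>) \<in> borel_measurable unit_lebesgue"
    unfolding error_part_def
    by (intro continuous_on_unit_measurable continuous_on_add continuous_on_diff continuous_on_sum continuous_on_mult
        continuous_on_const scaling_continuous wavelet_continuous partial_expansion_continuous f jj) auto
  have [measurable]: "?H \<in> borel_measurable unit_lebesgue"
    unfolding case_prod_beta
    by (intro continuous_on_unit_measurable continuous_on_sum continuous_on_mult continuous_on_const wavelet_continuous)
      (use A(2) in auto)
  have "(\<integral>\<^sup>+x\<in>?I. ennreal ((error_part (levels n) n f x \<omega>)\<^sup>2) \<partial>lborel)
    \<le> (\<integral>\<^sup>+x. 2 * (ennreal ((error_part lo n f x \<omega>)\<^sup>2) * indicator ?I x) + 2 * (ennreal ((?H x)\<^sup>2) * indicator ?I x) \<partial>unit_lebesgue)"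
    unfolding restr
  proof (rule nn_integral_mono)
    fix x
    show "ennreal ((error_part (levels n) n f x \<omega>)\<^sup>2) * indicator ?I x
      \<le> 2 * (ennreal ((error_part lo n f x \<omega>)\<^sup>2) * indicator ?I x) + 2 * (ennreal ((?H x)\<^sup>2) * indicator ?I x)"
    proof (cases "x \<in> ?I")
      case True
      have "(a + b)\<^sup>2 \<le> 2 * a\<^sup>2 + 2 * b\<^sup>2" for a b :: real
        using sum_squares_bound[of a b] unfolding power2_sum by linarith
      then have "ennreal ((error_part lo n f x \<omega> + ?H x)\<^sup>2) \<le> ennreal (2 * (error_part lo n f x \<omega>)\<^sup>2 + 2 * (?H x)\<^sup>2)"
        by (rule ennreal_leI)
      also have "\<dots> = 2 * ennreal ((error_part lo n f x \<omega>)\<^sup>2) + 2 * ennreal ((?H x)\<^sup>2)" by (simp add: ennreal_mult)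
      finally show ?thesis using True by (simp only: split[OF True]) simp
    qed simp
  qed
  also have "\<dots> = 2 * (\<integral>\<^sup>+x. ennreal ((error_part lo n f x \<omega>)\<^sup>2) * indicator ?I x \<partial>unit_lebesgue)
      + 2 * (\<integral>\<^sup>+x. ennreal ((?H x)\<^sup>2) * indicator ?I x \<partial>unit_lebesgue)"
    by (subst nn_integral_add) (simp_all add: nn_integral_cmult)
  also have "\<dots> \<le> 2 * (\<integral>\<^sup>+x. ennreal ((error_part lo n f x \<omega>)\<^sup>2) * indicator ?I x \<partial>unit_lebesgue)
      + 2 * (\<integral>\<^sup>+x. ennreal ((?H x)\<^sup>2) \<partial>unit_lebesgue)"
    by (intro add_mono order_refl mult_left_mono nn_integral_mono) (auto split: split_indicator)
  also have "(\<integral>\<^sup>+x. ennreal ((?H x)\<^sup>2) \<partial>unit_lebesgue) = ennreal (\<Sum>(j, k)\<in>?A. (err n f j k \<omega>)\<^sup>2)"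
    by (rule nn_integral_wavelet_sum_square[OF A])
  also have "\<dots> = (\<Sum>(j, k)\<in>?A. ennreal ((err n f j k \<omega>)\<^sup>2))"
    by (subst sum_ennreal[symmetric]) (auto intro!: sum.cong)
  also have "\<dots> = (\<Sum>j\<in>hi. \<Sum>k\<in>near j. ennreal ((err n f j k \<omega>)\<^sup>2))"
    using fin by (intro sum.Sigma[symmetric]) auto
  finally show ?thesis unfolding restr[symmetric] .
qed

text \<open>
  Coarse levels, $2^j \le 1/c$, by adding root mean squares at each point: the sum of $2^{j/2}$ is of order $c^{-1/2}$.  Fine levels by
  \<open>high_level_error\<close>, summed over the levels.
\<close>

lemma local_risk_bound:
  "\<exists>D>0. \<forall>n\<ge>27. \<forall>f\<in>holder_class \<alpha> M. \<forall>x0. \<forall>c>0. {x0 - c..x0 + c} \<subseteq> {0..1} \<longrightarrow>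
     local_risk P (block_js P \<phi>I \<psi> j0 n (observation B n f)) f x0 c
       \<le> ennreal (D * (real n powr (- (2 * (\<alpha> * s))) + ln (real n) * ln (ln (real n)) / (real n * c)))"
proof -
  obtain A \<kappa>' where eb: "coeff_error_bounds A \<kappa>'" using coeff_error_bounds_exist by blast
  note A = coeff_error_boundsD(1)[OF eb]
  obtain D2 \<kappa> where D2: "D2 > 0" and \<kappa>: "\<kappa> \<ge> 1" and high: "\<forall>n\<ge>3. \<forall>f\<in>holder_class \<alpha> M. \<forall>j\<in>levels n. \<forall>c>0. \<forall>x0. 1 / c < 2 ^ j \<longrightarrow>
     (\<Sum>k\<in>{k\<in>{1..2^j}. \<bar>2^j * x0 - real k\<bar> \<le> 2^j * c + R}. mean_square P (err n f j k))
     \<le> ennreal (D2 * (2 ^ j * (of_bool (2 ^ j \<le> (\<kappa> * real n) powr s) * (c / real n))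
        + of_bool (2 ^ j * c \<le> ln (real n)) * (ln (real n) / real n)
        + 2 powr (- 2 * \<alpha> * real j) * (of_bool ((\<kappa> * real n) powr s < 2 ^ j) * c)
        + 2 ^ j * (c * real n powr (- 2 + s))))"
    using high_level_error by blast
  define c1 where "c1 = 1 / (1 - 2 powr (- (1/2)) :: real)"
  define c3 where "c3 = 1 / (1 - 2 powr (- (2 * \<alpha>)))"
  have cpos: "c1 > 0" "c3 > 0" using two_powr_less_1[of "1/2"] two_powr_less_1[of "2 * \<alpha>"] \<alpha> by (auto simp: c1_def c3_def)
  define Elo where "Elo = error_const * (2 + A * c1\<^sup>2)"
  define Ehi where "Ehi = D2 * (2 * \<kappa> powr s + c3 + 5)"
  define D where "D = 2 * Elo + Ehi"
  have E: "Elo > 0" "Ehi > 0" "D > 0" using error_const_pos D2 A cpos by (auto simp: Elo_def Ehi_def D_def intro!: add_pos_nonneg mult_pos_pos add_nonneg_pos)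
  show ?thesis
  proof (rule exI[of _ D], rule conjI[OF E(3)], intro allI impI ballI)
    fix n :: nat and f :: "real \<Rightarrow> real" and x0 c :: real
    assume n27: "n \<ge> 27" and f: "f \<in> holder_class \<alpha> M" and c: "c > 0" and I: "{x0 - c..x0 + c} \<subseteq> {0..1}"
    have n: "n \<ge> 1" "n \<ge> 2" "n \<ge> 3" using n27 by auto
    note cf = holder_class_continuous[OF f \<alpha> M]
    define N where "N = real n"
    define L where "L = ln N"
    \<comment> \<open>$27 = 3^3$ makes $\log n$ at least 3, hence $\log\log n$ at least 1\<close>
    have N: "N \<ge> 27" using n27 by (simp add: N_def)
    have L3: "L \<ge> 3"
    proof -
      have "ln (3::real) \<ge> 1" using ln_ge_iff[of 3 1] exp_le by simp
      moreover have "ln (27::real) = 3 * ln 3" using ln_realpow[of 3 3] by simp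
      moreover have "ln 27 \<le> L" using N by (simp add: L_def)
      ultimately show ?thesis by linarith
    qed
    have lnL: "ln L \<ge> 1" using ln_ge_iff[of L 1] exp_le L3 by simp
    \<comment> \<open>the interval lies in $[0,1]$\<close>
    have c1': "c \<le> 1"
    proof -
      have "x0 - c \<in> {0..1}" "x0 + c \<in> {0..1}" using I c by auto
      then show ?thesis by auto
    qed
    define Q where "Q = N powr (- (2 * (\<alpha> * s)))"
    define Z where "Z = L * ln L / (N * c)"
    have QZ: "Q > 0" "Z > 0" using N c L3 lnL by (auto simp: Q_def Z_def)
    define lo where "lo = {j\<in>levels n. 2 ^ j \<le> 1 / c}"
    define hi where "hi = {j\<in>levels n. 1 / c < 2 ^ j}"
    define near where "near j = {k\<in>{1..2^j}. \<bar>2^j * x0 - real k\<bar> \<le> 2^j * c + R}" for j :: nat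
    have lolev: "lo \<subseteq> levels n" and hilev: "hi \<subseteq> levels n" and finhi: "finite hi" by (auto simp: lo_def hi_def)
    have lo_bound: "mean_square P (error_part lo n f x) \<le> ennreal (Elo * (Q + Z))" if x: "x \<in> {0..1}" for x
    proof -
      let ?g = "\<lambda>_ :: nat. sqrt (A * (L / N))"
      have g: "A * (L / N) > 0" using A L3 N by simp
      have "mean_square P (error_part lo n f x) \<le> ennreal (error_const * (1 / real n + (\<Sum>j\<in>lo. 2 powr (real j / 2) * ?g j)\<^sup>2 + real n powr (- 2 * \<alpha>)))"
      proof (rule error_part_mean_square)
        show "?g j > 0" for j using g by simp
        fix j k :: nat assume "j \<in> lo" "k \<in> {1..2^j}"
        then have "mean_square P (err n f j k) \<le> ennreal (A * (ln (real n) / real n))" using coeff_error_boundsD(3)[OF eb n(3) f] lolev by blast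
        then show "mean_square P (err n f j k) \<le> ennreal ((?g j)\<^sup>2)" using g by (simp add: L_def N_def)
      qed (use n f x lolev in auto)
      also have "\<dots> \<le> ennreal (Elo * (Q + Z))"
      proof (rule ennreal_leI)
        have "(\<Sum>j\<in>lo. 2 powr (real j / 2)) \<le> (1 / c) powr (1/2) * c1"
          unfolding lo_def c1_def by (rule half_powr_sum_low) (use c in auto)
        then have "(\<Sum>j\<in>lo. 2 powr (real j / 2) * ?g j) \<le> ((1 / c) powr (1/2) * c1) * sqrt (A * (L / N))"
          unfolding sum_distrib_right[symmetric] by (rule mult_right_mono) (use g in simp)
        then have "(\<Sum>j\<in>lo. 2 powr (real j / 2) * ?g j)\<^sup>2 \<le> (((1 / c) powr (1/2) * c1) * sqrt (A * (L / N)))\<^sup>2"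
          using g by (intro power_mono sum_nonneg) auto
        also have "\<dots> = A * c1\<^sup>2 * (L / (N * c))"
        proof -
          have "((1 / c) powr (1/2))\<^sup>2 = 1 / c" using c by (simp add: power2_eq_square powr_add[symmetric])
          moreover have "(sqrt (A * (L / N)))\<^sup>2 = A * (L / N)" using g by simp
          ultimately show ?thesis by (simp add: power_mult_distrib mult.commute mult.left_commute)
        qed
        also have "\<dots> \<le> A * c1\<^sup>2 * Z"
          unfolding Z_def using A L3 N c lnL by (intro mult_left_mono divide_right_mono) auto
        finally have 1: "(\<Sum>j\<in>lo. 2 powr (real j / 2) * ?g j)\<^sup>2 \<le> A * c1\<^sup>2 * Z" .
        have "1 / N \<le> 1 / (N * c)" using N c c1' by (intro divide_left_mono) (auto simp: mult_left_le)
        also have "\<dots> \<le> Z" unfolding Z_def using L3 lnL N c mult_mono[of 1 L 1 "ln L"] by (intro divide_right_mono) auto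
        finally have 2: "1 / real n \<le> Z" by (simp add: N_def)
        have 3: "real n powr (- 2 * \<alpha>) \<le> Q" unfolding Q_def N_def[symmetric]
          using N s_props(6) by (intro powr_mono) auto
        have "1 / real n + (\<Sum>j\<in>lo. 2 powr (real j / 2) * ?g j)\<^sup>2 + real n powr (- 2 * \<alpha>) \<le> Z + A * c1\<^sup>2 * Z + Q"
          using 1 2 3 by linarith
        also have "\<dots> \<le> (2 + A * c1\<^sup>2) * (Q + Z)" using A QZ by (simp add: algebra_simps)
        finally show "error_const * (1 / real n + (\<Sum>j\<in>lo. 2 powr (real j / 2) * ?g j)\<^sup>2 + real n powr (- 2 * \<alpha>)) \<le> Elo * (Q + Z)"
          unfolding Elo_def mult.assoc using error_const_pos by (intro mult_left_mono) auto
      qed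
      finally show ?thesis .
    qed
    define X2 where "X2 = (\<kappa> * N) powr s"
    have X2: "X2 > 0" using \<kappa> N by (simp add: X2_def)
    define b where "b j = 2 ^ j * (of_bool (2 ^ j \<le> X2) * (c / N))
        + 1 * (of_bool (2 ^ j * c \<le> L) * (L / N))
        + 2 powr (- 2 * \<alpha> * real j) * (of_bool (X2 < 2 ^ j) * c)
        + 2 ^ j * (of_bool (2 ^ j \<le> N) * (c * N powr (- 2 + s)))" for j :: nat
    have hi_bound: "(\<Sum>j\<in>hi. \<Sum>k\<in>near j. mean_square P (err n f j k)) \<le> ennreal (c * Ehi * (Q + Z))"
    proof -
      have "(\<Sum>j\<in>hi. \<Sum>k\<in>near j. mean_square P (err n f j k)) \<le> (\<Sum>j\<in>hi. ennreal (D2 * b j))"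
      proof (rule sum_mono)
        fix j assume "j \<in> hi"
        then have j: "j \<in> levels n" "1 / c < 2 ^ j" by (auto simp: hi_def)
        have "2 ^ j \<le> N" using levelsD(3)[OF j(1) n(1)] by (simp add: N_def)
        then show "(\<Sum>k\<in>near j. mean_square P (err n f j k)) \<le> ennreal (D2 * b j)"
          using high[rule_format, OF n(3) f j(1) c j(2), of x0]
          by (simp only: near_def b_def X2_def L_def N_def of_bool_eq(2) mult_1_left simp_thms)
      qed
      also have "\<dots> = ennreal (D2 * (\<Sum>j\<in>hi. b j))"
      proof -
        have "b j \<ge> 0" for j unfolding b_def using c N L3 by (intro add_nonneg_nonneg mult_nonneg_nonneg) auto
        then show ?thesis using D2 by (subst sum_ennreal) (auto simp: sum_distrib_left)
      qed
      also have "\<dots> \<le> ennreal (c * Ehi * (Q + Z))"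
      proof (rule ennreal_leI)
        have "(\<Sum>j\<in>hi. b j) = (c / N) * (\<Sum>j\<in>{j\<in>hi. 2 ^ j \<le> X2}. 2 ^ j)
          + (L / N) * (\<Sum>j\<in>{j\<in>hi. 2 ^ j * c \<le> L}. 1)
          + c * (\<Sum>j\<in>{j\<in>hi. X2 < 2 ^ j}. 2 powr (- 2 * \<alpha> * real j))
          + (c * N powr (- 2 + s)) * (\<Sum>j\<in>{j\<in>hi. 2 ^ j \<le> N}. 2 ^ j)"
          unfolding b_def sum.distrib sum_filtered[OF finhi] ..
        also have "\<dots> \<le> (c / N) * (2 * X2) + (L / N) * (3 * ln L) + c * (X2 powr (- (2 * \<alpha>)) * c3) + (c * N powr (- 2 + s)) * (2 * N)"
        proof (intro add_mono mult_left_mono)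
          have low: "(\<Sum>j\<in>{j\<in>hi. 2 ^ j \<le> X}. 2 ^ j) \<le> 2 * X" if "X > 0" for X :: real
            using geometric_sum_low[OF finhi zero_less_one that] that by (simp add: powr_realpow powr_minus)
          show "(\<Sum>j\<in>{j\<in>hi. 2 ^ j \<le> X2}. 2 ^ j) \<le> 2 * X2" "(\<Sum>j\<in>{j\<in>hi. 2 ^ j \<le> N}. 2 ^ j) \<le> 2 * N"
            using X2 N by (auto intro!: low)
          have "{j\<in>hi. 2 ^ j * c \<le> L} = {j\<in>levels n. 1 / c < 2 ^ j \<and> 2 ^ j * c \<le> L}" by (auto simp: hi_def)
          then show "(\<Sum>j\<in>{j\<in>hi. 2 ^ j * c \<le> L}. 1) \<le> 3 * ln L"
            using card_levels_window[OF finite_levels c _ lnL, of n] L3 by simp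
          show "(\<Sum>j\<in>{j\<in>hi. X2 < 2 ^ j}. 2 powr (- 2 * \<alpha> * real j)) \<le> X2 powr (- (2 * \<alpha>)) * c3"
            using geometric_sum_high[OF finhi _ X2, of "2 * \<alpha>"] \<alpha> by (simp add: c3_def)
        qed (use c N L3 in auto)
        also have "\<dots> \<le> c * (2 * \<kappa> powr s * Q) + c * (3 * Z) + c * (Q * c3) + c * (2 * Q)"
        proof (intro add_mono)
          have Q1: "Q = N powr (- 1 + s)" 
          proof -
            have "- (2 * (\<alpha> * s)) = - 1 + s" using s_props(3) by simp
            then show ?thesis by (simp only: Q_def)
          qed
          have N1: "N powr s / N = Q" using N unfolding Q1 by (simp add: powr_diff)
          have "X2 / N = \<kappa> powr s * Q" using \<kappa> N by (simp add: X2_def powr_mult N1[symmetric])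
          moreover have "(c / N) * (2 * X2) = c * (2 * (X2 / N))" by simp
          ultimately show "(c / N) * (2 * X2) \<le> c * (2 * \<kappa> powr s * Q)" by (simp only: mult.assoc order_refl)
          show "(L / N) * (3 * ln L) \<le> c * (3 * Z)" using c by (simp add: Z_def mult.left_commute)
          have "X2 powr (- (2 * \<alpha>)) = (\<kappa> * N) powr (- (2 * (\<alpha> * s)))"
            by (simp add: X2_def powr_powr ac_simps)
          also have "\<dots> \<le> N powr (- (2 * (\<alpha> * s)))"
            using \<kappa> N s_props mult_right_mono[of 1 \<kappa> N] by (intro powr_mono2') auto
          finally have "X2 powr (- (2 * \<alpha>)) \<le> Q" by (simp add: Q_def)
          then show "c * (X2 powr (- (2 * \<alpha>)) * c3) \<le> c * (Q * c3)" using c cpos by (intro mult_left_mono mult_right_mono) auto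
          have "N powr (- 2 + s) * N = Q"
          proof -
            have "N powr (- 2 + s) * N powr 1 = N powr (- 2 + s + 1)" by (rule powr_add[symmetric])
            then show ?thesis using N by (simp add: Q1)
          qed
          moreover have "c * N powr (- 2 + s) * (2 * N) = c * (2 * (N powr (- 2 + s) * N))" by (simp only: ac_simps)
          ultimately show "c * N powr (- 2 + s) * (2 * N) \<le> c * (2 * Q)" by (simp only: order_refl)
        qed
        also have "\<dots> \<le> c * ((2 * \<kappa> powr s + c3 + 5) * (Q + Z))"
        proof -
          have "2 * \<kappa> powr s * Q + 3 * Z + Q * c3 + 2 * Q \<le> (2 * \<kappa> powr s + c3 + 5) * (Q + Z)"
          proof -
            have "0 \<le> 2 * \<kappa> powr s * Z + c3 * Z + 3 * Q + 2 * Z" using QZ cpos by (intro add_nonneg_nonneg mult_nonneg_nonneg) auto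
            then show ?thesis by (simp add: algebra_simps)
          qed
          then have "c * (2 * \<kappa> powr s * Q + 3 * Z + Q * c3 + 2 * Q) \<le> c * ((2 * \<kappa> powr s + c3 + 5) * (Q + Z))"
            using c by (intro mult_left_mono) auto
          then show ?thesis by (simp only: distrib_left)
        qed
        finally have "(\<Sum>j\<in>hi. b j) \<le> c * ((2 * \<kappa> powr s + c3 + 5) * (Q + Z))" .
        then have "D2 * (\<Sum>j\<in>hi. b j) \<le> D2 * (c * ((2 * \<kappa> powr s + c3 + 5) * (Q + Z)))" using D2 by (intro mult_left_mono) auto
        also have "\<dots> = c * Ehi * (Q + Z)" unfolding Ehi_def by (simp only: ac_simps)
        finally show "D2 * (\<Sum>j\<in>hi. b j) \<le> c * Ehi * (Q + Z)" .
      qed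
      finally show ?thesis .
    qed
    have em: "(\<lambda>\<omega>. ennreal ((err n f j k \<omega>)\<^sup>2)) \<in> borel_measurable P" if "j \<in> hi" "k \<in> near j" for j k
    proof -
      have j: "j \<in> levels n" using that hilev by blast
      have [measurable]: "err n f j k \<in> borel_measurable P"
        using that(2) by (intro err_measurable[OF n(1) cf levelsD(1,2)[OF j n(1)] n(2)]) (auto simp: near_def)
      show ?thesis by measurable
    qed
    have Fm: "(\<lambda>\<omega>. \<integral>\<^sup>+x\<in>{x0 - c..x0 + c}. ennreal ((error_part lo n f x \<omega>)\<^sup>2) \<partial>lborel) \<in> borel_measurable P" (is "?F \<in> _")
      by (rule local_error_measurable[OF n(2) cf lolev I])
    have Hm: "(\<lambda>\<omega>. \<Sum>j\<in>hi. \<Sum>k\<in>near j. ennreal ((err n f j k \<omega>)\<^sup>2)) \<in> borel_measurable P" (is "?H \<in> _")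
      by (intro borel_measurable_sum em)
    have "(\<integral>\<^sup>+\<omega>. (\<integral>\<^sup>+x\<in>{x0 - c..x0 + c}. ennreal ((error_part (levels n) n f x \<omega>)\<^sup>2) \<partial>lborel) \<partial>P)
      \<le> (\<integral>\<^sup>+\<omega>. 2 * ?F \<omega> + 2 * ?H \<omega> \<partial>P)"
      unfolding lo_def hi_def near_def by (intro nn_integral_mono local_error_split[OF n(2) cf c I])
    also have "\<dots> = 2 * (\<integral>\<^sup>+\<omega>. ?F \<omega> \<partial>P) + 2 * (\<integral>\<^sup>+\<omega>. ?H \<omega> \<partial>P)"
      using Fm Hm by (subst nn_integral_add) (simp_all add: nn_integral_cmult)
    also have "(\<integral>\<^sup>+\<omega>. ?H \<omega> \<partial>P) = (\<Sum>j\<in>hi. \<Sum>k\<in>near j. mean_square P (err n f j k))"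
      unfolding mean_square_def
      by (subst nn_integral_sum, intro borel_measurable_sum em, assumption, assumption, intro sum.cong refl, rule nn_integral_sum, rule em)
    also have "2 * (\<integral>\<^sup>+\<omega>. ?F \<omega> \<partial>P) + 2 * (\<Sum>j\<in>hi. \<Sum>k\<in>near j. mean_square P (err n f j k))
      \<le> 2 * ennreal (((x0 + c) - (x0 - c)) * (Elo * (Q + Z))) + 2 * ennreal (c * Ehi * (Q + Z))"
      using c E QZ by (intro add_mono mult_left_mono hi_bound local_integral_swap[OF n(2) cf lolev I] lo_bound) auto
    also have "\<dots> = ennreal (2 * c * (D * (Q + Z)))"
    proof -
      have sum2: "2 * ennreal x + 2 * ennreal y = ennreal (2 * x + 2 * y)" if "x \<ge> 0" "y \<ge> 0" for x y
        using that by (simp add: ennreal_mult)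
      have nonneg: "((x0 + c) - (x0 - c)) * (Elo * (Q + Z)) \<ge> 0" "c * Ehi * (Q + Z) \<ge> 0" using c E QZ by auto
      have eq: "2 * (((x0 + c) - (x0 - c)) * (Elo * (Q + Z))) + 2 * (c * Ehi * (Q + Z)) = 2 * c * (D * (Q + Z))"
        by (simp add: D_def algebra_simps)
      show ?thesis unfolding sum2[OF nonneg] eq ..
    qed
    finally have "local_risk P (block_js P \<phi>I \<psi> j0 n (observation B n f)) f x0 c \<le> ennreal (1 / (2 * c)) * ennreal (2 * c * (D * (Q + Z)))"
      using c by (simp only: local_risk_def block_js_error[OF n(1)] if_True) (rule mult_left_mono, simp_all)
    also have "\<dots> = ennreal (D * (Q + Z))" using c E QZ by (simp add: ennreal_mult[symmetric])
    finally show "local_risk P (block_js P \<phi>I \<psi> j0 n (observation B n f)) f x0 c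
       \<le> ennreal (D * (real n powr (- (2 * (\<alpha> * s))) + ln (real n) * ln (ln (real n)) / (real n * c)))"
      unfolding Q_def Z_def L_def N_def .
  qed
qed

end

section \<open>The three regimes of neighbourhoods\<close>

theorem theorem4:
  fixes P :: "'w measure"
    and B :: "real \<Rightarrow> 'w \<Rightarrow> real"
    and \<phi> \<psi> :: "real \<Rightarrow> real"
    and \<phi>I \<psi>I :: "nat \<Rightarrow> nat \<Rightarrow> real \<Rightarrow> real"
    and r j\<^sub>0 :: nat
    and \<alpha> M x\<^sub>0 :: real
    and c d :: "nat \<Rightarrow> real"
  assumes "brownian_motion P B"
    and "\<alpha> > 0" and "M > 0"
    and "wavelet_pair \<phi> \<psi>"
    and "regular_wavelet r \<psi>" and "real r > \<alpha>"
    and "interval_wavelet_basis \<phi> \<psi> r j\<^sub>0 \<phi>I \<psi>I"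
    and "0 < x\<^sub>0" and "x\<^sub>0 < 1"
    and "\<And>n. n \<ge> 1 \<Longrightarrow> d n \<ge> 0"
    and "\<And>n. n \<ge> 1 \<Longrightarrow> c n = d n * real n powr (- 1 / (1 + 2 * \<alpha>))"
    and "\<And>n. n \<ge> 1 \<Longrightarrow> {x\<^sub>0 - c n..x\<^sub>0 + c n} \<subseteq> {0..1}"
  shows
    "(limsup (\<lambda>n. ereal (d n * ln (real n) powr (- 1 / (1 + 2 * \<alpha>)))) < \<infinity> \<longrightarrow>
        limsup (\<lambda>n. ennreal ((real n / ln (real n)) powr (2 * \<alpha> / (1 + 2 * \<alpha>))) *
          (SUP f\<in>holder_class \<alpha> M.
             local_risk P (block_js P \<phi>I \<psi>I j\<^sub>0 n (observation B n f)) f x\<^sub>0 (c n))) < \<infinity>) \<and>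
     (liminf (\<lambda>n. ereal (d n * ln (real n) powr (- 1 / (1 + 2 * \<alpha>)))) = \<infinity> \<and>
      limsup (\<lambda>n. ereal (d n * inverse (ln (real n) * ln (ln (real n))))) = 0 \<longrightarrow>
        limsup (\<lambda>n. ennreal (real n powr (2 * \<alpha> / (1 + 2 * \<alpha>)) *
              (d n / (ln (real n) * ln (ln (real n))))) *
          (SUP f\<in>holder_class \<alpha> M.
             local_risk P (block_js P \<phi>I \<psi>I j\<^sub>0 n (observation B n f)) f x\<^sub>0 (c n))) < \<infinity>) \<and>
     (liminf (\<lambda>n. ereal (d n * inverse (ln (real n) * ln (ln (real n))))) > 0 \<longrightarrow>
        limsup (\<lambda>n. ennreal (real n powr (2 * \<alpha> / (1 + 2 * \<alpha>))) *
          (SUP f\<in>holder_class \<alpha> M.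
             local_risk P (block_js P \<phi>I \<psi>I j\<^sub>0 n (observation B n f)) f x\<^sub>0 (c n))) < \<infinity>)"
proof -
  obtain R C where ws: "wavelet_system (\<phi>I j\<^sub>0) \<psi>I r j\<^sub>0 R C"
    using wavelet_system_of_basis[OF assms(4,7)] .
  interpret wavelet_system "\<phi>I j\<^sub>0" \<psi>I r j\<^sub>0 R C by (rule ws)
  interpret holder_estimation \<phi>I \<psi>I r j\<^sub>0 R C P B \<alpha> M
    by unfold_locales (use assms in auto)
  let ?risk = "\<lambda>n. SUP f\<in>holder_class \<alpha> M. local_risk P (block_js P \<phi>I \<psi>I j\<^sub>0 n (observation B n f)) f x\<^sub>0 (c n)"
  let ?\<beta> = "2 * \<alpha> / (1 + 2 * \<alpha>)"
  have \<beta>: "2 * (\<alpha> * s) = ?\<beta>" by (simp add: s_def)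
  have c0: "c n \<ge> 0" if "n \<ge> 1" for n using assms(10,11)[OF that] by simp
  obtain D1 where D1: "D1 > 0" and pt: "\<And>n. n \<ge> 3 \<Longrightarrow> ?risk n \<le> ennreal (D1 * (ln (real n) / real n) powr ?\<beta>)"
  proof -
    obtain D where D: "D > 0" and *: "\<forall>n\<ge>3. \<forall>f\<in>holder_class \<alpha> M. \<forall>x0 c. c \<ge> 0 \<longrightarrow> {x0 - c..x0 + c} \<subseteq> {0..1} \<longrightarrow>
      local_risk P (block_js P \<phi>I \<psi>I j\<^sub>0 n (observation B n f)) f x0 c \<le> ennreal (D * (ln (real n) / real n) powr (2 * (\<alpha> * s)))"
      using pointwise_risk_bound by blast
    have "?risk n \<le> ennreal (D * (ln (real n) / real n) powr ?\<beta>)" if "n \<ge> 3" for n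
      using *[rule_format, OF that _ c0 assms(12), of _] that unfolding \<beta> by (intro SUP_least) auto
    with D show ?thesis by (rule that)
  qed
  obtain D2 where D2: "D2 > 0" and loc: "\<And>n. n \<ge> 27 \<Longrightarrow> d n > 0 \<Longrightarrow>
     ?risk n \<le> ennreal (D2 * (real n powr (- ?\<beta>) * (1 + ln (real n) * ln (ln (real n)) / d n)))"
  proof -
    obtain D where D: "D > 0" and *: "\<forall>n\<ge>27. \<forall>f\<in>holder_class \<alpha> M. \<forall>x0. \<forall>c>0. {x0 - c..x0 + c} \<subseteq> {0..1} \<longrightarrow>
       local_risk P (block_js P \<phi>I \<psi>I j\<^sub>0 n (observation B n f)) f x0 c
       \<le> ennreal (D * (real n powr (- (2 * (\<alpha> * s))) + ln (real n) * ln (ln (real n)) / (real n * c)))"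
      using local_risk_bound by blast
    have "?risk n \<le> ennreal (D * (real n powr (- ?\<beta>) * (1 + ln (real n) * ln (ln (real n)) / d n)))"
      if n: "n \<ge> 27" and d: "d n > 0" for n
    proof -
      have n1: "n \<ge> 1" using n by simp
      have cn: "c n > 0" using assms(11)[OF n1] d n by simp
      have "real n * c n = d n * real n powr ?\<beta>"
      proof -
        have "real n * real n powr (- 1 / (1 + 2 * \<alpha>)) = real n powr (1 + - 1 / (1 + 2 * \<alpha>))"
          using n unfolding powr_add by simp
        moreover have "1 + - 1 / (1 + 2 * \<alpha>) = ?\<beta>" using assms(2) by (simp add: field_simps)
        ultimately show ?thesis unfolding assms(11)[OF n1] by (subst mult.left_commute) (simp only:)
      qed
      then have "ln (real n) * ln (ln (real n)) / (real n * c n) = real n powr (- ?\<beta>) * (ln (real n) * ln (ln (real n)) / d n)"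
        using d n by (simp add: powr_minus_divide field_simps)
      then have eq: "D * (real n powr (- (2 * (\<alpha> * s))) + ln (real n) * ln (ln (real n)) / (real n * c n))
         = D * (real n powr (- ?\<beta>) * (1 + ln (real n) * ln (ln (real n)) / d n))"
        unfolding \<beta> by (simp only: distrib_left mult_1_right)
      show ?thesis
        by (rule SUP_least) (rule *[rule_format, OF n _ cn assms(12)[OF n1], unfolded eq])
    qed
    with D show ?thesis by (rule that)
  qed
  have bounded: "limsup F < \<infinity>" if "eventually (\<lambda>n. F n \<le> ennreal b) sequentially" for F :: "nat \<Rightarrow> ennreal" and b
    by (rule le_less_trans[OF Limsup_bounded[OF that]]) simp
  have ev27: "eventually (\<lambda>n::nat. n \<ge> 27) sequentially" by (rule eventually_ge_at_top)
  have lls: "ln (real n) > 0" "ln (real n) * ln (ln (real n)) > 0" if "n \<ge> 27" for n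
  proof -
    have 1: "ln (real n) > 1"
    proof -
      have "exp 1 < (27::real)" using exp_le by simp
      then have "exp 1 < real n" using that by linarith
      then have "ln (exp 1) < ln (real n)" using that by (subst ln_less_cancel_iff) auto
      then show ?thesis by simp
    qed
    then show "ln (real n) > 0" "ln (real n) * ln (ln (real n)) > 0" by auto
  qed
  have scaled: "ennreal x * ?risk n \<le> ennreal (x * y)" if "?risk n \<le> ennreal y" "x \<ge> 0" for n x y
  proof -
    have "ennreal x * ?risk n \<le> ennreal x * ennreal y" using that(1) by (rule mult_left_mono) simp
    also have "\<dots> = ennreal (x * y)" using that(2) by (simp add: ennreal_mult')
    finally show ?thesis .
  qed
  have case1: "limsup (\<lambda>n. ennreal ((real n / ln (real n)) powr ?\<beta>) * ?risk n) < \<infinity>"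
  proof (rule bounded)
    show "eventually (\<lambda>n. ennreal ((real n / ln (real n)) powr ?\<beta>) * ?risk n \<le> ennreal D1) sequentially"
      using ev27
    proof eventually_elim
      case (elim n)
      have eq: "(real n / ln (real n)) powr ?\<beta> * (D1 * (ln (real n) / real n) powr ?\<beta>) = D1"
        using lls(1)[OF elim] elim by (simp add: powr_divide)
      have "n \<ge> 3" using elim by simp
      from scaled[OF pt[OF this], of "(real n / ln (real n)) powr ?\<beta>"] show ?case unfolding eq by simp
    qed
  qed
  have case2: "limsup (\<lambda>n. ennreal (real n powr ?\<beta> * (d n / (ln (real n) * ln (ln (real n))))) * ?risk n) < \<infinity>"
    if low: "liminf (\<lambda>n. ereal (d n * ln (real n) powr (- 1 / (1 + 2 * \<alpha>)))) = \<infinity>"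
      and up: "limsup (\<lambda>n. ereal (d n * inverse (ln (real n) * ln (ln (real n))))) = 0"
  proof (rule bounded)
    have "eventually (\<lambda>n. 0 < ereal (d n * ln (real n) powr (- 1 / (1 + 2 * \<alpha>)))) sequentially"
      by (rule less_LiminfD) (simp only: low, simp)
    moreover have "eventually (\<lambda>n. ereal (d n * inverse (ln (real n) * ln (ln (real n)))) < 1) sequentially"
      by (rule Limsup_lessD) (simp only: up, simp)
    ultimately show "eventually (\<lambda>n. ennreal (real n powr ?\<beta> * (d n / (ln (real n) * ln (ln (real n))))) * ?risk n \<le> ennreal (2 * D2)) sequentially"
      using ev27
    proof eventually_elim
      case (elim n)
      have d: "d n > 0" using elim(1) by (simp add: zero_less_mult_iff)
      let ?w = "ln (real n) * ln (ln (real n))"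
      note w = lls(2)[OF elim(3)]
      have lt: "d n / ?w < 1" using elim(2) by (simp add: divide_inverse one_ereal_def)
      have "real n powr ?\<beta> * (d n / ?w) * (D2 * (real n powr (- ?\<beta>) * (1 + ?w / d n)))
        = (real n powr ?\<beta> * real n powr (- ?\<beta>)) * (D2 * (d n / ?w * (1 + ?w / d n)))" by (simp only: ac_simps)
      also have "real n powr ?\<beta> * real n powr (- ?\<beta>) = 1" using elim(3) by (simp add: powr_add[symmetric])
      also have "d n / ?w * (1 + ?w / d n) = d n / ?w + 1"
      proof -
        have "x / w * (1 + w / x) = x / w + 1" if "x > 0" "w > 0" for x w :: real using that by (simp add: distrib_left)
        from this[OF d w] show ?thesis .
      qed
      also have "1 * (D2 * (d n / ?w + 1)) \<le> D2 * 2" using lt D2 by simp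
      finally have "real n powr ?\<beta> * (d n / ?w) * (D2 * (real n powr (- ?\<beta>) * (1 + ?w / d n))) \<le> 2 * D2" by simp
      then show ?case
        using d w by (intro order_trans[OF scaled[OF loc[OF elim(3) d]] ennreal_leI]) auto
    qed
  qed
  have case3: "limsup (\<lambda>n. ennreal (real n powr ?\<beta>) * ?risk n) < \<infinity>"
    if pos: "liminf (\<lambda>n. ereal (d n * inverse (ln (real n) * ln (ln (real n))))) > 0"
  proof -
    obtain \<kappa> where \<kappa>: "0 < ereal \<kappa>" "ereal \<kappa> < liminf (\<lambda>n. ereal (d n * inverse (ln (real n) * ln (ln (real n)))))"
      using ereal_dense2[OF pos] by blast
    from less_LiminfD[OF \<kappa>(2)] have ev: "eventually (\<lambda>n. ereal \<kappa> < ereal (d n * inverse (ln (real n) * ln (ln (real n))))) sequentially" .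
    have "eventually (\<lambda>n. ennreal (real n powr ?\<beta>) * ?risk n \<le> ennreal (D2 * (1 + 1 / \<kappa>))) sequentially"
      using ev ev27
    proof eventually_elim
      case (elim n)
      let ?w = "ln (real n) * ln (ln (real n))"
      note w = lls(2)[OF elim(2)]
      have k: "\<kappa> < d n / ?w" using elim(1) by (simp add: divide_inverse)
      have k0: "\<kappa> > 0" using \<kappa>(1) by simp
      have conv: "x > 0 \<and> w / x \<le> 1 / k" if "k < x / w" "k > 0" "w > 0" for x w k :: real
      proof -
        have kw: "k * w < x" using that by (simp add: pos_less_divide_eq)
        then have "x > 0" using that less_trans[OF mult_pos_pos kw] by blast
        then show ?thesis using kw that by (simp add: field_simps)
      qed
      from conv[OF k k0 w] have d: "d n > 0" and "?w / d n \<le> 1 / \<kappa>" by blast+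
      then have le: "D2 * (1 + ?w / d n) \<le> D2 * (1 + 1 / \<kappa>)" using D2 by simp
      have "real n powr ?\<beta> * (D2 * (real n powr (- ?\<beta>) * (1 + ?w / d n)))
        = (real n powr ?\<beta> * real n powr (- ?\<beta>)) * (D2 * (1 + ?w / d n))" by (simp only: ac_simps)
      also have "real n powr ?\<beta> * real n powr (- ?\<beta>) = 1" using elim(2) by (simp add: powr_add[symmetric])
      also have "1 * (D2 * (1 + ?w / d n)) \<le> D2 * (1 + 1 / \<kappa>)" using le by simp
      finally have "real n powr ?\<beta> * (D2 * (real n powr (- ?\<beta>) * (1 + ?w / d n))) \<le> D2 * (1 + 1 / \<kappa>)" .
      then show ?case by (intro order_trans[OF scaled[OF loc[OF elim(2) d]] ennreal_leI]) auto
    qed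
    then show ?thesis by (rule bounded)
  qed
  show ?thesis using case1 case2 case3 by blast
qed

end
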